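(* Let $G$ be a compact metrisable group, let $\mathcal{H}=L^2(G)$ with respect to Haar measure, and let $L$ be the left regular representation of $G$ on $\mathcal{H}$. Let $\mu$ be the counting measure on the dual $\widehat G$. Let $Q$ be a closable Hermitian quadratic form on a dense subspace $\mathcal{D}_0\subset\mathcal{H}$ with the property that for every $\Phi\in\mathcal{D}_0$ there is a $\Delta\subset\widehat G$ with $\mu(\Delta)<\infty$ and $P_\Delta\Phi=\Phi$. If $Q$ is invariant under $L$, i.e. $L(g)\Phi\in\mathcal{D}_0$ and $Q(L(g)\Phi)=Q(\Phi)$ for all $g\in G$ and $\Phi\in\mathcal{D}_0$, then $Q$ is strongly representable (by some self-adjoint operator).
   Context: $(L(g_0)\varphi)(g)=\varphi(g_0^{-1}g)$. $\widehat G$ is the set of unitary equivalence classes of irreducible unitary representations of $G$. By the Peter–Weyl theorem $L^2(G)=\bigoplus_{\alpha\in\widehat G}n(\alpha)\mathcal{H}^\alpha$ and $L=\bigoplus_{\alpha\in\widehat G}n(\alpha)L^\alpha$, where $\mathcal{H}^\alpha$ carries the irreducible representation labelled by $\alpha$, and the multiplicity is $n(\alpha)=\dim\mathcal{H}^\alpha<\infty$. For $\Delta\subset\widehat G$, $P_\Delta$ is the orthogonal projection of $L^2(G)$ onto $\bigoplus_{\alpha\in\Delta}n(\alpha)\mathcal{H}^\alpha$. A Hermitian quadratic form $Q$ on a dense subspace $\mathcal{D}\subset\mathcal{H}$ is the diagonal $Q(\Phi):=Q(\Phi,\Phi)$ of a sesquilinear form $Q:\mathcal{D}\times\mathcal{D}\to\mathbb{C}$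 (antilinear in the first entry, linear in the second) with $Q(\Phi,\Psi)=\overline{Q(\Psi,\Phi)}$. It is closable if for every sequence $\{\Phi_n\}\subset\mathcal{D}$ with $\Phi_n\to0$ in $\mathcal{H}$ and $\lim_{n,m\to\infty}Q(\Phi_n-\Phi_m)=0$ one has $\lim_nQ(\Phi_n)=0$. A form $\widehat Q$ on $\widehat{\mathcal{D}}$ extends $(Q,\mathcal{D})$ if $\mathcal{D}\subset\widehat{\mathcal{D}}\subset\mathcal{H}$ and $\widehat Q|_{\mathcal{D}}=Q$. Let $T$ be self-adjoint with resolution of the identity $E(\cdot)$ and $\nu_\Phi(\sigma)=\|E(\sigma)\Phi\|^2$. The spectral norm is $|||\Phi|||_E^2=\int_{\mathbb{R}}(1+|\lambda|)\,d\nu_\Phi(\lambda)$, $\Phi\in\mathcal{D}(|T|^{1/2})$. $(Q,\mathcal{D})$ is strongly representable by $T$ if (1) there is an extension $(\widehat Q,\widehat{\mathcal{D}})$ of $(Q,\mathcal{D})$ with $\mathcal{D}(T)\subset\widehat{\mathcal{D}}$, and $\mathcal{D}\subset\mathcal{D}(|T|^{1/2})$; (2) $\widehat{\mathcal{D}}$ is the closure of $\mathcal{D}$ (in $\mathcal{D}(|T|^{1/2})$) with respect to $|||\cdot|||_E$; (3) $\widehat Q(\Phi)=\int_{\mathbb{R}}\lambda\,d\nu_\Phi(\lambda)$ for all $\Phi\in\widehat{\mathcal{D}}$. *)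

theory Defs
  imports "HOL-Analysis.Analysis" "HOL-Algebra.Group"
begin

section \<open>Complex Hilbert spaces on explicit carriers\<close>

text \<open>Inner products are antilinear in the first and linear in the second argument.\<close>

record 'v inner_space = "'v partial_object" +
  vzero :: "'v"
  vplus :: "'v \<Rightarrow> 'v \<Rightarrow> 'v"
  vscale :: "complex \<Rightarrow> 'v \<Rightarrow> 'v"
  vinner :: "'v \<Rightarrow> 'v \<Rightarrow> complex"

definition vminus :: "'v inner_space \<Rightarrow> 'v \<Rightarrow> 'v \<Rightarrow> 'v" where
  "vminus H x y = vplus H x (vscale H (-1) y)"

definition vnorm :: "'v inner_space \<Rightarrow> 'v \<Rightarrow> real" where
  "vnorm H x = sqrt (Re (vinner H x x))"

text \<open>The locale \<open>Metric_space\<close> wants symmetry and nonnegativity of the distance on the whole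
  type, hence the default value outside the carrier.\<close>

definition vdist :: "'v inner_space \<Rightarrow> 'v \<Rightarrow> 'v \<Rightarrow> real" where
  "vdist H x y = (if x \<in> carrier H \<and> y \<in> carrier H then vnorm H (vminus H x y) else 0)"

definition vtopology :: "'v inner_space \<Rightarrow> 'v topology" where
  "vtopology H = Metric_space.mtopology (carrier H) (vdist H)"

locale inner_product_space =
  fixes H :: "'v inner_space"
  assumes plus_group:
      "comm_group \<lparr>carrier = carrier H, monoid.mult = vplus H, one = vzero H\<rparr>"
    and scale_closed: "x \<in> carrier H \<Longrightarrow> vscale H a x \<in> carrier H"
    and scale_plus_right: "x \<in> carrier H \<Longrightarrow> y \<in> carrier H \<Longrightarrow>
      vscale H a (vplus H x y) = vplus H (vscale H a x) (vscale H a y)"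
    and scale_plus_left: "x \<in> carrier H \<Longrightarrow>
      vscale H (a + b) x = vplus H (vscale H a x) (vscale H b x)"
    and scale_scale: "x \<in> carrier H \<Longrightarrow> vscale H a (vscale H b x) = vscale H (a * b) x"
    and scale_one: "x \<in> carrier H \<Longrightarrow> vscale H 1 x = x"
    and inner_commute: "x \<in> carrier H \<Longrightarrow> y \<in> carrier H \<Longrightarrow>
      vinner H x y = cnj (vinner H y x)"
    and inner_plus_right: "x \<in> carrier H \<Longrightarrow> y \<in> carrier H \<Longrightarrow> z \<in> carrier H \<Longrightarrow>
      vinner H x (vplus H y z) = vinner H x y + vinner H x z"
    and inner_scale_right: "x \<in> carrier H \<Longrightarrow> y \<in> carrier H \<Longrightarrow>
      vinner H x (vscale H a y) = a * vinner H x y"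
    and inner_nonneg: "x \<in> carrier H \<Longrightarrow> 0 \<le> Re (vinner H x x)"
    and inner_definite: "x \<in> carrier H \<Longrightarrow> vinner H x x = 0 \<Longrightarrow> x = vzero H"

locale hilbert_space = inner_product_space +
  assumes complete: "Metric_space.mcomplete (carrier H) (vdist H)"

definition linear_subspace :: "'v inner_space \<Rightarrow> 'v set \<Rightarrow> bool" where
  "linear_subspace H S \<longleftrightarrow> S \<subseteq> carrier H \<and> vzero H \<in> S \<and>
     (\<forall>x\<in>S. \<forall>y\<in>S. vplus H x y \<in> S) \<and> (\<forall>a. \<forall>x\<in>S. vscale H a x \<in> S)"

definition closed_subspace :: "'v inner_space \<Rightarrow> 'v set \<Rightarrow> bool" where
  "closed_subspace H S \<longleftrightarrow> linear_subspace H S \<and> closedin (vtopology H) S"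

definition dense_subspace :: "'v inner_space \<Rightarrow> 'v set \<Rightarrow> bool" where
  "dense_subspace H S \<longleftrightarrow> linear_subspace H S \<and> vtopology H closure_of S = carrier H"

definition closed_span :: "'v inner_space \<Rightarrow> 'v set \<Rightarrow> 'v set" where
  "closed_span H S = \<Inter>{W. closed_subspace H W \<and> S \<subseteq> W}"

definition linear_map_on ::
    "'v inner_space \<Rightarrow> 'v set \<Rightarrow> 'w inner_space \<Rightarrow> ('v \<Rightarrow> 'w) \<Rightarrow> bool" where
  "linear_map_on H D K A \<longleftrightarrow> A ` D \<subseteq> carrier K \<and>
     (\<forall>x\<in>D. \<forall>y\<in>D. A (vplus H x y) = vplus K (A x) (A y)) \<and>
     (\<forall>a. \<forall>x\<in>D. A (vscale H a x) = vscale K a (A x))"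

definition unitary_map :: "'v inner_space \<Rightarrow> 'w inner_space \<Rightarrow> ('v \<Rightarrow> 'w) \<Rightarrow> bool" where
  "unitary_map H K U \<longleftrightarrow> bij_betw U (carrier H) (carrier K) \<and> linear_map_on H (carrier H) K U \<and>
     (\<forall>x\<in>carrier H. \<forall>y\<in>carrier H. vinner K (U x) (U y) = vinner H x y)"

definition orth_proj :: "'v inner_space \<Rightarrow> 'v set \<Rightarrow> 'v \<Rightarrow> 'v" where
  "orth_proj H S x = (THE y. y \<in> S \<and> (\<forall>z\<in>S. vinner H z (vminus H x y) = 0))"


section \<open>Compact metrisable groups, Haar measure and the left regular representation\<close>

locale compact_metrisable_group = group G for G :: "('g, 'm) monoid_scheme" (structure) +
  fixes T :: "'g topology"
  assumes topspace_eq: "topspace T = carrier G"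
    and continuous_mult: "continuous_map (prod_topology T T) T (\<lambda>(x, y). x \<otimes> y)"
    and continuous_inv: "continuous_map T T (\<lambda>x. inv x)"
    and compact: "compact_space T"
    and metrisable: "metrizable_space T"

text \<open>Regularity is automatic: a finite Borel measure on a compact metrisable space is
  regular. The total mass is not normalised.\<close>

definition haar_measure ::
    "('g, 'm) monoid_scheme \<Rightarrow> 'g topology \<Rightarrow> 'g measure \<Rightarrow> bool" where
  "haar_measure G T M \<longleftrightarrow> sets M = sigma_sets (topspace T) {U. openin T U} \<and>
     finite_measure M \<and> emeasure M (space M) \<noteq> 0 \<and>
     (\<forall>g\<in>carrier G. \<forall>A\<in>sets M. emeasure M ((\<lambda>x. g \<otimes>\<^bsub>G\<^esub> x) ` A) = emeasure M A)"

definition square_integrable :: "'g measure \<Rightarrow> ('g \<Rightarrow> complex) set" where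
  "square_integrable M =
     {f \<in> borel_measurable M. integrable M (\<lambda>x. (cmod (f x))\<^sup>2)}"

text \<open>Vectors of \<open>L2 M\<close> are classes of square integrable functions modulo equality
  almost everywhere; the operations are computed on representatives.\<close>

definition L2_class :: "'g measure \<Rightarrow> ('g \<Rightarrow> complex) \<Rightarrow> ('g \<Rightarrow> complex) set" where
  "L2_class M f = {h \<in> square_integrable M. AE x in M. h x = f x}"

definition L2_rep :: "('g \<Rightarrow> complex) set \<Rightarrow> 'g \<Rightarrow> complex" where
  "L2_rep A = (SOME f. f \<in> A)"

definition L2 :: "'g measure \<Rightarrow> ('g \<Rightarrow> complex) set inner_space" where
  "L2 M = \<lparr>carrier = L2_class M ` square_integrable M,
     vzero = L2_class M (\<lambda>_. 0),
     vplus = (\<lambda>A B. L2_class M (\<lambda>x. L2_rep A x + L2_rep B x)),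
     vscale = (\<lambda>a A. L2_class M (\<lambda>x. a * L2_rep A x)),
     vinner = (\<lambda>A B. integral\<^sup>L M (\<lambda>x. cnj (L2_rep A x) * L2_rep B x))\<rparr>"

definition left_regular :: "('g, 'm) monoid_scheme \<Rightarrow> 'g measure \<Rightarrow>
    'g \<Rightarrow> ('g \<Rightarrow> complex) set \<Rightarrow> ('g \<Rightarrow> complex) set" where
  "left_regular G M g A = L2_class M (\<lambda>x. L2_rep A (inv\<^bsub>G\<^esub> g \<otimes>\<^bsub>G\<^esub> x))"


section \<open>Unitary representations, the dual, and isotypic projections\<close>

definition unitary_rep :: "('g, 'm) monoid_scheme \<Rightarrow> 'g topology \<Rightarrow>
    'v inner_space \<Rightarrow> ('g \<Rightarrow> 'v \<Rightarrow> 'v) \<Rightarrow> bool" where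
  "unitary_rep G T H \<pi> \<longleftrightarrow> hilbert_space H \<and> (\<forall>g\<in>carrier G. unitary_map H H (\<pi> g)) \<and>
     (\<forall>g\<in>carrier G. \<forall>h\<in>carrier G. \<forall>v\<in>carrier H. \<pi> (g \<otimes>\<^bsub>G\<^esub> h) v = \<pi> g (\<pi> h v)) \<and>
     (\<forall>v\<in>carrier H. continuous_map T (vtopology H) (\<lambda>g. \<pi> g v))"

definition invariant_subspace :: "('g, 'm) monoid_scheme \<Rightarrow> 'v inner_space \<Rightarrow>
    ('g \<Rightarrow> 'v \<Rightarrow> 'v) \<Rightarrow> 'v set \<Rightarrow> bool" where
  "invariant_subspace G H \<pi> V \<longleftrightarrow> closed_subspace H V \<and> (\<forall>g\<in>carrier G. \<pi> g ` V \<subseteq> V)"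

definition irreducible_rep :: "('g, 'm) monoid_scheme \<Rightarrow> 'g topology \<Rightarrow>
    'v inner_space \<Rightarrow> ('g \<Rightarrow> 'v \<Rightarrow> 'v) \<Rightarrow> bool" where
  "irreducible_rep G T H \<pi> \<longleftrightarrow> unitary_rep G T H \<pi> \<and> carrier H \<noteq> {vzero H} \<and>
     (\<forall>V. invariant_subspace G H \<pi> V \<longrightarrow> V = {vzero H} \<or> V = carrier H)"

definition unitarily_equivalent :: "('g, 'm) monoid_scheme \<Rightarrow>
    'v inner_space \<times> ('g \<Rightarrow> 'v \<Rightarrow> 'v) \<Rightarrow> 'w inner_space \<times> ('g \<Rightarrow> 'w \<Rightarrow> 'w) \<Rightarrow> bool" where
  "unitarily_equivalent G = (\<lambda>(H, \<pi>) (K, \<rho>). \<exists>U. unitary_map H K U \<and>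
     (\<forall>g\<in>carrier G. \<forall>v\<in>carrier H. U (\<pi> g v) = \<rho> g (U v)))"

text \<open>An irreducible unitary representation of a compact metrisable (hence separable) group
  acts on a separable Hilbert space, so it has a unitarily equivalent copy whose carrier is
  a subset of the type \<open>nat \<Rightarrow> complex\<close>. Nothing else is assumed about the representation
  spaces: they are arbitrary Hilbert spaces with such a carrier.\<close>

type_synonym 'g concrete_rep =
  "(nat \<Rightarrow> complex) inner_space \<times> ('g \<Rightarrow> (nat \<Rightarrow> complex) \<Rightarrow> (nat \<Rightarrow> complex))"

definition irreps :: "('g, 'm) monoid_scheme \<Rightarrow> 'g topology \<Rightarrow> 'g concrete_rep set" where
  "irreps G T = {(K, \<rho>). irreducible_rep G T K \<rho>}"

definition dual :: "('g, 'm) monoid_scheme \<Rightarrow> 'g topology \<Rightarrow> 'g concrete_rep set set" where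
  "dual G T = irreps G T //
     {(r, s). r \<in> irreps G T \<and> s \<in> irreps G T \<and> unitarily_equivalent G r s}"

text \<open>\<open>isotypic G H \<pi> \<alpha>\<close> is the subspace written \<open>n(\<alpha>) H\<^sup>\<alpha>\<close> in the decomposition of \<open>\<pi>\<close>:
  the closed span of all invariant subspaces carrying a representation of class \<open>\<alpha>\<close>.\<close>

definition isotypic :: "('g, 'm) monoid_scheme \<Rightarrow> 'v inner_space \<Rightarrow> ('g \<Rightarrow> 'v \<Rightarrow> 'v) \<Rightarrow>
    'g concrete_rep set \<Rightarrow> 'v set" where
  "isotypic G H \<pi> \<alpha> = closed_span H (\<Union>{V. invariant_subspace G H \<pi> V \<and>
     (\<exists>r\<in>\<alpha>. unitarily_equivalent G (H\<lparr>carrier := V\<rparr>, \<pi>) r)})"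

definition isotypic_proj :: "('g, 'm) monoid_scheme \<Rightarrow> 'g measure \<Rightarrow>
    'g concrete_rep set set \<Rightarrow> ('g \<Rightarrow> complex) set \<Rightarrow> ('g \<Rightarrow> complex) set" where
  "isotypic_proj G M \<Delta> =
     orth_proj (L2 M) (closed_span (L2 M) (\<Union>\<alpha>\<in>\<Delta>. isotypic G (L2 M) (left_regular G M) \<alpha>))"


section \<open>Hermitian quadratic forms\<close>

text \<open>The quadratic form \<open>Q(\<Phi>)\<close> is \<open>Q \<Phi> \<Phi>\<close>.\<close>

definition hermitian_form :: "'v inner_space \<Rightarrow> 'v set \<Rightarrow> ('v \<Rightarrow> 'v \<Rightarrow> complex) \<Rightarrow> bool" where
  "hermitian_form H D Q \<longleftrightarrow> dense_subspace H D \<and>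
     (\<forall>x\<in>D. \<forall>y\<in>D. \<forall>z\<in>D. Q x (vplus H y z) = Q x y + Q x z) \<and>
     (\<forall>a. \<forall>x\<in>D. \<forall>y\<in>D. Q x (vscale H a y) = a * Q x y) \<and>
     (\<forall>x\<in>D. \<forall>y\<in>D. \<forall>z\<in>D. Q (vplus H x y) z = Q x z + Q y z) \<and>
     (\<forall>a. \<forall>x\<in>D. \<forall>y\<in>D. Q (vscale H a x) y = cnj a * Q x y) \<and>
     (\<forall>x\<in>D. \<forall>y\<in>D. Q x y = cnj (Q y x))"

definition closable_form :: "'v inner_space \<Rightarrow> 'v set \<Rightarrow> ('v \<Rightarrow> 'v \<Rightarrow> complex) \<Rightarrow> bool" where
  "closable_form H D Q \<longleftrightarrow> (\<forall>\<Phi> :: nat \<Rightarrow> 'v. range \<Phi> \<subseteq> D \<longrightarrow>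
     limitin (vtopology H) \<Phi> (vzero H) sequentially \<longrightarrow>
     ((\<lambda>(n, m). Q (vminus H (\<Phi> n) (\<Phi> m)) (vminus H (\<Phi> n) (\<Phi> m))) \<longlongrightarrow> 0)
       (sequentially \<times>\<^sub>F sequentially) \<longrightarrow>
     (\<lambda>n. Q (\<Phi> n) (\<Phi> n)) \<longlonglongrightarrow> 0)"

definition form_extends :: "'v inner_space \<Rightarrow> 'v set \<Rightarrow> ('v \<Rightarrow> 'v \<Rightarrow> complex) \<Rightarrow>
    'v set \<Rightarrow> ('v \<Rightarrow> 'v \<Rightarrow> complex) \<Rightarrow> bool" where
  "form_extends H D' Q' D Q \<longleftrightarrow> hermitian_form H D' Q' \<and> D \<subseteq> D' \<and>
     (\<forall>x\<in>D. \<forall>y\<in>D. Q' x y = Q x y)"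


section \<open>Self-adjoint operators and strong representability\<close>

text \<open>An unbounded operator is given by its domain \<open>D\<close> and a function \<open>A\<close>, whose values
  outside \<open>D\<close> are irrelevant.\<close>

definition adjoint_domain :: "'v inner_space \<Rightarrow> 'v set \<Rightarrow> ('v \<Rightarrow> 'v) \<Rightarrow> 'v set" where
  "adjoint_domain H D A =
     {x \<in> carrier H. \<exists>y\<in>carrier H. \<forall>z\<in>D. vinner H (A z) x = vinner H z y}"

definition self_adjoint :: "'v inner_space \<Rightarrow> 'v set \<Rightarrow> ('v \<Rightarrow> 'v) \<Rightarrow> bool" where
  "self_adjoint H D A \<longleftrightarrow> dense_subspace H D \<and> linear_map_on H D H A \<and>
     (\<forall>x\<in>D. \<forall>z\<in>D. vinner H (A z) x = vinner H z (A x)) \<and> adjoint_domain H D A = D"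

definition orthogonal_projector :: "'v inner_space \<Rightarrow> ('v \<Rightarrow> 'v) \<Rightarrow> bool" where
  "orthogonal_projector H P \<longleftrightarrow> linear_map_on H (carrier H) H P \<and>
     (\<forall>x\<in>carrier H. P (P x) = P x) \<and>
     (\<forall>x\<in>carrier H. \<forall>y\<in>carrier H. vinner H (P x) y = vinner H x (P y))"

definition projection_valued_measure ::
    "'v inner_space \<Rightarrow> (real set \<Rightarrow> 'v \<Rightarrow> 'v) \<Rightarrow> bool" where
  "projection_valued_measure H E \<longleftrightarrow>
     (\<forall>\<sigma>\<in>sets borel. orthogonal_projector H (E \<sigma>)) \<and>
     (\<forall>x\<in>carrier H. E UNIV x = x) \<and>
     (\<forall>\<sigma>\<in>sets borel. \<forall>\<tau>\<in>sets borel. \<forall>x\<in>carrier H. E (\<sigma> \<inter> \<tau>) x = E \<sigma> (E \<tau> x)) \<and>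
     (\<forall>A :: nat \<Rightarrow> real set. range A \<subseteq> sets borel \<longrightarrow> disjoint_family A \<longrightarrow>
       (\<forall>x\<in>carrier H. \<forall>y\<in>carrier H.
         (\<lambda>n. vinner H y (E (A n) x)) sums vinner H y (E (\<Union>n. A n) x)))"

definition spectral_measure ::
    "'v inner_space \<Rightarrow> (real set \<Rightarrow> 'v \<Rightarrow> 'v) \<Rightarrow> 'v \<Rightarrow> real measure" where
  "spectral_measure H E x =
     measure_of UNIV (sets borel) (\<lambda>\<sigma>. ennreal ((vnorm H (E \<sigma> x))\<^sup>2))"

text \<open>Domain of the operator \<open>f(T)\<close> of the functional calculus given by \<open>E\<close>.\<close>

definition calculus_domain ::
    "'v inner_space \<Rightarrow> (real set \<Rightarrow> 'v \<Rightarrow> 'v) \<Rightarrow> (real \<Rightarrow> real) \<Rightarrow> 'v set" where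
  "calculus_domain H E f =
     {x \<in> carrier H. integrable (spectral_measure H E x) (\<lambda>l. (f l)\<^sup>2)}"

text \<open>\<open>E\<close> is the resolution of the identity of \<open>(D, A)\<close>, i.e. \<open>A = \<integral> l dE(l)\<close>. By polarisation
  the diagonal values \<open>\<langle>x, A x\<rangle>\<close> determine \<open>A\<close> on \<open>D\<close>. By the spectral theorem \<open>E\<close> exists and is
  unique (on Borel sets and vectors of \<open>H\<close>) for every self-adjoint operator.\<close>

definition resolution_of_identity ::
    "'v inner_space \<Rightarrow> 'v set \<Rightarrow> ('v \<Rightarrow> 'v) \<Rightarrow> (real set \<Rightarrow> 'v \<Rightarrow> 'v) \<Rightarrow> bool" where
  "resolution_of_identity H D A E \<longleftrightarrow> projection_valued_measure H E \<and>
     D = calculus_domain H E (\<lambda>l. l) \<and>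
     (\<forall>x\<in>D. vinner H x (A x) = of_real (integral\<^sup>L (spectral_measure H E x) (\<lambda>l. l)))"

definition spectral_norm :: "'v inner_space \<Rightarrow> (real set \<Rightarrow> 'v \<Rightarrow> 'v) \<Rightarrow> 'v \<Rightarrow> real" where
  "spectral_norm H E x = sqrt (integral\<^sup>L (spectral_measure H E x) (\<lambda>l. 1 + \<bar>l\<bar>))"

definition spectral_closure ::
    "'v inner_space \<Rightarrow> (real set \<Rightarrow> 'v \<Rightarrow> 'v) \<Rightarrow> 'v set \<Rightarrow> 'v set" where
  "spectral_closure H E D = {x \<in> calculus_domain H E (\<lambda>l. sqrt \<bar>l\<bar>).
     \<forall>e>0. \<exists>y\<in>D. spectral_norm H E (vminus H x y) < e}"

definition strongly_representable :: "'v inner_space \<Rightarrow> 'v set \<Rightarrow> ('v \<Rightarrow> 'v \<Rightarrow> complex) \<Rightarrow>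
    'v set \<Rightarrow> ('v \<Rightarrow> 'v) \<Rightarrow> bool" where
  "strongly_representable H D Q DA A \<longleftrightarrow> self_adjoint H DA A \<and>
     (\<exists>E D' Q'. resolution_of_identity H DA A E \<and>
        form_extends H D' Q' D Q \<and> DA \<subseteq> D' \<and> D \<subseteq> calculus_domain H E (\<lambda>l. sqrt \<bar>l\<bar>) \<and>
        D' = spectral_closure H E D \<and>
        (\<forall>x\<in>D'. Q' x x = of_real (integral\<^sup>L (spectral_measure H E x) (\<lambda>l. l))))"

end

theory Submission
  imports Defs "HOL-Algebra.FiniteProduct"
begin

text \<open>Let \<open>U\<close> be a neighbourhood of the identity that is symmetric and invariant under conjugation. Convolution
  \<open>K\<close> with its indicator function is a symmetric Hilbert--Schmidt operator on \<open>L2 M\<close> that commutes with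
  the left regular representation, so its eigenspaces for nonzero eigenvalues are finite-dimensional
  and invariant. An irreducible subspace contains an eigenvector of \<open>K\<close> by compactness, hence lies in one
  eigenspace; the eigenvalue is an average of a matrix coefficient, so it depends only on the
  class of the representation, and it is nonzero once \<open>U\<close> is small. Hence isotypic components are
  finite-dimensional and every vector of the form domain \<open>D\<close> lies in a finite-dimensional invariant
  subspace of \<open>D\<close>.

  As \<open>K\<close> is a weak average of translations, invariance of \<open>Q\<close> makes \<open>K\<close> symmetric for \<open>Q\<close> as well, so the
  eigenspaces of \<open>K\<close> within \<open>D\<close> are orthogonal for \<open>Q\<close>, and diagonalising \<open>Q\<close> on them shows that
  \<open>D\<close> is spanned by vectors \<open>e\<close> with \<open>Q e x = l \<langle>e, x\<rangle>\<close> for all \<open>x\<close> in \<open>D\<close>. The projections onto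
  the closed spans of these eigenvectors form the resolution of the identity of the representing operator.\<close>

section \<open>Hilbert spaces on explicit carriers\<close>

text \<open>The obstacle is that \<open>Q\<close> is defined on \<open>D\<close> only and need not
  be continuous, while convolution is an integral of translations: it is not clear that
  \<open>K x\<close> stays in \<open>D\<close>, nor that the integral can be pulled through
  \<open>Q\<close>. Both are settled inside finite-dimensional translation-stable subspaces of
  \<open>D\<close>, where closedness and continuity are automatic. For this reason
  finite-dimensionality has to be established before \<open>Q\<close> is touched.

  \<open>D\<close> may meet an eigenspace of \<open>K\<close> in a proper subspace, so
  decompositions are taken within \<open>D\<close> and orthogonality is only tested against vectors
  of \<open>D\<close>.

  The neighbourhood \<open>U\<close> has to shrink with the classes under consideration, hence
  depends on the vector. The equation \<open>Q e x = l \<langle>e, x\<rangle>\<close> does not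
  mention \<open>U\<close>, so eigenvectors found with different \<open>U\<close> can be pooled. The
  numbers \<open>l\<close> obtained this way may have both signs, be unbounded and be dense in the
  line. The spectral calculus is therefore written with unconditional sums over all real
  \<open>l\<close>, whose nonzero terms sit at eigenvalues.\<close>

context inner_product_space
begin

abbreviation V where "V \<equiv> carrier H"
abbreviation add (infixl "\<oplus>" 65) where "x \<oplus> y \<equiv> vplus H x y"
abbreviation sub (infixl "\<ominus>" 65) where "x \<ominus> y \<equiv> vminus H x y"
abbreviation scl (infixr "\<odot>" 75) where "a \<odot> x \<equiv> vscale H a x"
abbreviation nought where "nought \<equiv> vzero H"
abbreviation ip where "ip x y \<equiv> vinner H x y"
abbreviation nm where "nm x \<equiv> vnorm H x"

lemma add_closed [simp, intro]: "x \<in> V \<Longrightarrow> y \<in> V \<Longrightarrow> x \<oplus> y \<in> V"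
  using comm_group.axioms(2)[OF plus_group, THEN group.is_monoid, THEN monoid.m_closed, of x y]
  by simp

lemma zero_closed [simp, intro]: "nought \<in> V"
  using comm_group.axioms(2)[OF plus_group, THEN group.is_monoid, THEN monoid.one_closed] by simp

lemmas scl_closed [simp, intro] = scale_closed

lemma sub_closed [simp, intro]: "x \<in> V \<Longrightarrow> y \<in> V \<Longrightarrow> x \<ominus> y \<in> V"
  by (simp add: vminus_def)

lemma add_assoc: "x \<in> V \<Longrightarrow> y \<in> V \<Longrightarrow> z \<in> V \<Longrightarrow> (x \<oplus> y) \<oplus> z = x \<oplus> (y \<oplus> z)"
  using comm_group.axioms(2)[OF plus_group, THEN group.is_monoid, THEN monoid.m_assoc, of x y z]
  by simp

lemma add_zero_right [simp]: "x \<in> V \<Longrightarrow> x \<oplus> nought = x"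
  using comm_group.axioms(2)[OF plus_group, THEN group.is_monoid, THEN monoid.r_one, of x] by simp

lemma add_zero_left [simp]: "x \<in> V \<Longrightarrow> nought \<oplus> x = x"
  using comm_group.axioms(2)[OF plus_group, THEN group.is_monoid, THEN monoid.l_one, of x] by simp

lemma ip_add_right [simp]:
  "x \<in> V \<Longrightarrow> y \<in> V \<Longrightarrow> z \<in> V \<Longrightarrow> ip x (y \<oplus> z) = ip x y + ip x z"
  by (rule inner_plus_right)

lemma ip_scl_right [simp]: "x \<in> V \<Longrightarrow> y \<in> V \<Longrightarrow> ip x (a \<odot> y) = a * ip x y"
  by (rule inner_scale_right)

lemma ip_add_left [simp]:
  "x \<in> V \<Longrightarrow> y \<in> V \<Longrightarrow> z \<in> V \<Longrightarrow> ip (x \<oplus> y) z = ip x z + ip y z"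
  using inner_commute[of "x \<oplus> y" z] inner_commute[of x z] inner_commute[of y z] by simp

lemma ip_scl_left [simp]: "x \<in> V \<Longrightarrow> y \<in> V \<Longrightarrow> ip (a \<odot> x) y = cnj a * ip x y"
  using inner_commute[of "a \<odot> x" y] inner_commute[of x y] by simp

lemma ip_sub_right [simp]:
  "x \<in> V \<Longrightarrow> y \<in> V \<Longrightarrow> z \<in> V \<Longrightarrow> ip x (y \<ominus> z) = ip x y - ip x z"
  by (simp add: vminus_def)

lemma ip_sub_left [simp]:
  "x \<in> V \<Longrightarrow> y \<in> V \<Longrightarrow> z \<in> V \<Longrightarrow> ip (x \<ominus> y) z = ip x z - ip y z"
  by (simp add: vminus_def)

lemma ip_zero_right [simp]: "x \<in> V \<Longrightarrow> ip x nought = 0"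
  using ip_add_right[of x nought nought] by simp

lemma ip_zero_left [simp]: "x \<in> V \<Longrightarrow> ip nought x = 0"
  using ip_add_left[of nought nought x] by simp

text \<open>Rearranging vectors on an explicit carrier drags closure conditions along. Paired with
  an arbitrary \<open>z\<close>, a vector identity becomes one between complex numbers; most vector
  equations below are proved in this way.\<close>

lemma ip_eqI:
  assumes x: "x \<in> V" and y: "y \<in> V" and eq: "\<And>z. z \<in> V \<Longrightarrow> ip z x = ip z y"
  shows "x = y"
proof -
  have z: "(-1) \<odot> y \<oplus> y = nought"
    by (rule inner_definite) (use y in auto)
  have "x \<ominus> y = nought"
    by (rule inner_definite) (use x y eq[of x] eq[of y] in auto)
  then have "(x \<oplus> (-1) \<odot> y) \<oplus> y = y" using y by (simp add: vminus_def)
  then show ?thesis using x y z by (simp add: add_assoc)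
qed

lemma ip_self: "x \<in> V \<Longrightarrow> ip x x = of_real ((nm x)\<^sup>2)"
  using inner_commute[of x x] inner_nonneg[of x]
  by (simp add: vnorm_def complex_eq_iff)

lemma nm_nonneg [simp]: "0 \<le> nm x" if "x \<in> V"
  using inner_nonneg[OF that] by (simp add: vnorm_def)

lemma nm_sq: "x \<in> V \<Longrightarrow> (nm x)\<^sup>2 = Re (ip x x)"
  using inner_nonneg[of x] by (simp add: vnorm_def)

lemma nm_zero [simp]: "nm nought = 0"
  by (simp add: vnorm_def)

lemma nm_eq_0 [simp]: "x \<in> V \<Longrightarrow> nm x = 0 \<longleftrightarrow> x = nought"
  using inner_definite[of x] ip_self[of x] by auto

lemma nm_scl [simp]: "x \<in> V \<Longrightarrow> nm (a \<odot> x) = cmod a * nm x"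
proof -
  assume x: "x \<in> V"
  have "ip (a \<odot> x) (a \<odot> x) = (a * cnj a) * ip x x" using x by simp
  also have "\<dots> = of_real ((cmod a * nm x)\<^sup>2)"
    unfolding complex_norm_square[symmetric] ip_self[OF x] by (simp add: power_mult_distrib)
  finally have "Re (ip (a \<odot> x) (a \<odot> x)) = (cmod a * nm x)\<^sup>2"
    by (metis Re_complex_of_real)
  then show ?thesis using x by (simp add: vnorm_def[of H "a \<odot> x"])
qed

lemma nm_add_sq: "x \<in> V \<Longrightarrow> y \<in> V \<Longrightarrow> (nm (x \<oplus> y))\<^sup>2 = (nm x)\<^sup>2 + 2 * Re (ip x y) + (nm y)\<^sup>2"
  using inner_commute[of y x] by (simp add: nm_sq)

lemma nm_sub_sq: "x \<in> V \<Longrightarrow> y \<in> V \<Longrightarrow> (nm (x \<ominus> y))\<^sup>2 = (nm x)\<^sup>2 - 2 * Re (ip x y) + (nm y)\<^sup>2"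
  using inner_commute[of y x] by (simp add: nm_sq)

lemma Cauchy_Schwarz:
  assumes x: "x \<in> V" and y: "y \<in> V" shows "cmod (ip x y) \<le> nm x * nm y"
proof (cases "nm y = 0")
  case True then show ?thesis using x y by simp
next
  case False
  \<comment> \<open>Since \<open>a = ip y x\<close>, the vector
    \<open>(a / of_real s) \<odot> y\<close> is the projection of \<open>x\<close> onto the line
    through \<open>y\<close>.\<close>
  define a where "a = cnj (ip x y)"
  define s where "s = (nm y)\<^sup>2"
  have s: "s > 0" using False by (simp add: s_def)
  have *: "a * ip x y = of_real ((cmod a)\<^sup>2)"
    unfolding a_def by (metis complex_mod_cnj complex_cnj_cnj complex_norm_square)
  have "0 \<le> (nm (x \<ominus> (a / of_real s) \<odot> y))\<^sup>2" by simp
  also have "\<dots> = (nm x)\<^sup>2 - 2 * Re (a * ip x y / of_real s) + (cmod a / s)\<^sup>2 * s"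
    using x y s by (simp add: nm_sub_sq norm_divide power_mult_distrib power_divide s_def[symmetric])
  also have "Re (a * ip x y / of_real s) = (cmod a)\<^sup>2 / s"
    unfolding * by (metis Re_complex_of_real of_real_divide)
  also have "(nm x)\<^sup>2 - 2 * ((cmod a)\<^sup>2 / s) + (cmod a / s)\<^sup>2 * s = (nm x)\<^sup>2 - (cmod a)\<^sup>2 / s"
    using s by (simp add: power2_eq_square field_simps)
  finally have "(cmod a)\<^sup>2 \<le> (nm x)\<^sup>2 * s" using s by (simp add: field_simps)
  then have "(cmod (ip x y))\<^sup>2 \<le> (nm x * nm y)\<^sup>2" by (simp add: a_def s_def power_mult_distrib)
  then show ?thesis by (rule power2_le_imp_le) (use x y in auto)
qed

lemma nm_triangle:
  assumes x: "x \<in> V" and y: "y \<in> V" shows "nm (x \<oplus> y) \<le> nm x + nm y"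
proof -
  have "Re (ip x y) \<le> nm x * nm y"
    using Cauchy_Schwarz[OF x y] complex_Re_le_cmod[of "ip x y"] by linarith
  then have "(nm (x \<oplus> y))\<^sup>2 \<le> (nm x + nm y)\<^sup>2"
    using x y by (simp add: nm_add_sq power2_sum)
  then show ?thesis by (rule power2_le_imp_le) (use x y in auto)
qed

lemma sub_self [simp]: "x \<in> V \<Longrightarrow> x \<ominus> x = nought"
  by (rule ip_eqI) auto

lemma sub_add_cancel [simp]: "x \<in> V \<Longrightarrow> y \<in> V \<Longrightarrow> (x \<ominus> y) \<oplus> y = x"
  by (rule ip_eqI) auto

lemma sub_zero [simp]: "x \<in> V \<Longrightarrow> x \<ominus> nought = x"
  by (rule ip_eqI) auto

lemma scl_zero_left [simp]: "x \<in> V \<Longrightarrow> 0 \<odot> x = nought"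
  by (rule ip_eqI) auto

lemma scl_zero_right [simp]: "a \<odot> nought = nought"
  by (rule ip_eqI) auto

lemma sub_eq_0 [simp]: "x \<in> V \<Longrightarrow> y \<in> V \<Longrightarrow> x \<ominus> y = nought \<longleftrightarrow> x = y"
  by (metis add_zero_left sub_add_cancel sub_self)

lemma nm_sub_commute: "x \<in> V \<Longrightarrow> y \<in> V \<Longrightarrow> nm (x \<ominus> y) = nm (y \<ominus> x)"
proof -
  assume "x \<in> V" "y \<in> V"
  then have "y \<ominus> x = (-1) \<odot> (x \<ominus> y)" by (intro ip_eqI) auto
  then show ?thesis using \<open>x \<in> V\<close> \<open>y \<in> V\<close> by simp
qed

lemma nm_sub_triangle:
  assumes "x \<in> V" "y \<in> V" "z \<in> V" shows "nm (x \<ominus> z) \<le> nm (x \<ominus> y) + nm (y \<ominus> z)"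
proof -
  have "x \<ominus> z = (x \<ominus> y) \<oplus> (y \<ominus> z)" using assms by (intro ip_eqI) auto
  then show ?thesis using nm_triangle[of "x \<ominus> y" "y \<ominus> z"] assms by simp
qed

lemma nm_diff_le: "x \<in> V \<Longrightarrow> y \<in> V \<Longrightarrow> \<bar>nm x - nm y\<bar> \<le> nm (x \<ominus> y)"
  using nm_triangle[of "x \<ominus> y" y] nm_triangle[of "y \<ominus> x" x] nm_sub_commute[of x y] by simp

sublocale ms: Metric_space V "vdist H"
  by unfold_locales
    (auto simp: vdist_def nm_sub_commute intro: nm_sub_triangle)

lemma vtopology_eq: "vtopology H = ms.mtopology"
  by (simp add: vtopology_def)

lemma topspace_vtopology [simp]: "topspace (vtopology H) = V"
  by (simp add: vtopology_eq)

section \<open>Convergent sequences and closed subspaces\<close>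

definition conv :: "(nat \<Rightarrow> 'v) \<Rightarrow> 'v \<Rightarrow> bool" where
  "conv s x \<longleftrightarrow> (\<lambda>n. nm (s n \<ominus> x)) \<longlonglongrightarrow> 0"

lemma limitin_iff:
  assumes "range s \<subseteq> V" "x \<in> V"
  shows "limitin (vtopology H) s x sequentially \<longleftrightarrow> conv s x"
proof -
  have "s n \<in> V" for n using assms by auto
  then show ?thesis
    using assms unfolding vtopology_eq ms.limitin_metric_dist_null conv_def
    by (simp add: vdist_def)
qed

lemma conv_ip:
  assumes s: "\<And>n. s n \<in> V" and x: "x \<in> V" and y: "y \<in> V" and c: "conv s x"
  shows "(\<lambda>n. ip y (s n)) \<longlonglongrightarrow> ip y x" "(\<lambda>n. ip (s n) y) \<longlonglongrightarrow> ip x y"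
proof -
  have *: "(\<lambda>n. ip y (s n) - ip y x) \<longlonglongrightarrow> 0"
  proof (rule Lim_null_comparison)
    show "\<forall>\<^sub>F n in sequentially. cmod (ip y (s n) - ip y x) \<le> nm y * nm (s n \<ominus> x)"
      using Cauchy_Schwarz[OF y, of "s _ \<ominus> x"] s x y by auto
    show "(\<lambda>n. nm y * nm (s n \<ominus> x)) \<longlonglongrightarrow> 0"
      using tendsto_mult[OF tendsto_const[of "nm y"] c[unfolded conv_def]] by simp
  qed
  then show 1: "(\<lambda>n. ip y (s n)) \<longlonglongrightarrow> ip y x" by (rule LIM_zero_cancel)
  have "(\<lambda>n. cnj (ip y (s n))) \<longlonglongrightarrow> cnj (ip y x)" using 1 by (rule tendsto_cnj)
  then show "(\<lambda>n. ip (s n) y) \<longlonglongrightarrow> ip x y"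
    using inner_commute[OF s y] inner_commute[OF x y] by simp
qed

lemma conv_nm:
  assumes s: "\<And>n. s n \<in> V" and x: "x \<in> V" and c: "conv s x"
  shows "(\<lambda>n. nm (s n)) \<longlonglongrightarrow> nm x"
proof -
  have "(\<lambda>n. nm (s n) - nm x) \<longlonglongrightarrow> 0"
    by (rule Lim_null_comparison[OF _ c[unfolded conv_def]])
      (use s x nm_diff_le in auto)
  then show ?thesis by (rule LIM_zero_cancel)
qed

lemma conv_unique:
  assumes s: "\<And>n. s n \<in> V" and x: "x \<in> V" and y: "y \<in> V" and c: "conv s x" "conv s y"
  shows "x = y"
  using LIMSEQ_unique[OF conv_ip(1)[OF s x _ c(1)] conv_ip(1)[OF s y _ c(2)]]
  by (intro ip_eqI x y)

lemma closedin_seq: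
  "closedin (vtopology H) S \<longleftrightarrow>
    S \<subseteq> V \<and> (\<forall>s x. (\<forall>n. s n \<in> S) \<and> x \<in> V \<and> conv s x \<longrightarrow> x \<in> S)"
proof -
  have "closedin (vtopology H) S \<longleftrightarrow>
    S \<subseteq> V \<and> (\<forall>s x. range s \<subseteq> S \<and> limitin (vtopology H) s x sequentially \<longrightarrow> x \<in> S)"
    unfolding vtopology_eq by (rule ms.metric_closedin_iff_sequentially_closed)
  moreover have "limitin (vtopology H) s x sequentially \<longleftrightarrow> x \<in> V \<and> conv s x"
    if "S \<subseteq> V" "range s \<subseteq> S" for s x
    using limitin_iff[of s x] that limitin_topspace[of "vtopology H" s x sequentially] by auto
  ultimately show ?thesis by (simp add: image_subset_iff cong: conj_cong)
qed

lemma closure_of_iff: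
  assumes "S \<subseteq> V"
  shows "x \<in> vtopology H closure_of S \<longleftrightarrow> x \<in> V \<and> (\<forall>e>0. \<exists>y\<in>S. nm (x \<ominus> y) < e)"
proof -
  have "x \<in> vtopology H closure_of S \<longleftrightarrow> x \<in> V \<and> (\<forall>e>0. \<exists>y\<in>S. y \<in> ms.mball x e)"
    unfolding vtopology_eq ms.metric_closure_of by auto
  moreover have "y \<in> ms.mball x e \<longleftrightarrow> nm (x \<ominus> y) < e" if "x \<in> V" "y \<in> S" for y e
    using that assms by (auto simp: vdist_def)
  ultimately show ?thesis by blast
qed

lemma subspaceD:
  assumes "linear_subspace H S"
  shows "S \<subseteq> V" "x \<in> S \<Longrightarrow> x \<in> V" "nought \<in> S" "x \<in> S \<Longrightarrow> y \<in> S \<Longrightarrow> x \<oplus> y \<in> S"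
    "x \<in> S \<Longrightarrow> a \<odot> x \<in> S" "x \<in> S \<Longrightarrow> y \<in> S \<Longrightarrow> x \<ominus> y \<in> S"
  using assms by (auto simp: linear_subspace_def vminus_def)

lemma closed_subspaceD:
  assumes "closed_subspace H S"
  shows "linear_subspace H S" "(\<And>n. s n \<in> S) \<Longrightarrow> x \<in> V \<Longrightarrow> conv s x \<Longrightarrow> x \<in> S"
  using assms unfolding closed_subspace_def closedin_seq by blast+

text \<open>The inner product is continuous, so each condition survives limits. If an operator has
  an adjoint \<open>f\<close>, its kernel takes this form; fixed spaces and eigenspaces are shown to
  be closed by this route.\<close>

lemma closed_subspace_weak:
  assumes "\<And>z. z \<in> Z \<Longrightarrow> f z \<in> V"
  shows "closed_subspace H {x \<in> V. \<forall>z\<in>Z. ip (f z) x = 0}"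
  unfolding closed_subspace_def closedin_seq
proof (intro conjI allI impI)
  show "linear_subspace H {x \<in> V. \<forall>z\<in>Z. ip (f z) x = 0}"
    using assms by (auto simp: linear_subspace_def)
  fix s x assume *: "(\<forall>n. s n \<in> {x \<in> V. \<forall>z\<in>Z. ip (f z) x = 0}) \<and> x \<in> V \<and> conv s x"
  have "ip (f z) x = 0" if "z \<in> Z" for z
  proof -
    have "(\<lambda>n. ip (f z) (s n)) \<longlonglongrightarrow> ip (f z) x"
      by (rule conv_ip(1)) (use * assms that in auto)
    moreover have "(\<lambda>n. ip (f z) (s n)) = (\<lambda>_. 0)" using * that by auto
    ultimately show ?thesis by (simp add: LIMSEQ_const_iff)
  qed
  then show "x \<in> {x \<in> V. \<forall>z\<in>Z. ip (f z) x = 0}" using * by auto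
qed auto

lemma closed_subspace_V: "closed_subspace H V"
  using closed_subspace_weak[of "{}" id] by simp

lemma closed_subspace_Int:
  "closed_subspace H S \<Longrightarrow> closed_subspace H S' \<Longrightarrow> closed_subspace H (S \<inter> S')"
  by (auto simp: closed_subspace_def linear_subspace_def)

lemma closed_subspace_closed_span:
  assumes "S \<subseteq> V" shows "closed_subspace H (closed_span H S)"
proof -
  let ?\<W> = "{W. closed_subspace H W \<and> S \<subseteq> W}"
  have ne: "?\<W> \<noteq> {}" using closed_subspace_V assms by auto
  have "closedin (vtopology H) (\<Inter> ?\<W>)"
    by (rule closedin_Inter[OF ne]) (auto simp: closed_subspace_def)
  moreover have "linear_subspace H (\<Inter> ?\<W>)"
    using closed_subspace_V assms by (auto simp: closed_subspace_def linear_subspace_def)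
  ultimately show ?thesis by (simp add: closed_subspace_def closed_span_def)
qed

lemma closed_span_minimal: "closed_subspace H W \<Longrightarrow> S \<subseteq> W \<Longrightarrow> closed_span H S \<subseteq> W"
  by (auto simp: closed_span_def)

lemma closed_span_superset: "S \<subseteq> closed_span H S"
  by (auto simp: closed_span_def)

section \<open>Algebraic spans and finite sums of vectors\<close>

definition lin_span :: "'v set \<Rightarrow> 'v set" where
  "lin_span S = \<Inter>{W. linear_subspace H W \<and> S \<subseteq> W}"

lemma lin_span_minimal: "linear_subspace H W \<Longrightarrow> S \<subseteq> W \<Longrightarrow> lin_span S \<subseteq> W"
  by (auto simp: lin_span_def)

lemma lin_span_superset: "S \<subseteq> lin_span S"
  by (auto simp: lin_span_def)

lemma linear_subspace_V: "linear_subspace H V"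
  by (auto simp: linear_subspace_def)

lemma linear_subspace_lin_span: "S \<subseteq> V \<Longrightarrow> linear_subspace H (lin_span S)"
  using linear_subspace_V by (auto simp: lin_span_def linear_subspace_def)

abbreviation vgroup where "vgroup \<equiv> \<lparr>carrier = V, monoid.mult = vplus H, one = nought\<rparr>"

definition vsum :: "('i \<Rightarrow> 'v) \<Rightarrow> 'i set \<Rightarrow> 'v" where
  "vsum f I = finprod vgroup f I"

lemma vsum_empty [simp]: "vsum f {} = nought"
  by (simp add: vsum_def finprod_def)

lemma vsum_insert:
  assumes "finite I" "i \<notin> I" "f i \<in> V" "\<And>j. j \<in> I \<Longrightarrow> f j \<in> V"
  shows "vsum f (insert i I) = f i \<oplus> vsum f I"
proof -
  interpret g: comm_group vgroup by (rule plus_group)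
  show ?thesis unfolding vsum_def
    using g.finprod_insert[of I i f] assms by (simp add: Pi_def)
qed

lemma vsum_in:
  assumes "linear_subspace H S" "finite I" "\<And>i. i \<in> I \<Longrightarrow> f i \<in> S"
  shows "vsum f I \<in> S"
  using assms(2,3)
proof (induction I rule: finite_induct)
  case empty then show ?case using subspaceD(3)[OF assms(1)] by simp
next
  case (insert i I)
  then have "f j \<in> V" if "j \<in> insert i I" for j using that subspaceD(2)[OF assms(1)] by blast
  then show ?case using insert subspaceD(4)[OF assms(1)] by (simp add: vsum_insert)
qed

lemma vsum_closed [simp, intro]: "finite I \<Longrightarrow> (\<And>i. i \<in> I \<Longrightarrow> f i \<in> V) \<Longrightarrow> vsum f I \<in> V"
  by (rule vsum_in[OF linear_subspace_V])

lemma ip_vsum_right: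
  assumes "finite I" "\<And>i. i \<in> I \<Longrightarrow> f i \<in> V" "x \<in> V"
  shows "ip x (vsum f I) = (\<Sum>i\<in>I. ip x (f i))"
  using assms(1,2)
proof (induction I rule: finite_induct)
  case (insert i I)
  then show ?case using assms(3) by (simp add: vsum_insert vsum_closed)
qed (use assms(3) in simp)

lemma ip_vsum_left:
  assumes "finite I" "\<And>i. i \<in> I \<Longrightarrow> f i \<in> V" "x \<in> V"
  shows "ip (vsum f I) x = (\<Sum>i\<in>I. ip (f i) x)"
  using assms(1,2)
proof (induction I rule: finite_induct)
  case (insert i I)
  then show ?case using assms(3) by (simp add: vsum_insert vsum_closed)
qed (use assms(3) in simp)

end

section \<open>The projection theorem\<close>

lemma (in hilbert_space) Cauchy_conv:
  assumes s: "\<And>n. s n \<in> V"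
    and c: "\<And>e. e > 0 \<Longrightarrow> \<exists>N. \<forall>m\<ge>N. \<forall>n\<ge>N. nm (s m \<ominus> s n) < e"
  obtains x where "x \<in> V" "conv s x"
proof -
  have "ms.MCauchy s" unfolding ms.MCauchy_def
    using s c by (auto simp: vdist_def)
  then obtain x where "limitin ms.mtopology s x sequentially"
    using complete unfolding ms.mcomplete_def by blast
  then have "x \<in> V" "conv s x"
    using limitin_iff[of s x] s limitin_topspace[of "vtopology H" s x]
    by (auto simp: vtopology_eq image_subset_iff)
  then show ?thesis by (rule that)
qed

context hilbert_space
begin

text \<open>A minimising sequence is Cauchy by the parallelogram law.\<close>

lemma projection_exists:
  assumes S: "closed_subspace H S" and x: "x \<in> V"
  shows "\<exists>y\<in>S. \<forall>z\<in>S. ip z (x \<ominus> y) = 0"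
proof -
  note lin = closed_subspaceD(1)[OF S]
  note SV = subspaceD(2)[OF lin]
  define d where "d = (INF y\<in>S. (nm (x \<ominus> y))\<^sup>2)"
  have bdd: "bdd_below ((\<lambda>y. (nm (x \<ominus> y))\<^sup>2) ` S)" by (rule bdd_belowI2[of _ 0]) simp
  have ne: "S \<noteq> {}" using subspaceD(3)[OF lin] by auto
  have d_le: "d \<le> (nm (x \<ominus> y))\<^sup>2" if "y \<in> S" for y
    unfolding d_def by (rule cINF_lower[OF bdd that])
  have "\<exists>y\<in>S. (nm (x \<ominus> y))\<^sup>2 < d + 1 / real (Suc n)" for n
    using cINF_less_iff[OF ne bdd, of "d + 1 / real (Suc n)"] by (simp add: d_def)
  then obtain s where s: "\<And>n. s n \<in> S" and sd: "\<And>n. (nm (x \<ominus> s n))\<^sup>2 < d + 1 / real (Suc n)"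
    by metis
  have sV: "s n \<in> V" for n using SV[OF s] .
  have par: "(nm (s m \<ominus> s n))\<^sup>2 \<le> 2 / real (Suc m) + 2 / real (Suc n)" for m n
  proof -
    let ?h = "(1/2) \<odot> (s m \<oplus> s n)"
    have "?h \<in> S" by (intro subspaceD(4,5)[OF lin] s)
    from d_le[OF this] have "d \<le> (nm (x \<ominus> ?h))\<^sup>2" .
    moreover have "(nm (s m \<ominus> s n))\<^sup>2 + 4 * (nm (x \<ominus> ?h))\<^sup>2
        = 2 * (nm (x \<ominus> s m))\<^sup>2 + 2 * (nm (x \<ominus> s n))\<^sup>2"
      using x sV inner_commute[of "s m" x] inner_commute[of "s n" x] inner_commute[of "s n" "s m"]
      by (simp add: nm_sq algebra_simps)
    ultimately show ?thesis using sd[of m] sd[of n] by simp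
  qed
  obtain y where y: "y \<in> V" "conv s y"
  proof (rule Cauchy_conv[of s])
    fix e :: real assume e: "e > 0"
    obtain N where N: "4 / e\<^sup>2 < real N" using reals_Archimedean2 by blast
    have "nm (s m \<ominus> s n) < e" if mn: "m \<ge> N" "n \<ge> N" for m n
    proof -
      have "4 / e\<^sup>2 < real (Suc m)" "4 / e\<^sup>2 < real (Suc n)" using N mn by auto
      then have "2 / real (Suc m) < e\<^sup>2 / 2" "2 / real (Suc n) < e\<^sup>2 / 2" using e
        by (simp_all add: field_simps del: of_nat_Suc)
      then have "2 / real (Suc m) + 2 / real (Suc n) < e\<^sup>2" by linarith
      then have "(nm (s m \<ominus> s n))\<^sup>2 < e\<^sup>2" using par[of m n] by simp
      then show ?thesis using e by (simp add: power_less_imp_less_base)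
    qed
    then show "\<exists>N. \<forall>m\<ge>N. \<forall>n\<ge>N. nm (s m \<ominus> s n) < e" by blast
  qed (use sV in auto)
  have yS: "y \<in> S" by (rule closed_subspaceD(2)[OF S]) (use s y in auto)
  have "conv (\<lambda>n. x \<ominus> s n) (x \<ominus> y)"
  proof -
    have "(x \<ominus> s n) \<ominus> (x \<ominus> y) = y \<ominus> s n" for n
      by (rule ip_eqI) (use x y sV in auto)
    then show ?thesis using y nm_sub_commute[OF y(1) sV] by (simp add: conv_def)
  qed
  from conv_nm[OF _ _ this] have "(\<lambda>n. nm (x \<ominus> s n)) \<longlonglongrightarrow> nm (x \<ominus> y)" using x sV y by simp
  then have "(\<lambda>n. (nm (x \<ominus> s n))\<^sup>2) \<longlonglongrightarrow> (nm (x \<ominus> y))\<^sup>2" by (rule tendsto_power)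
  moreover have "(\<lambda>n. d + 1 / real (Suc n)) \<longlonglongrightarrow> d + 0"
    by (intro tendsto_add tendsto_const LIMSEQ_Suc[OF lim_1_over_n])
  ultimately have yd: "(nm (x \<ominus> y))\<^sup>2 \<le> d"
    using LIMSEQ_le[of "\<lambda>n. (nm (x \<ominus> s n))\<^sup>2" _ "\<lambda>n. d + 1 / real (Suc n)" "d + 0"] sd
    by (force intro: less_imp_le)
  have "ip z (x \<ominus> y) = 0" if z: "z \<in> S" for z
  proof (cases "z = nought")
    case False
    have zV: "z \<in> V" using SV[OF z] .
    \<comment> \<open>Moving \<open>y\<close> along \<open>z\<close> by the coefficient
      \<open>c / t\<close> would lower the squared distance to \<open>x\<close> by
      \<open>|c|^2 / t\<close>, which minimality of \<open>y\<close> forbids unless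
      \<open>c = 0\<close>.\<close>
    define c where "c = ip z (x \<ominus> y)"
    define t where "t = (nm z)\<^sup>2"
    have t: "t > 0" using False zV by (simp add: t_def)
    have "y \<oplus> (c / of_real t) \<odot> z \<in> S" by (intro subspaceD(4,5)[OF lin] yS z)
    from d_le[OF this] yd
    have "(nm (x \<ominus> y))\<^sup>2 \<le> (nm (x \<ominus> (y \<oplus> (c / of_real t) \<odot> z)))\<^sup>2" by simp
    also have "x \<ominus> (y \<oplus> (c / of_real t) \<odot> z) = (x \<ominus> y) \<ominus> (c / of_real t) \<odot> z"
      by (rule ip_eqI) (use x y zV in auto)
    also have "(nm \<dots>)\<^sup>2 = (nm (x \<ominus> y))\<^sup>2 - 2 * Re (c * cnj c / of_real t) + (cmod c / t)\<^sup>2 * t"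
      using x y zV t inner_commute[of "x \<ominus> y" z]
      by (simp add: nm_sub_sq norm_divide power_mult_distrib power_divide t_def[symmetric] c_def[symmetric])
    also have "Re (c * cnj c / of_real t) = (cmod c)\<^sup>2 / t"
      by (simp add: complex_norm_square[symmetric] del: of_real_power)
    also have "(nm (x \<ominus> y))\<^sup>2 - 2 * ((cmod c)\<^sup>2 / t) + (cmod c / t)\<^sup>2 * t
        = (nm (x \<ominus> y))\<^sup>2 - (cmod c)\<^sup>2 / t"
      using t by (simp add: power2_eq_square field_simps)
    finally have "(cmod c)\<^sup>2 / t \<le> 0" by simp
    then show ?thesis using t by (simp add: c_def divide_le_0_iff)
  qed (use x y in simp)
  then show ?thesis using yS by blast
qed

lemma orth_proj:
  assumes S: "closed_subspace H S" and x: "x \<in> V"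
  shows "orth_proj H S x \<in> S" "z \<in> S \<Longrightarrow> ip z (x \<ominus> orth_proj H S x) = 0"
    and orth_proj_unique: "y \<in> S \<Longrightarrow> (\<And>z. z \<in> S \<Longrightarrow> ip z (x \<ominus> y) = 0) \<Longrightarrow> orth_proj H S x = y"
proof -
  note SV = subspaceD(2)[OF closed_subspaceD(1)[OF S]]
  have un: "y = y'" if y: "y \<in> S" "\<forall>z\<in>S. ip z (x \<ominus> y) = 0"
    and y': "y' \<in> S" "\<forall>z\<in>S. ip z (x \<ominus> y') = 0" for y y'
  proof -
    have 1: "y \<ominus> y' \<in> S" using subspaceD(6)[OF closed_subspaceD(1)[OF S]] y y' by blast
    have "ip (y \<ominus> y') (y \<ominus> y') = ip (y \<ominus> y') (x \<ominus> y') - ip (y \<ominus> y') (x \<ominus> y)"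
      using SV[OF 1] SV y(1) y'(1) x by simp
    also have "\<dots> = 0" using y y' 1 by simp
    finally have "y \<ominus> y' = nought" using inner_definite SV[OF 1] by blast
    then show ?thesis using SV y y' by simp
  qed
  have ex: "\<exists>!y. y \<in> S \<and> (\<forall>z\<in>S. ip z (x \<ominus> y) = 0)"
    using projection_exists[OF S x] un by blast
  note th = theI'[OF ex, folded orth_proj_def]
  show "orth_proj H S x \<in> S" "z \<in> S \<Longrightarrow> ip z (x \<ominus> orth_proj H S x) = 0" using th by auto
  show "orth_proj H S x = y" if "y \<in> S" "\<And>z. z \<in> S \<Longrightarrow> ip z (x \<ominus> y) = 0"
    using un th that by blast
qed

context
  fixes S assumes S: "closed_subspace H S"
begin

lemma orth_proj_closed [simp, intro]: "x \<in> V \<Longrightarrow> orth_proj H S x \<in> V"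
  using orth_proj(1)[OF S] subspaceD(2)[OF closed_subspaceD(1)[OF S]] by blast

lemma ip_orth_proj: "x \<in> V \<Longrightarrow> z \<in> S \<Longrightarrow> ip z (orth_proj H S x) = ip z x"
  using orth_proj(2)[OF S, of x z] subspaceD(2)[OF closed_subspaceD(1)[OF S], of z] by simp

lemma orth_proj_id: "x \<in> S \<Longrightarrow> orth_proj H S x = x"
  using subspaceD(2)[OF closed_subspaceD(1)[OF S]] by (intro orth_proj_unique[OF S]) auto

lemma orth_proj_0: "x \<in> V \<Longrightarrow> (\<And>z. z \<in> S \<Longrightarrow> ip z x = 0) \<Longrightarrow> orth_proj H S x = nought"
  by (rule orth_proj_unique[OF S]) (use subspaceD(3)[OF closed_subspaceD(1)[OF S]] in auto)

text \<open>Both sides equal the inner product of the two projections. Linearity of the projection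
  is then obtained by moving it to the other argument.\<close>

lemma orth_proj_sym:
  "x \<in> V \<Longrightarrow> y \<in> V \<Longrightarrow> ip (orth_proj H S x) y = ip x (orth_proj H S y)"
  using ip_orth_proj[of y "orth_proj H S x"] ip_orth_proj[of x "orth_proj H S y"] orth_proj(1)[OF S]
    inner_commute[of "orth_proj H S x" "orth_proj H S y"] inner_commute[of x "orth_proj H S y"]
  by simp

lemma orth_proj_nm: "x \<in> V \<Longrightarrow> nm (orth_proj H S x) \<le> nm x"
proof -
  assume x: "x \<in> V"
  let ?p = "orth_proj H S x"
  have "(nm ?p)\<^sup>2 = Re (ip ?p x)" using ip_orth_proj[OF x orth_proj(1)[OF S x]] x by (simp add: nm_sq)
  also have "\<dots> \<le> nm ?p * nm x"
    using Cauchy_Schwarz[of ?p x] x complex_Re_le_cmod[of "ip ?p x"] by simp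
  finally show ?thesis using x
    by (cases "nm ?p = 0") (auto simp: power2_eq_square mult_le_cancel_left_pos less_le)
qed

lemma orth_proj_add:
  "x \<in> V \<Longrightarrow> y \<in> V \<Longrightarrow> orth_proj H S (x \<oplus> y) = orth_proj H S x \<oplus> orth_proj H S y"
  by (rule ip_eqI) (auto simp: orth_proj_sym[symmetric])

lemma orth_proj_sub:
  "x \<in> V \<Longrightarrow> y \<in> V \<Longrightarrow> orth_proj H S (x \<ominus> y) = orth_proj H S x \<ominus> orth_proj H S y"
  by (rule ip_eqI) (auto simp: orth_proj_sym[symmetric])

lemma orth_proj_scl: "x \<in> V \<Longrightarrow> orth_proj H S (a \<odot> x) = a \<odot> orth_proj H S x"
  by (rule ip_eqI) (auto simp: orth_proj_sym[symmetric])

lemma orthogonal_projector_orth_proj: "orthogonal_projector H (orth_proj H S)"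
  using orth_proj_add orth_proj_scl orth_proj_sym orth_proj_id[OF orth_proj(1)[OF S]]
  by (auto simp: orthogonal_projector_def linear_map_on_def)

end

end

section \<open>Orthonormal systems and finite-dimensional subspaces\<close>

context inner_product_space
begin

definition orthonormal :: "'v set \<Rightarrow> bool" where
  "orthonormal B \<longleftrightarrow> finite B \<and> B \<subseteq> V \<and> (\<forall>x\<in>B. \<forall>y\<in>B. ip x y = (if x = y then 1 else 0))"

definition fourier :: "'v set \<Rightarrow> 'v \<Rightarrow> 'v" where
  "fourier B x = vsum (\<lambda>b. ip b x \<odot> b) B"

text \<open>Dimension is bounded by counting orthonormal vectors, not through linear bases: this is
  exactly what a Hilbert--Schmidt bound on an eigenspace delivers, and a system of largest size is
  then a basis.\<close>

definition fdim :: "'v set \<Rightarrow> bool" where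
  "fdim F \<longleftrightarrow> linear_subspace H F \<and> (\<exists>N. \<forall>B\<subseteq>F. orthonormal B \<longrightarrow> card B \<le> N)"

lemma orthonormalD:
  assumes "orthonormal B"
  shows "finite B" "b \<in> B \<Longrightarrow> b \<in> V" "b \<in> B \<Longrightarrow> ip b b = 1" "b \<in> B \<Longrightarrow> nm b = 1"
    "b \<in> B \<Longrightarrow> b' \<in> B \<Longrightarrow> b \<noteq> b' \<Longrightarrow> ip b b' = 0"
  using assms by (auto simp: orthonormal_def vnorm_def)

lemma fourier_closed [simp, intro]: "orthonormal B \<Longrightarrow> x \<in> V \<Longrightarrow> fourier B x \<in> V"
  by (auto simp: fourier_def orthonormalD)

lemma fourier_in: "linear_subspace H F \<Longrightarrow> orthonormal B \<Longrightarrow> B \<subseteq> F \<Longrightarrow> fourier B x \<in> F"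
  unfolding fourier_def by (rule vsum_in) (auto simp: orthonormalD subspaceD)

lemma ip_fourier_right:
  "orthonormal B \<Longrightarrow> x \<in> V \<Longrightarrow> z \<in> V \<Longrightarrow> ip z (fourier B x) = (\<Sum>b\<in>B. ip b x * ip z b)"
  unfolding fourier_def by (subst ip_vsum_right) (auto simp: orthonormalD intro!: sum.cong)

lemma ip_fourier_left:
  "orthonormal B \<Longrightarrow> x \<in> V \<Longrightarrow> z \<in> V \<Longrightarrow> ip (fourier B x) z = (\<Sum>b\<in>B. cnj (ip b x) * ip b z)"
  unfolding fourier_def by (subst ip_vsum_left) (auto simp: orthonormalD intro!: sum.cong)

lemma ip_basis_fourier:
  assumes B: "orthonormal B" and x: "x \<in> V" and b: "b \<in> B" shows "ip b (fourier B x) = ip b x"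
proof -
  have "ip b (fourier B x) = (\<Sum>c\<in>B. ip c x * ip b c)"
    using B x b by (simp add: ip_fourier_right orthonormalD)
  also have "\<dots> = (\<Sum>c\<in>B. if c = b then ip c x else 0)"
    by (rule sum.cong) (use orthonormalD[OF B] b in auto)
  also have "\<dots> = ip b x" using orthonormalD(1)[OF B] b by simp
  finally show ?thesis .
qed

lemma fourier_sym:
  assumes B: "orthonormal B" and x: "x \<in> V" and z: "z \<in> V"
  shows "ip (fourier B z) x = ip z (fourier B x)"
  unfolding ip_fourier_right[OF B x z] ip_fourier_left[OF B z x]
  by (rule sum.cong) (use inner_commute[OF z] orthonormalD[OF B] in auto)

lemma nm_fourier_sq:
  assumes B: "orthonormal B" and x: "x \<in> V"
  shows "(nm (fourier B x))\<^sup>2 = (\<Sum>b\<in>B. (cmod (ip b x))\<^sup>2)"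
proof -
  have "ip (fourier B x) (fourier B x) = (\<Sum>b\<in>B. cnj (ip b x) * ip b (fourier B x))"
    using B x by (simp add: ip_fourier_left)
  also have "\<dots> = (\<Sum>b\<in>B. of_real ((cmod (ip b x))\<^sup>2))"
    unfolding complex_norm_square
    by (rule sum.cong) (use ip_basis_fourier[OF B x] in \<open>auto simp: mult.commute\<close>)
  finally show ?thesis using B x by (simp add: nm_sq)
qed

lemma nm_sub_fourier_sq:
  assumes B: "orthonormal B" and x: "x \<in> V"
  shows "(nm (x \<ominus> fourier B x))\<^sup>2 = (nm x)\<^sup>2 - (nm (fourier B x))\<^sup>2"
proof -
  have "ip x (fourier B x) = ip (fourier B x) (fourier B x)"
    unfolding ip_fourier_left[OF B x fourier_closed[OF B x]] ip_fourier_right[OF B x x]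
    by (rule sum.cong)
      (use ip_basis_fourier[OF B x] inner_commute[OF x] orthonormalD[OF B] in auto)
  then show ?thesis using B x by (simp add: nm_sub_sq) (simp add: nm_sq)
qed

lemma Bessel:
  assumes B: "orthonormal B" and x: "x \<in> V"
  shows "(\<Sum>b\<in>B. (cmod (ip b x))\<^sup>2) \<le> (nm x)\<^sup>2"
  using nm_sub_fourier_sq[OF B x] nm_fourier_sq[OF B x] zero_le_power2[of "nm (x \<ominus> fourier B x)"]
  by linarith

lemma nm_sub_fourier_le:
  assumes B: "orthonormal B" and x: "x \<in> V" shows "nm (x \<ominus> fourier B x) \<le> nm x"
  by (rule power2_le_imp_le) (use nm_sub_fourier_sq[OF B x] x B in auto)

lemma orthonormal_insert:
  assumes B: "orthonormal B" and r: "r \<in> V" "r \<noteq> nought" and orth: "\<And>b. b \<in> B \<Longrightarrow> ip b r = 0"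
  defines "e \<equiv> of_real (1 / nm r) \<odot> r"
  shows "orthonormal (insert e B)" "e \<notin> B" "nm e = 1"
proof -
  have n: "nm r > 0" using r by (simp add: less_le)
  have e: "e \<in> V" using r by (simp add: e_def)
  have be: "ip b e = 0" "ip e b = 0" if "b \<in> B" for b
    using orth[OF that] r orthonormalD(2)[OF B that] inner_commute[of r b]
    by (simp_all add: e_def)
  show "nm e = 1" using n r unfolding e_def by (simp add: norm_divide)
  then have "ip e e = 1" using ip_self[OF e] by simp
  then show "e \<notin> B" using be(1) by force
  show "orthonormal (insert e B)"
    using B e be \<open>ip e e = 1\<close> by (auto simp: orthonormal_def)
qed

text \<open>Take an orthonormal system of largest cardinality. If \<open>x\<close> differed from its
  Fourier sum, the normalised difference would enlarge the system.\<close>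

lemma fdim_basis:
  assumes F: "fdim F"
  obtains B where "B \<subseteq> F" "orthonormal B" "\<And>x. x \<in> F \<Longrightarrow> fourier B x = x"
proof -
  have lin: "linear_subspace H F" using F by (simp add: fdim_def)
  obtain N where N: "\<And>B. B \<subseteq> F \<Longrightarrow> orthonormal B \<Longrightarrow> card B \<le> N" using F by (auto simp: fdim_def)
  define P where "P B \<longleftrightarrow> B \<subseteq> F \<and> orthonormal B" for B
  have "P {}" by (auto simp: P_def orthonormal_def)
  moreover have "\<forall>B. P B \<longrightarrow> card B < Suc N" using N by (auto simp: P_def less_Suc_eq_le)
  ultimately obtain B where B: "P B" and mx: "\<And>A. P A \<Longrightarrow> card A \<le> card B"
    using ex_has_greatest_nat[of P "{}" card "Suc N"] by blast
  have BF: "B \<subseteq> F" "orthonormal B" using B by (auto simp: P_def)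
  have "fourier B x = x" if x: "x \<in> F" for x
  proof (rule ccontr)
    have xV: "x \<in> V" using subspaceD(2)[OF lin x] .
    define r where "r = x \<ominus> fourier B x"
    assume "fourier B x \<noteq> x"
    then have r: "r \<in> V" "r \<noteq> nought" using xV BF by (auto simp: r_def)
    have o: "ip b r = 0" if "b \<in> B" for b
      using that xV BF ip_basis_fourier[OF BF(2) xV that] by (simp add: r_def orthonormalD)
    note ins = orthonormal_insert[OF BF(2) r o]
    have "r \<in> F" unfolding r_def by (intro subspaceD(6)[OF lin] x fourier_in BF lin)
    then have "P (insert (of_real (1 / nm r) \<odot> r) B)"
      using ins(1) BF by (auto simp: P_def intro: subspaceD(5)[OF lin])
    from mx[OF this] show False using ins(2) orthonormalD(1)[OF BF(2)] by simp
  qed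
  then show ?thesis using that BF by blast
qed

text \<open>Double counting of \<open>|ip b a|^2\<close> over \<open>a\<close> in an orthonormal
  \<open>A\<close> and \<open>b\<close> in \<open>B\<close>: the expansion in \<open>B\<close> makes
  the total \<open>card A\<close>, while Bessel's inequality for \<open>A\<close> at each
  \<open>b\<close> makes it at most \<open>card B\<close>.\<close>

lemma fdimI:
  assumes lin: "linear_subspace H F" and B: "orthonormal B" and exp: "\<And>x. x \<in> F \<Longrightarrow> fourier B x = x"
  shows "fdim F"
proof -
  have "card A \<le> card B" if A: "A \<subseteq> F" "orthonormal A" for A
  proof -
    have "real (card A) = (\<Sum>a\<in>A. (nm (fourier B a))\<^sup>2)"
      using exp A orthonormalD(4)[OF A(2)] by (simp add: subset_iff)
    also have "\<dots> = (\<Sum>a\<in>A. \<Sum>b\<in>B. (cmod (ip b a))\<^sup>2)"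
      using nm_fourier_sq[OF B] orthonormalD[OF A(2)] by simp
    also have "\<dots> = (\<Sum>b\<in>B. \<Sum>a\<in>A. (cmod (ip b a))\<^sup>2)" by (rule sum.swap)
    also have "\<dots> = (\<Sum>b\<in>B. \<Sum>a\<in>A. (cmod (ip a b))\<^sup>2)"
      by (intro sum.cong refl)
        (metis B A(2) complex_mod_cnj inner_commute orthonormalD(2))
    also have "\<dots> \<le> (\<Sum>b\<in>B. (nm b)\<^sup>2)"
      by (intro sum_mono Bessel A orthonormalD(2)[OF B])
    also have "\<dots> = real (card B)" using orthonormalD(4)[OF B] by simp
    finally show ?thesis by simp
  qed
  then show ?thesis using lin by (auto simp: fdim_def)
qed

lemma fdim_subset: "fdim F \<Longrightarrow> linear_subspace H F' \<Longrightarrow> F' \<subseteq> F \<Longrightarrow> fdim F'"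
  unfolding fdim_def by (meson order_trans)

text \<open>As \<open>fourier B\<close> is symmetric, being fixed by it means being orthogonal to
  every \<open>z \<ominus> fourier B z\<close>.\<close>

lemma closed_subspace_fourier:
  assumes B: "orthonormal B" shows "closed_subspace H {x \<in> V. fourier B x = x}"
proof -
  have "{x \<in> V. fourier B x = x} = {x \<in> V. \<forall>z\<in>V. ip (z \<ominus> fourier B z) x = 0}"
    using B by (auto simp: fourier_sym intro!: ip_eqI)
  then show ?thesis using closed_subspace_weak[of V "\<lambda>z. z \<ominus> fourier B z"] B by auto
qed

lemma fdim_closed:
  assumes F: "fdim F" shows "closed_subspace H F"
proof -
  obtain B where B: "B \<subseteq> F" "orthonormal B" "\<And>x. x \<in> F \<Longrightarrow> fourier B x = x"
    using fdim_basis[OF F] by metis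
  have lin: "linear_subspace H F" using F by (simp add: fdim_def)
  have "F = {x \<in> V. fourier B x = x}"
    using B subspaceD(2)[OF lin] fourier_in[OF lin B(2,1)] by (metis (mono_tags, lifting) Collect_eqI Collect_mem_eq)
  then show ?thesis using closed_subspace_fourier[OF B(2)] by simp
qed

end

section \<open>Symmetric Hilbert--Schmidt operators have eigenvectors\<close>

text \<open>The operator acts on a closed subspace \<open>S\<close> because the eigenvector theorem
  is applied to invariant subspaces: to an irreducible subspace of \<open>L2 M\<close>, and to the
  orthogonal complement of known eigenvectors. \<open>C\<close> bounds the square of the
  Hilbert--Schmidt norm, tested on finite orthonormal systems.\<close>

locale HS_operator = hilbert_space +
  fixes S K C
  assumes S: "closed_subspace H S"
    and KS: "\<And>x. x \<in> S \<Longrightarrow> K x \<in> S"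
    and K_add: "\<And>x y. x \<in> S \<Longrightarrow> y \<in> S \<Longrightarrow> K (x \<oplus> y) = K x \<oplus> K y"
    and K_scl: "\<And>a x. x \<in> S \<Longrightarrow> K (a \<odot> x) = a \<odot> K x"
    and K_sym: "\<And>x y. x \<in> S \<Longrightarrow> y \<in> S \<Longrightarrow> ip (K x) y = ip x (K y)"
    and HS: "\<And>B. B \<subseteq> S \<Longrightarrow> orthonormal B \<Longrightarrow> (\<Sum>b\<in>B. (nm (K b))\<^sup>2) \<le> C"
begin

lemma lin: "linear_subspace H S" by (rule closed_subspaceD(1)[OF S])

lemma inV [simp, intro]: "x \<in> S \<Longrightarrow> x \<in> V" using subspaceD(2)[OF lin] .

lemmas inS [simp, intro] = subspaceD(3-6)[OF lin] KS

lemma K_sub: "x \<in> S \<Longrightarrow> y \<in> S \<Longrightarrow> K (x \<ominus> y) = K x \<ominus> K y"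
  by (simp add: vminus_def K_add K_scl)

lemma K_zero [simp]: "K nought = nought"
  using K_scl[of nought 0] by simp

lemma unit:
  assumes "x \<in> S" "x \<noteq> nought"
  shows "nm (K (of_real (1 / nm x) \<odot> x)) = nm (K x) / nm x"
  using assms by (simp add: K_scl norm_divide)

lemma HS_nonneg: "0 \<le> C"
  using HS[of "{}"] by (simp add: orthonormal_def)

text \<open>The Hilbert--Schmidt bound for the system consisting of the normalised \<open>x\<close>
  alone.\<close>

lemma K_bound: "x \<in> S \<Longrightarrow> nm (K x) \<le> sqrt C * nm x"
proof (cases "x = nought")
  case False
  assume x: "x \<in> S"
  have n: "nm x > 0" using x False by (simp add: less_le)
  let ?e = "of_real (1 / nm x) \<odot> x"
  have "orthonormal (insert ?e {})"
    by (rule orthonormal_insert) (use x False in \<open>auto simp: orthonormal_def\<close>)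
  then have "(nm (K ?e))\<^sup>2 \<le> C" using HS[of "{?e}"] x by simp
  then have "nm (K x) / nm x \<le> sqrt C" unfolding unit[OF x False] by (rule real_le_rsqrt)
  then show ?thesis using n by (simp add: field_simps)
qed simp

lemma K_conv: "(\<And>n. s n \<in> S) \<Longrightarrow> x \<in> S \<Longrightarrow> conv s x \<Longrightarrow> conv (\<lambda>n. K (s n)) (K x)"
proof -
  assume s: "\<And>n. s n \<in> S" and x: "x \<in> S" and c: "conv s x"
  have "(\<lambda>n. sqrt C * nm (s n \<ominus> x)) \<longlonglongrightarrow> 0"
    using c unfolding conv_def by (rule tendsto_mult_right_zero)
  moreover have "norm (nm (K (s n) \<ominus> K x)) \<le> sqrt C * nm (s n \<ominus> x)" for n
    using K_bound[of "s n \<ominus> x"] s x by (simp add: K_sub)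
  ultimately show ?thesis unfolding conv_def
    by (rule Lim_null_comparison[OF always_eventually[OF allI], rotated])
qed

text \<open>The system \<open>B\<close> is chosen to almost exhaust the Hilbert--Schmidt norm.\<close>

lemma finite_rank_approx:
  assumes d: "d > 0"
  obtains B where "B \<subseteq> S" "orthonormal B"
    "\<And>w. w \<in> S \<Longrightarrow> (\<And>b. b \<in> B \<Longrightarrow> ip b w = 0) \<Longrightarrow> nm (K w) \<le> d * nm w"
proof -
  define \<B> where "\<B> = {B. B \<subseteq> S \<and> orthonormal B}"
  define \<Sigma> where "\<Sigma> B = (\<Sum>b\<in>B. (nm (K b))\<^sup>2)" for B
  have bdd: "bdd_above (\<Sigma> ` \<B>)" using HS by (intro bdd_aboveI2[of _ _ C]) (auto simp: \<B>_def \<Sigma>_def)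
  have ne: "\<B> \<noteq> {}" by (auto simp: \<B>_def orthonormal_def)
  have "d\<^sup>2 > 0" using d by simp
  then obtain B where B: "B \<in> \<B>" and big: "Sup (\<Sigma> ` \<B>) - d\<^sup>2 < \<Sigma> B"
    using less_cSup_iff[of "\<Sigma> ` \<B>" "Sup (\<Sigma> ` \<B>) - d\<^sup>2"] ne bdd by auto
  have BS: "B \<subseteq> S" "orthonormal B" using B by (auto simp: \<B>_def)
  have "nm (K w) \<le> d * nm w" if w: "w \<in> S" and o: "\<And>b. b \<in> B \<Longrightarrow> ip b w = 0" for w
  proof (cases "w = nought")
    case False
    have n: "nm w > 0" using w False by (simp add: less_le)
    let ?e = "of_real (1 / nm w) \<odot> w"
    note ins = orthonormal_insert[OF BS(2) inV[OF w] False o]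
    have "insert ?e B \<in> \<B>" using ins(1) BS w by (auto simp: \<B>_def)
    then have "\<Sigma> (insert ?e B) \<le> Sup (\<Sigma> ` \<B>)" by (rule cSUP_upper[OF _ bdd])
    moreover have "\<Sigma> (insert ?e B) = (nm (K ?e))\<^sup>2 + \<Sigma> B"
      unfolding \<Sigma>_def by (rule sum.insert) (use ins(2) orthonormalD(1)[OF BS(2)] in auto)
    ultimately have "(nm (K ?e))\<^sup>2 \<le> d\<^sup>2" using big by linarith
    then have "nm (K w) / nm w \<le> d" unfolding unit[OF w False] using d by (auto intro: power2_le_imp_le)
    then show ?thesis using n by (simp add: field_simps)
  qed simp
  then show ?thesis using that BS by blast
qed

definition ball where "ball = {x \<in> S. nm x \<le> 1}"

text \<open>Up to a small error \<open>K\<close> sees only the Fourier coefficients with respect to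
  the finite system \<open>B\<close>. Vectors of the ball are sorted into finitely many grid cells
  by these coefficients, and \<open>K\<close> maps each cell to a set of small diameter.\<close>

lemma K_totally_bounded: "ms.mtotally_bounded (K ` ball)"
  unfolding ms.mtotally_bounded_def
proof (intro allI impI)
  fix e :: real assume e: "e > 0"
  have "e / 6 > 0" using e by simp
  then obtain B where B: "B \<subseteq> S" "orthonormal B"
    and small: "\<And>w. w \<in> S \<Longrightarrow> (\<And>b. b \<in> B \<Longrightarrow> ip b w = 0) \<Longrightarrow> nm (K w) \<le> e / 6 * nm w"
    using finite_rank_approx by metis
  \<comment> \<open>The added 1 keeps \<open>n\<close> positive for empty \<open>B\<close>, and
    \<open>n^2\<close> dominates \<open>card B\<close>. Likewise \<open>M\<close> is positive even
    for \<open>C = 0\<close>.\<close>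
  define n where "n = real (card B) + 1"
  define M where "M = sqrt C + 1"
  have M: "M > 0" "sqrt C \<le> M" using HS_nonneg by (auto simp: M_def add_nonneg_pos)
  have n: "n > 0" by (simp add: n_def)
  \<comment> \<open>This makes \<open>2 * n * \<eta> = e / (6 * M)\<close>. For the difference
    \<open>z\<close> of two vectors in one cell, \<open>K\<close> then has norm at most
    \<open>e / 6\<close> on the component along \<open>B\<close> and at most
    \<open>2 * e / 6\<close> on the rest, as \<open>nm z \<le> 2\<close>.\<close>
  define \<eta> where "\<eta> = e / (12 * M * n)"
  have \<eta>: "\<eta> > 0" using e M n by (simp add: \<eta>_def)
  define m where "m = \<lceil>1 / \<eta>\<rceil> + 1"
  define cell where
    "cell x = (\<lambda>b\<in>B. (\<lfloor>Re (ip b x) / \<eta>\<rfloor>, \<lfloor>Im (ip b x) / \<eta>\<rfloor>))" for x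
  have fl: "\<lfloor>t / \<eta>\<rfloor> \<in> {-m..m}" if "\<bar>t\<bar> \<le> 1" for t
  proof -
    have "\<bar>t / \<eta>\<bar> \<le> 1 / \<eta>" using that \<eta> by (simp add: divide_right_mono)
    then have "t / \<eta> \<le> 1 / \<eta>" "- (1 / \<eta>) \<le> t / \<eta>" by linarith+
    then show ?thesis unfolding m_def atLeastAtMost_iff by linarith
  qed
  have "cell ` ball \<subseteq> PiE B (\<lambda>_. {-m..m} \<times> {-m..m})"
  proof
    fix f assume "f \<in> cell ` ball"
    then obtain x where x: "x \<in> S" "nm x \<le> 1" "f = cell x" by (auto simp: ball_def)
    have "cmod (ip b x) \<le> 1" if "b \<in> B" for b
      using Cauchy_Schwarz[of b x] x orthonormalD(2,4)[OF B(2) that] by simp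
    then have "\<bar>Re (ip b x)\<bar> \<le> 1" "\<bar>Im (ip b x)\<bar> \<le> 1" if "b \<in> B" for b
      using that abs_Re_le_cmod[of "ip b x"] abs_Im_le_cmod[of "ip b x"] by fastforce+
    then show "f \<in> PiE B (\<lambda>_. {-m..m} \<times> {-m..m})"
      unfolding x cell_def using fl by (auto simp del: atLeastAtMost_iff)
  qed
  then have "finite (cell ` ball)"
    by (rule finite_subset) (intro finite_PiE orthonormalD(1)[OF B(2)] finite_cartesian_product finite_atLeastAtMost_int)
  then obtain A where A: "A \<subseteq> ball" "finite A" "cell ` ball = cell ` A"
    using finite_subset_image[of "cell ` ball" cell ball] by auto
  have close: "nm (K x \<ominus> K y) < e" if xy: "x \<in> ball" "y \<in> ball" and eq: "cell x = cell y" for x y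
  proof -
    have S: "x \<in> S" "y \<in> S" "nm x \<le> 1" "nm y \<le> 1" using xy by (auto simp: ball_def)
    define z where "z = x \<ominus> y"
    define p where "p = fourier B z"
    have z: "z \<in> S" using S by (simp add: z_def)
    have p: "p \<in> S" unfolding p_def by (intro fourier_in lin B)
    have "z = x \<oplus> (-1) \<odot> y" by (simp add: z_def vminus_def)
    then have nz: "nm z \<le> 2" using nm_triangle[of x "(-1) \<odot> y"] S by simp
    have fle: "\<bar>s - t\<bar> \<le> \<eta>" if "\<lfloor>s / \<eta>\<rfloor> = \<lfloor>t / \<eta>\<rfloor>" for s t
    proof -
      have "\<bar>s / \<eta> - t / \<eta>\<bar> < 1" using that by linarith
      then have "\<bar>s - t\<bar> / \<eta> < 1" using \<eta> by (simp add: diff_divide_distrib[symmetric] abs_divide)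
      then show ?thesis using \<eta> by (simp add: field_simps)
    qed
    have "cmod (ip b z) \<le> 2 * \<eta>" if b: "b \<in> B" for b
    proof -
      have "cell x b = cell y b" using eq by simp
      then have "\<bar>Re (ip b x) - Re (ip b y)\<bar> \<le> \<eta>" "\<bar>Im (ip b x) - Im (ip b y)\<bar> \<le> \<eta>"
        using b by (auto simp: cell_def intro: fle)
      then show ?thesis using cmod_le[of "ip b z"] S orthonormalD(2)[OF B(2) b] by (simp add: z_def)
    qed
    then have "(\<Sum>b\<in>B. (cmod (ip b z))\<^sup>2) \<le> (\<Sum>b\<in>B. (2 * \<eta>)\<^sup>2)"
      by (intro sum_mono power_mono) auto
    then have "(nm p)\<^sup>2 \<le> real (card B) * (2 * \<eta>)\<^sup>2"
      using nm_fourier_sq[OF B(2) inV[OF z]] by (simp add: p_def)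
    also have "\<dots> \<le> n\<^sup>2 * (2 * \<eta>)\<^sup>2"
      by (intro mult_right_mono) (auto simp: n_def power2_eq_square algebra_simps)
    finally have "(nm p)\<^sup>2 \<le> (n * (2 * \<eta>))\<^sup>2" by (simp add: power_mult_distrib)
    then have "nm p \<le> n * (2 * \<eta>)" by (rule power2_le_imp_le) (use n \<eta> in auto)
    also have "\<dots> = e / (6 * M)" using n M by (simp add: \<eta>_def field_simps)
    finally have "M * nm p \<le> e / 6" using M by (simp add: field_simps)
    moreover have "nm (K p) \<le> M * nm p"
      using K_bound[OF p] M(2) p by (meson mult_right_mono nm_nonneg inV order_trans)
    moreover have "nm (K (z \<ominus> p)) \<le> e / 6 * 2"
    proof -
      have "ip b (z \<ominus> p) = 0" if "b \<in> B" for b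
        using ip_basis_fourier[OF B(2) inV[OF z] that] that z p B by (simp add: p_def orthonormalD)
      then have "nm (K (z \<ominus> p)) \<le> e / 6 * nm (z \<ominus> p)" by (intro small) (use z p in auto)
      also have "\<dots> \<le> e / 6 * 2"
        using nm_sub_fourier_le[OF B(2) inV[OF z]] nz e by (intro mult_left_mono) (auto simp: p_def)
      finally show ?thesis .
    qed
    moreover have "nm (K z) \<le> nm (K (z \<ominus> p)) + nm (K p)"
      using nm_triangle[of "K (z \<ominus> p)" "K p"] z p by (simp add: K_add[symmetric])
    ultimately have "nm (K z) < e" using e by linarith
    then show ?thesis using S by (simp add: z_def K_sub)
  qed
  show "\<exists>A'. finite A' \<and> A' \<subseteq> K ` ball \<and> K ` ball \<subseteq> (\<Union>x\<in>A'. ms.mball x e)"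
  proof (intro exI conjI)
    show "finite (K ` A)" "K ` A \<subseteq> K ` ball" using A by auto
    show "K ` ball \<subseteq> (\<Union>x\<in>K ` A. ms.mball x e)"
    proof
      fix w assume "w \<in> K ` ball"
      then obtain x where x: "x \<in> ball" "w = K x" by auto
      then obtain a where a: "a \<in> A" "cell a = cell x" using A(3) by (metis imageE imageI)
      have "a \<in> ball" using a A by auto
      then have "w \<in> ms.mball (K a) e" using close[of a x] a x by (auto simp: vdist_def ball_def)
      then show "w \<in> (\<Union>x\<in>K ` A. ms.mball x e)" using a by auto
    qed
  qed
qed

text \<open>A maximising sequence for the norm of \<open>K\<close> on the unit ball yields an eigenvector \<open>w\<close> of
  \<open>K\<^sup>2\<close> for the eigenvalue \<open>s\<^sup>2\<close>; then \<open>w\<close> or \<open>K w - s w\<close> is an eigenvector of \<open>K\<close>.\<close>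

lemma HS_eigenvector:
  assumes nz: "S \<noteq> {nought}"
  shows "\<exists>v\<in>S. \<exists>c. v \<noteq> nought \<and> K v = of_real c \<odot> v \<and> (c = 0 \<longrightarrow> (\<forall>x\<in>S. K x = nought))"
proof -
  define s where "s = (SUP x\<in>ball. nm (K x))"
  have bdd: "bdd_above ((\<lambda>x. nm (K x)) ` ball)"
  proof (rule bdd_aboveI2)
    fix x assume "x \<in> ball"
    then have "x \<in> S" "nm x \<le> 1" by (auto simp: ball_def)
    then show "nm (K x) \<le> sqrt C"
      using K_bound[of x] HS_nonneg mult_left_mono[of "nm x" 1 "sqrt C"] by simp
  qed
  have b0: "nought \<in> ball" by (simp add: ball_def)
  have s_upper: "nm (K x) \<le> s" if "x \<in> ball" for x unfolding s_def by (rule cSUP_upper[OF that bdd])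
  have s0: "0 \<le> s" using s_upper[OF b0] by simp
  have Ks: "nm (K x) \<le> s * nm x" if x: "x \<in> S" for x
  proof (cases "x = nought")
    case False
    have n: "nm x > 0" using x False by (simp add: less_le)
    have "of_real (1 / nm x) \<odot> x \<in> ball" using x n by (simp add: ball_def norm_divide)
    then have "nm (K x) / nm x \<le> s" using s_upper unit[OF x False] by metis
    then show ?thesis using n by (simp add: field_simps)
  qed simp
  show ?thesis
  \<comment> \<open>For \<open>s = 0\<close> the operator vanishes on \<open>S\<close> and every
    nonzero vector will do. Only here is the eigenvalue 0 returned, which gives the last clause of
    the claim.\<close>
  proof (cases "s = 0")
    case True
    then have K0: "K x = nought" if "x \<in> S" for x
    proof -
      have "nm (K x) = 0" by (rule antisym) (use Ks[OF that] True that in simp_all)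
      then show ?thesis using that by simp
    qed
    obtain v where "v \<in> S" "v \<noteq> nought" using nz inS(1) by blast
    then have "v \<in> S \<and> v \<noteq> nought \<and> K v = of_real 0 \<odot> v \<and> (\<forall>x\<in>S. K x = nought)" using K0 by simp
    then show ?thesis by blast
  next
    case False
    then have s: "s > 0" using s0 by simp
    have "\<exists>x\<in>ball. s - 1 / real (Suc n) < nm (K x)" for n
      using less_cSUP_iff[OF _ bdd, of "s - 1 / real (Suc n)"] b0 by (auto simp: s_def)
    then obtain v where v: "\<And>n. v n \<in> ball" and vs: "\<And>n. s - 1 / real (Suc n) < nm (K (v n))" by metis
    have "range (\<lambda>n. K (v n)) \<subseteq> K ` ball" using v by auto
    then obtain r where r: "strict_mono r" and Cau: "ms.MCauchy ((\<lambda>n. K (v n)) \<circ> r)"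
      using K_totally_bounded unfolding ms.mtotally_bounded_sequentially by blast
    define u where "u n = v (r n)" for n
    have u: "u n \<in> S" "nm (u n) \<le> 1" for n using v by (auto simp: u_def ball_def)
    have u_lim: "(\<lambda>n. nm (K (u n))) \<longlonglongrightarrow> s"
    proof (rule tendsto_sandwich[of "\<lambda>n. s - 1 / real (Suc n)" _ _ "\<lambda>_. s"])
      have "s - 1 / real (Suc n) \<le> nm (K (u n))" for n
      proof -
        have "1 / real (Suc (r n)) \<le> 1 / real (Suc n)"
          using seq_suble[OF r, of n] by (intro divide_left_mono) auto
        then show ?thesis using vs[of "r n"] by (simp add: u_def)
      qed
      then show "\<forall>\<^sub>F n in sequentially. s - 1 / real (Suc n) \<le> nm (K (u n))" by simp
      show "\<forall>\<^sub>F n in sequentially. nm (K (u n)) \<le> s" using s_upper v by (simp add: u_def)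
      have "(\<lambda>n. s - 1 / real (Suc n)) \<longlonglongrightarrow> s - 0"
        by (intro tendsto_diff tendsto_const LIMSEQ_Suc[OF lim_1_over_n])
      then show "(\<lambda>n. s - 1 / real (Suc n)) \<longlonglongrightarrow> s" by simp
    qed simp
    obtain w where w: "w \<in> V" "conv (\<lambda>n. K (u n)) w"
    proof (rule Cauchy_conv[of "\<lambda>n. K (u n)"])
      fix e :: real assume "e > 0"
      then show "\<exists>N. \<forall>m\<ge>N. \<forall>n\<ge>N. nm (K (u m) \<ominus> K (u n)) < e"
        using Cau u unfolding ms.MCauchy_def by (fastforce simp: vdist_def u_def)
    qed (use u in auto)
    have wS: "w \<in> S" by (rule closed_subspaceD(2)[OF S _ w]) (use u in auto)
    have nw: "nm w = s"
      using LIMSEQ_unique[OF conv_nm[OF _ w] u_lim] u by auto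
    \<comment> \<open>Expand the square, with \<open>ip (K (K x)) x = |K x|^2\<close> by symmetry.
      Along a maximising sequence the right-hand side tends to 0.\<close>
    have d: "(nm (K (K x) \<ominus> of_real (s\<^sup>2) \<odot> x))\<^sup>2 \<le> s\<^sup>2 * (s\<^sup>2 - (nm (K x))\<^sup>2)"
      if x: "x \<in> S" "nm x \<le> 1" for x
    proof -
      have 1: "ip (K (K x)) x = of_real ((nm (K x))\<^sup>2)"
        using x K_sym[of "K x" x] by (simp add: ip_self)
      have 2: "(nm (K (K x)))\<^sup>2 \<le> s\<^sup>2 * (nm (K x))\<^sup>2"
        using Ks[of "K x"] x s by (metis KS inV nm_nonneg power_mono power_mult_distrib)
      have 3: "(s\<^sup>2 * nm x)\<^sup>2 \<le> s\<^sup>2 * s\<^sup>2"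
        using x s by (simp add: power_mult_distrib power2_eq_square mult_le_one)
      have "(nm (K (K x) \<ominus> of_real (s\<^sup>2) \<odot> x))\<^sup>2
          = (nm (K (K x)))\<^sup>2 - 2 * (s\<^sup>2 * (nm (K x))\<^sup>2) + (s\<^sup>2 * nm x)\<^sup>2"
        using x by (simp add: nm_sub_sq 1 norm_mult norm_power del: of_real_power)
      then show ?thesis using 2 3 by (simp add: algebra_simps)
    qed
    have KKu: "conv (\<lambda>n. K (K (u n))) (K w)" by (rule K_conv) (use u wS w in auto)
    \<comment> \<open>So far only the images \<open>K (u n)\<close> are known to converge. The
      estimate \<open>d\<close> carries convergence over to multiples of \<open>u n\<close> itself;
      applying \<open>K\<close> once more then computes \<open>K (K w)\<close>.\<close>
    have "conv (\<lambda>n. of_real (s\<^sup>2) \<odot> u n) (K w)"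
    proof -
      have "(\<lambda>n. s\<^sup>2 * (s\<^sup>2 - (nm (K (u n)))\<^sup>2)) \<longlonglongrightarrow> s\<^sup>2 * (s\<^sup>2 - s\<^sup>2)"
        by (intro tendsto_intros u_lim)
      then have "(\<lambda>n. sqrt (s\<^sup>2 * (s\<^sup>2 - (nm (K (u n)))\<^sup>2))) \<longlonglongrightarrow> sqrt 0"
        by (intro tendsto_real_sqrt) simp
      from tendsto_add[OF this KKu[unfolded conv_def]]
      have "(\<lambda>n. sqrt (s\<^sup>2 * (s\<^sup>2 - (nm (K (u n)))\<^sup>2)) + nm (K (K (u n)) \<ominus> K w)) \<longlonglongrightarrow> 0" by simp
      moreover have "norm (nm (of_real (s\<^sup>2) \<odot> u n \<ominus> K w))
          \<le> sqrt (s\<^sup>2 * (s\<^sup>2 - (nm (K (u n)))\<^sup>2)) + nm (K (K (u n)) \<ominus> K w)" for n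
        using nm_sub_triangle[of "of_real (s\<^sup>2) \<odot> u n" "K (K (u n))" "K w"]
          real_le_rsqrt[OF d[OF u(1)[of n] u(2)[of n]]] nm_sub_commute[of "of_real (s\<^sup>2) \<odot> u n" "K (K (u n))"] u wS
        by (simp del: of_real_power)
      ultimately show ?thesis unfolding conv_def
        by (rule Lim_null_comparison[OF always_eventually[OF allI], rotated])
    qed
    then have "conv (\<lambda>n. K (of_real (s\<^sup>2) \<odot> u n)) (K (K w))" by (rule K_conv[rotated 2]) (use u wS in auto)
    then have c1: "conv (\<lambda>n. of_real (s\<^sup>2) \<odot> K (u n)) (K (K w))" using u by (simp add: K_scl)
    have c2: "conv (\<lambda>n. of_real (s\<^sup>2) \<odot> K (u n)) (of_real (s\<^sup>2) \<odot> w)"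
    proof -
      have "of_real (s\<^sup>2) \<odot> K (u n) \<ominus> of_real (s\<^sup>2) \<odot> w = of_real (s\<^sup>2) \<odot> (K (u n) \<ominus> w)" for n
        by (rule ip_eqI) (use u wS in \<open>auto simp: algebra_simps\<close>)
      then have "nm (of_real (s\<^sup>2) \<odot> K (u n) \<ominus> of_real (s\<^sup>2) \<odot> w) = s\<^sup>2 * nm (K (u n) \<ominus> w)" for n
        using u wS by (simp add: norm_power)
      moreover have "(\<lambda>n. s\<^sup>2 * nm (K (u n) \<ominus> w)) \<longlonglongrightarrow> s\<^sup>2 * 0"
        using w(2) unfolding conv_def by (intro tendsto_intros)
      ultimately show ?thesis by (simp add: conv_def)
    qed
    have KKw: "K (K w) = of_real (s\<^sup>2) \<odot> w"
      by (rule conv_unique[OF _ _ _ c1 c2]) (use u wS in auto)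
    have w0: "w \<noteq> nought" using nw s by auto
    show ?thesis
    proof (cases "K w = of_real s \<odot> w")
      case True then show ?thesis using wS w0 s by blast
    next
      case False
      define z where "z = K w \<ominus> of_real s \<odot> w"
      have z: "z \<in> S" "z \<noteq> nought" using False wS by (auto simp: z_def)
      have "K z = of_real (s\<^sup>2) \<odot> w \<ominus> of_real s \<odot> K w"
        using wS by (simp add: z_def K_sub K_scl KKw)
      also have "\<dots> = of_real (- s) \<odot> z"
        unfolding z_def by (rule ip_eqI) (use wS in \<open>auto simp: algebra_simps power2_eq_square\<close>)
      finally have "K z = of_real (- s) \<odot> z" .
      then show ?thesis using z s by (metis neg_equal_0_iff_equal less_irrefl)
    qed
  qed
qed

end

section \<open>Symmetric operators on finite-dimensional subspaces\<close>

context hilbert_space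
begin

lemma lin_span_orth:
  assumes "y \<in> V" "S \<subseteq> V" "\<And>z. z \<in> S \<Longrightarrow> ip z y = 0" "x \<in> lin_span S"
  shows "ip x y = 0"
proof -
  have "linear_subspace H {z \<in> V. ip z y = 0}" using assms(1) by (auto simp: linear_subspace_def)
  then have "lin_span S \<subseteq> {z \<in> V. ip z y = 0}" by (rule lin_span_minimal) (use assms in auto)
  then show ?thesis using assms(4) by auto
qed

end

locale fdim_operator = hilbert_space +
  fixes F K
  assumes F: "fdim F"
    and KF: "\<And>x. x \<in> F \<Longrightarrow> K x \<in> F"
    and K_add: "\<And>x y. x \<in> F \<Longrightarrow> y \<in> F \<Longrightarrow> K (x \<oplus> y) = K x \<oplus> K y"
    and K_scl: "\<And>a x. x \<in> F \<Longrightarrow> K (a \<odot> x) = a \<odot> K x"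
    and K_sym: "\<And>x y. x \<in> F \<Longrightarrow> y \<in> F \<Longrightarrow> ip (K x) y = ip x (K y)"
begin

lemma lin: "linear_subspace H F" using F by (simp add: fdim_def)

lemma inV [simp, intro]: "x \<in> F \<Longrightarrow> x \<in> V" using subspaceD(2)[OF lin] .

lemma orth_component:
  assumes W: "linear_subspace H W" "W \<subseteq> F" and x: "x \<in> F" "x \<notin> W"
  shows "\<exists>y\<in>F. y \<noteq> nought \<and> (\<forall>z\<in>W. ip z y = 0)"
proof (intro bexI conjI ballI)
  have cW: "closed_subspace H W" by (rule fdim_closed[OF fdim_subset[OF F W]])
  note p = orth_proj[OF cW inV[OF x(1)]]
  have pF: "orth_proj H W x \<in> F" using p(1) W by auto
  show "x \<ominus> orth_proj H W x \<in> F" by (rule subspaceD(6)[OF lin x(1) pF])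
  show "x \<ominus> orth_proj H W x \<noteq> nought" using p(1) x pF by auto
  show "ip z (x \<ominus> orth_proj H W x) = 0" if "z \<in> W" for z using p(2)[OF that] .
qed

text \<open>The orthogonal complement \<open>F'\<close> of all eigenvectors is invariant by
  symmetry. If it were nonzero, the eigenvector theorem applied to it would yield an eigenvector
  orthogonal to itself.\<close>

lemma fdim_eigenvectors_span: "F \<subseteq> lin_span {v \<in> F. \<exists>c. K v = complex_of_real c \<odot> v}"
proof (rule ccontr)
  let ?E = "{v \<in> F. \<exists>c. K v = complex_of_real c \<odot> v}"
  let ?W = "lin_span ?E"
  have EV: "?E \<subseteq> V" by auto
  have W: "linear_subspace H ?W" "?W \<subseteq> F"
    using linear_subspace_lin_span[OF EV] lin_span_minimal[OF lin] by auto
  define F' where "F' = F \<inter> {x \<in> V. \<forall>z\<in>?E. ip z x = 0}"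
  have cF': "closed_subspace H F'"
    unfolding F'_def by (intro closed_subspace_Int fdim_closed[OF F] closed_subspace_weak) auto
  assume "\<not> F \<subseteq> ?W"
  then obtain x where x: "x \<in> F" "x \<notin> ?W" by blast
  obtain y where y: "y \<in> F" "y \<noteq> nought" "\<And>z. z \<in> ?W \<Longrightarrow> ip z y = 0"
    using orth_component[OF W x] by blast
  have "y \<in> F'" using y lin_span_superset[of ?E] by (auto simp: F'_def)
  then have ne: "F' \<noteq> {nought}" using y(2) by auto
  obtain B where B: "B \<subseteq> F" "orthonormal B" "\<And>x. x \<in> F \<Longrightarrow> fourier B x = x"
    using fdim_basis[OF F] by metis
  \<comment> \<open>The squared Hilbert--Schmidt norm computed on a basis \<open>B\<close> of
    \<open>F\<close> bounds the sum over any other orthonormal system: expand in \<open>B\<close>,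
    exchange the sums, use symmetry and Bessel's inequality.\<close>
  have HS: "HS_operator H F' K (\<Sum>b\<in>B. (nm (K b))\<^sup>2)"
  proof (unfold_locales, rule cF')
    show "K x \<in> F'" if x: "x \<in> F'" for x
    proof -
      have "ip z (K x) = 0" if z: "z \<in> F" "K z = complex_of_real c \<odot> z" for z c
        using K_sym[OF z(1), of x] x z by (auto simp: F'_def)
      then show ?thesis using x KF by (auto simp: F'_def)
    qed
    show "(\<Sum>a\<in>A. (nm (K a))\<^sup>2) \<le> (\<Sum>b\<in>B. (nm (K b))\<^sup>2)" if A: "A \<subseteq> F'" "orthonormal A" for A
    proof -
      have AF: "a \<in> F" if "a \<in> A" for a using that A by (auto simp: F'_def)
      have BF: "b \<in> F" if "b \<in> B" for b using that B by auto
      have "(\<Sum>a\<in>A. (nm (K a))\<^sup>2) = (\<Sum>a\<in>A. \<Sum>b\<in>B. (cmod (ip b (K a)))\<^sup>2)"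
        using B(3)[OF KF[OF AF]] nm_fourier_sq[OF B(2) inV[OF KF[OF AF]]] by simp
      also have "\<dots> = (\<Sum>b\<in>B. \<Sum>a\<in>A. (cmod (ip b (K a)))\<^sup>2)" by (rule sum.swap)
      also have "\<dots> = (\<Sum>b\<in>B. \<Sum>a\<in>A. (cmod (ip a (K b)))\<^sup>2)"
      proof (intro sum.cong refl)
        fix b a assume "b \<in> B" "a \<in> A"
        then have "ip b (K a) = cnj (ip a (K b))"
          using K_sym[of b a] inner_commute[of "K b" a] AF BF KF by simp
        then show "(cmod (ip b (K a)))\<^sup>2 = (cmod (ip a (K b)))\<^sup>2" by simp
      qed
      also have "\<dots> \<le> (\<Sum>b\<in>B. (nm (K b))\<^sup>2)"
        by (intro sum_mono Bessel A) (use BF KF in auto)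
      finally show ?thesis .
    qed
  qed (auto simp: F'_def K_add K_scl K_sym)
  obtain v c where v: "v \<in> F'" "v \<noteq> nought" "K v = of_real c \<odot> v"
    using HS_operator.HS_eigenvector[OF HS ne] by blast
  then have "v \<in> ?E" by (auto simp: F'_def)
  then have "ip v v = 0" using v by (auto simp: F'_def)
  then show False using inner_definite v by (auto simp: F'_def)
qed

text \<open>If \<open>y\<close> is orthogonal to the range, then
  \<open>|K y|^2 = ip (K (K y)) y = 0\<close>, so \<open>y = 0\<close> by injectivity. Used to solve
  \<open>K U u - c u = z\<close> inside the form domain.\<close>

lemma fdim_inj_surj:
  assumes inj: "\<And>x. x \<in> F \<Longrightarrow> K x = nought \<Longrightarrow> x = nought" and x: "x \<in> F"
  shows "x \<in> K ` F"
proof (rule ccontr)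
  assume x': "x \<notin> K ` F"
  have "nought \<in> F" using subspaceD(3)[OF lin] .
  moreover from this have "K nought = nought" using K_scl[of nought 0] KF by simp
  ultimately have 0: "nought \<in> K ` F" by (metis imageI)
  have add: "u \<oplus> v \<in> K ` F" if uv: "u \<in> K ` F" "v \<in> K ` F" for u v
  proof -
    obtain u' v' where "u' \<in> F" "v' \<in> F" "u = K u'" "v = K v'" using uv by blast
    then show ?thesis using K_add[of u' v', symmetric] subspaceD(4)[OF lin, of u' v'] by simp
  qed
  have scl: "a \<odot> u \<in> K ` F" if u: "u \<in> K ` F" for u a
  proof -
    obtain u' where "u' \<in> F" "u = K u'" using u by blast
    then show ?thesis using K_scl[of u' a, symmetric] subspaceD(5)[OF lin, of u' a] by simp
  qed
  have KF': "K ` F \<subseteq> F" using KF by blast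
  have W: "linear_subspace H (K ` F)"
    unfolding linear_subspace_def
    by (intro conjI ballI allI 0 add scl order_trans[OF KF' subspaceD(1)[OF lin]])
  obtain y where y: "y \<in> F" "y \<noteq> nought" "\<And>z. z \<in> K ` F \<Longrightarrow> ip z y = 0"
    using orth_component[OF W KF' x x'] by blast
  have "ip (K y) (K y) = ip (K (K y)) y" using K_sym[of "K y" y] KF y by simp
  also have "\<dots> = 0" using y KF by blast
  finally have "K y = nought" using inner_definite KF[OF y(1)] by blast
  then show False using inj y by blast
qed

end

section \<open>Forms spanned by eigenvectors\<close>

text \<open>\<open>e\<close> is an eigenvector of the (not yet constructed) operator representing \<open>Q\<close>.\<close>

definition form_eigenspace ::
    "'v inner_space \<Rightarrow> 'v set \<Rightarrow> ('v \<Rightarrow> 'v \<Rightarrow> complex) \<Rightarrow> real \<Rightarrow> 'v set" where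
  "form_eigenspace H D Q l = {e \<in> D. \<forall>x\<in>D. Q e x = of_real l * vinner H e x}"

locale form_domain = hilbert_space +
  fixes D Q
  assumes herm: "hermitian_form H D Q"
begin

lemma D_dense: "dense_subspace H D" using herm by (simp add: hermitian_form_def)

lemma D_lin: "linear_subspace H D" using D_dense by (simp add: dense_subspace_def)

lemma D_V: "x \<in> D \<Longrightarrow> x \<in> V" using subspaceD(2)[OF D_lin] .

lemma Q_rules:
  assumes "x \<in> D" "y \<in> D"
  shows "z \<in> D \<Longrightarrow> Q x (y \<oplus> z) = Q x y + Q x z" "Q x (a \<odot> y) = a * Q x y"
    "z \<in> D \<Longrightarrow> Q (x \<oplus> y) z = Q x z + Q y z" "Q (a \<odot> x) y = cnj a * Q x y" "Q x y = cnj (Q y x)"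
  using herm assms unfolding hermitian_form_def by blast+

lemma Q_sub: "x \<in> D \<Longrightarrow> y \<in> D \<Longrightarrow> z \<in> D \<Longrightarrow> Q x (y \<ominus> z) = Q x y - Q x z"
  using Q_rules(1,2)[of x] subspaceD(5)[OF D_lin] by (simp add: vminus_def)

end

text \<open>The assumption concerns the algebraic span: each vector of \<open>D\<close> is a finite
  combination of eigenvectors, so on \<open>D\<close> only finite sums occur, and infinite ones
  enter with the completion.\<close>

locale diagonal_form = form_domain +
  assumes spanned: "D \<subseteq> lin_span (\<Union>l. form_eigenspace H D Q l)"
begin

declare D_V [simp, intro]

abbreviation eig where "eig \<equiv> form_eigenspace H D Q"

lemma eig_D: "e \<in> eig l \<Longrightarrow> e \<in> D" by (simp add: form_eigenspace_def)

lemma eig_V [simp, intro]: "e \<in> eig l \<Longrightarrow> e \<in> V" using eig_D by blast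

lemma eig_Q: "e \<in> eig l \<Longrightarrow> x \<in> D \<Longrightarrow> Q e x = of_real l * ip e x"
  by (simp add: form_eigenspace_def)

lemma eig_subspace: "linear_subspace H (eig l)"
proof -
  have "nought \<in> eig l"
    using Q_rules(4)[of nought _ 0] subspaceD(3)[OF D_lin] by (auto simp: form_eigenspace_def)
  moreover have "x \<oplus> y \<in> eig l" if "x \<in> eig l" "y \<in> eig l" for x y
    using that subspaceD(4)[OF D_lin] Q_rules(3)[of x y]
    by (auto simp: form_eigenspace_def algebra_simps)
  moreover have "a \<odot> x \<in> eig l" if "x \<in> eig l" for a x
    using that subspaceD(5)[OF D_lin] Q_rules(4)[of x]
    by (auto simp: form_eigenspace_def)
  ultimately show ?thesis using eig_D by (auto simp: linear_subspace_def)
qed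

lemma eig_orth:
  assumes e: "e \<in> eig l" and f: "f \<in> eig m" and ne: "l \<noteq> m" shows "ip e f = 0"
proof -
  have "of_real l * ip e f = Q e f" using eig_Q[OF e eig_D[OF f]] by simp
  also have "\<dots> = cnj (Q f e)" by (rule Q_rules(5)[OF eig_D[OF e] eig_D[OF f]])
  also have "\<dots> = of_real m * ip e f"
    using eig_Q[OF f eig_D[OF e]] inner_commute[of e f] e f by simp
  finally show ?thesis using ne by simp
qed

lemma closed_subspace_eq_V:
  assumes W: "closed_subspace H W" and sub: "\<And>l. eig l \<subseteq> W" shows "W = V"
proof -
  have "D \<subseteq> W" using spanned lin_span_minimal[OF closed_subspaceD(1)[OF W]] sub by blast
  then have "vtopology H closure_of D \<subseteq> W"
    using W by (intro closure_of_minimal) (auto simp: closed_subspace_def)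
  then show ?thesis using D_dense subspaceD(1)[OF closed_subspaceD(1)[OF W]]
    by (auto simp: dense_subspace_def)
qed

section \<open>The spectral projections\<close>

definition E :: "real set \<Rightarrow> 'a \<Rightarrow> 'a" where
  "E \<sigma> = orth_proj H (closed_span H (\<Union>l\<in>\<sigma>. eig l))"

text \<open>\<open>E\<close> is defined for all sets of reals, so point masses and finite cut-offs
  are instances. Since \<open>P l\<close> vanishes unless \<open>l\<close> is an eigenvalue,
  spectral sums can run over all reals.\<close>

abbreviation P where "P l \<equiv> E {l}"

lemma E_closed_subspace: "closed_subspace H (closed_span H (\<Union>l\<in>\<sigma>. eig l))"
  by (rule closed_subspace_closed_span) auto

lemmas E_closed [simp, intro] = orth_proj_closed[OF E_closed_subspace, folded E_def]
lemmas E_sym = orth_proj_sym[OF E_closed_subspace, folded E_def]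
lemmas E_nm = orth_proj_nm[OF E_closed_subspace, folded E_def]
lemmas E_add = orth_proj_add[OF E_closed_subspace, folded E_def]
lemmas E_sub = orth_proj_sub[OF E_closed_subspace, folded E_def]
lemmas E_scl = orth_proj_scl[OF E_closed_subspace, folded E_def]
lemmas E_projector = orthogonal_projector_orth_proj[OF E_closed_subspace, folded E_def]

lemma E_eig: "e \<in> eig l \<Longrightarrow> E \<sigma> e = (if l \<in> \<sigma> then e else nought)"
proof (cases "l \<in> \<sigma>")
  case True
  assume "e \<in> eig l"
  then have "e \<in> closed_span H (\<Union>l\<in>\<sigma>. eig l)" using True
    by (intro subsetD[OF closed_span_superset]) auto
  then show ?thesis using True orth_proj_id[OF E_closed_subspace] by (simp add: E_def)
next
  case False
  assume e: "e \<in> eig l"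
  have "closed_subspace H {z \<in> V. \<forall>w\<in>{e}. ip w z = 0}" by (rule closed_subspace_weak) (use e in auto)
  then have "closed_span H (\<Union>l\<in>\<sigma>. eig l) \<subseteq> {z \<in> V. \<forall>w\<in>{e}. ip w z = 0}"
    by (rule closed_span_minimal) (use eig_orth[OF e] False in auto)
  then have "ip z e = 0" if "z \<in> closed_span H (\<Union>l\<in>\<sigma>. eig l)" for z
    using that inner_commute[of z e] e by auto
  then show ?thesis using False orth_proj_0[OF E_closed_subspace eig_V[OF e]] by (simp add: E_def)
qed

lemma E_zero [simp]: "E \<sigma> nought = nought"
  using E_eig[OF subspaceD(3)[OF eig_subspace]] by simp

text \<open>Maps with adjoints \<open>f'\<close> and \<open>g'\<close> agree on a closed subspace.
  If it contains all eigenvectors, it contains the dense \<open>D\<close>, hence is everything. The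
  rules for \<open>E\<close> below thus reduce to a check on eigenvectors.\<close>

lemma operator_eqI:
  assumes f: "\<And>x z. x \<in> V \<Longrightarrow> z \<in> V \<Longrightarrow> ip z (f x) = ip (f' z) x"
    and g: "\<And>x z. x \<in> V \<Longrightarrow> z \<in> V \<Longrightarrow> ip z (g x) = ip (g' z) x"
    and cl: "\<And>x. x \<in> V \<Longrightarrow> f x \<in> V" "\<And>x. x \<in> V \<Longrightarrow> g x \<in> V"
      "\<And>x. x \<in> V \<Longrightarrow> f' x \<in> V" "\<And>x. x \<in> V \<Longrightarrow> g' x \<in> V"
    and eq: "\<And>l e. e \<in> eig l \<Longrightarrow> f e = g e" and x: "x \<in> V"
  shows "f x = g x"
proof -
  have "{x \<in> V. \<forall>z\<in>V. ip (f' z \<ominus> g' z) x = 0} = V"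
  proof (rule closed_subspace_eq_V[OF closed_subspace_weak])
    show "eig l \<subseteq> {x \<in> V. \<forall>z\<in>V. ip (f' z \<ominus> g' z) x = 0}" for l
    proof (intro subsetI CollectI conjI ballI)
      fix e z assume e: "e \<in> eig l" and z: "z \<in> V"
      show "ip (f' z \<ominus> g' z) e = 0"
        using e z cl f[of e z] g[of e z] eq[OF e] by simp
    qed auto
  qed (use cl in auto)
  then have "ip (f' z \<ominus> g' z) x = 0" if "z \<in> V" for z using that x by blast
  then have "ip z (f x) = ip z (g x)" if "z \<in> V" for z
    using that x f[of x z] g[of x z] cl by simp
  then show ?thesis by (intro ip_eqI cl x)
qed

lemma E_E: "x \<in> V \<Longrightarrow> E \<sigma> (E \<tau> x) = E (\<sigma> \<inter> \<tau>) x"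
  by (rule operator_eqI[where f = "\<lambda>z. E \<sigma> (E \<tau> z)" and g = "E (\<sigma> \<inter> \<tau>)" and f' = "\<lambda>z. E \<tau> (E \<sigma> z)" and g' = "E (\<sigma> \<inter> \<tau>)"])
    (auto simp: E_sym E_eig)

lemma E_UNIV: "x \<in> V \<Longrightarrow> E UNIV x = x"
  by (rule operator_eqI[where f = "E UNIV" and g = "\<lambda>x. x" and f' = "E UNIV" and g' = id]) (auto simp: E_sym E_eig)

lemma E_empty: "x \<in> V \<Longrightarrow> E {} x = nought"
  by (rule operator_eqI[where f = "E {}" and g = "\<lambda>_. nought" and f' = "E {}" and g' = "\<lambda>_. nought"]) (auto simp: E_sym E_eig)

lemma E_Un:
  "\<sigma> \<inter> \<tau> = {} \<Longrightarrow> x \<in> V \<Longrightarrow> E (\<sigma> \<union> \<tau>) x = E \<sigma> x \<oplus> E \<tau> x"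
  by (rule operator_eqI[where f = "E (\<sigma> \<union> \<tau>)" and g = "\<lambda>z. E \<sigma> z \<oplus> E \<tau> z" and f' = "E (\<sigma> \<union> \<tau>)" and g' = "\<lambda>z. E \<sigma> z \<oplus> E \<tau> z"]) (auto simp: E_sym E_eig)

lemma P_E: "x \<in> V \<Longrightarrow> P l (E \<sigma> x) = (if l \<in> \<sigma> then P l x else nought)"
  by (auto simp: E_E E_empty)

lemma ip_P_P: "x \<in> V \<Longrightarrow> y \<in> V \<Longrightarrow> ip (P l x) (P l y) = ip x (P l y)"
  by (simp add: E_sym P_E)

text \<open>All three properties hold for eigenvectors and pass to linear combinations. Hence
  spectral cut-offs do not leave \<open>D\<close>, and each vector of \<open>D\<close> has finite
  spectral support.\<close>

lemma D_reduction:
  assumes "x \<in> D"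
  shows "E \<sigma> x \<in> D" "P l x \<in> eig l" "\<exists>F. finite F \<and> E F x = x"
proof -
  let ?W = "{x \<in> D. (\<forall>\<sigma>. E \<sigma> x \<in> D) \<and> (\<forall>l. P l x \<in> eig l) \<and> (\<exists>F. finite F \<and> E F x = x)}"
  have lin: "linear_subspace H ?W"
    unfolding linear_subspace_def
  proof (intro conjI ballI allI)
    have "\<exists>F. finite F \<and> E F nought = nought" using E_empty by blast
    then show "nought \<in> ?W"
      using subspaceD(3)[OF D_lin] subspaceD(3)[OF eig_subspace]
      by simp
    fix x assume x: "x \<in> ?W"
    then obtain F where F: "finite F" "E F x = x" by blast
    show "a \<odot> x \<in> ?W" for a
      using x F subspaceD(5)[OF D_lin] subspaceD(5)[OF eig_subspace] by (auto simp: E_scl)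
    fix y assume y: "y \<in> ?W"
    then obtain F' where F': "finite F'" "E F' y = y" by blast
    have "E (F \<union> F') x = x" using E_E[of x "F \<union> F'" F] F x by auto
    moreover have "E (F \<union> F') y = y" using E_E[of y "F \<union> F'" F'] F' y by (auto simp: Int_commute)
    ultimately have "E (F \<union> F') (x \<oplus> y) = x \<oplus> y" using x y by (auto simp: E_add)
    then have "\<exists>F. finite F \<and> E F (x \<oplus> y) = x \<oplus> y" using F F' by blast
    then show "x \<oplus> y \<in> ?W"
      using x y subspaceD(4)[OF D_lin] subspaceD(4)[OF eig_subspace] by (auto simp: E_add)
  qed auto
  have sub: "eig l \<subseteq> ?W" for l
  proof
    fix e assume e: "e \<in> eig l"
    have "E {l} e = e" using E_eig[OF e] by simp
    then have "\<exists>F. finite F \<and> E F e = e" by blast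
    then show "e \<in> ?W"
      using e eig_D[OF e] subspaceD(3)[OF D_lin] subspaceD(3)[OF eig_subspace]
      by (auto simp: E_eig[OF e])
  qed
  have "lin_span (\<Union>l. eig l) \<subseteq> ?W" by (rule lin_span_minimal[OF lin UN_least[OF sub]])
  then show "E \<sigma> x \<in> D" "P l x \<in> eig l" "\<exists>F. finite F \<and> E F x = x"
    using subsetD[OF spanned assms] by blast+
qed

section \<open>Parseval's identity and synthesis from components\<close>

lemma ip_E_finite:
  "finite F \<Longrightarrow> x \<in> V \<Longrightarrow> y \<in> V \<Longrightarrow> ip y (E F x) = (\<Sum>l\<in>F. ip y (P l x))"
proof (induction F rule: finite_induct)
  case (insert l F)
  then show ?case using E_Un[of "{l}" F x] by simp
qed (simp add: E_empty)

lemma D_approx: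
  assumes "x \<in> V" "e > 0" obtains y where "y \<in> D" "nm (x \<ominus> y) < e"
  using D_dense assms closure_of_iff[OF subspaceD(1)[OF D_lin], of x]
  by (auto simp: dense_subspace_def)

text \<open>It must be seen that \<open>E F y\<close> tends to \<open>y\<close> as the finite set
  \<open>F\<close> grows. Approximate \<open>y\<close> by \<open>y'\<close> in \<open>D\<close>:
  once \<open>F\<close> contains the support \<open>F0\<close>, the cut-off fixes \<open>y'\<close>,
  and it is a contraction on the difference.\<close>

lemma Parseval:
  assumes x: "x \<in> V" and y: "y \<in> V"
  shows "((\<lambda>l. ip (P l x) (P l y)) has_sum ip x y) UNIV"
  unfolding has_sum_def tendsto_iff eventually_finite_subsets_at_top
proof (intro allI impI)
  fix e :: real assume e: "e > 0"
  \<comment> \<open>The cut-off and the approximation each cost \<open>d\<close>, so the error is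
    below \<open>2 * d * (nm x + 1) = e\<close>; the added 1 covers \<open>x = 0\<close>.\<close>
  define d where "d = e / (2 * (nm x + 1))"
  have nx: "nm x \<ge> 0" using x by simp
  have d: "d > 0" using e nx by (simp add: d_def)
  obtain y' where y': "y' \<in> D" "nm (y \<ominus> y') < d" by (rule D_approx[OF y d])
  obtain F0 where F0: "finite F0" "E F0 y' = y'" using D_reduction(3)[OF y'(1)] by blast
  have "dist (\<Sum>l\<in>F. ip (P l x) (P l y)) (ip x y) < e" if F: "finite F" "F0 \<subseteq> F" for F
  proof -
    have "E F y' = y'" using E_E[of y' F F0] F0 y' F by (auto simp: Int_absorb1)
    then have "E F y \<ominus> y = E F (y \<ominus> y') \<ominus> (y \<ominus> y')"
      using y y' by (simp add: E_sub) (rule ip_eqI, auto)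
    also have "nm \<dots> \<le> nm (E F (y \<ominus> y')) + nm (y \<ominus> y')"
      using nm_triangle[of "E F (y \<ominus> y')" "(-1) \<odot> (y \<ominus> y')"] y y' by (simp add: vminus_def[of H "E F _"])
    also have "\<dots> < 2 * d" using E_nm[of "y \<ominus> y'" F] y y' by simp
    finally have *: "nm (E F y \<ominus> y) < 2 * d" .
    have "(\<Sum>l\<in>F. ip (P l x) (P l y)) = (\<Sum>l\<in>F. ip x (P l y))"
      using x y by (simp add: ip_P_P)
    also have "\<dots> = ip x (E F y)" by (rule ip_E_finite[OF F(1) y x, symmetric])
    finally have "dist (\<Sum>l\<in>F. ip (P l x) (P l y)) (ip x y) = cmod (ip x (E F y \<ominus> y))"
      using x y by (simp add: dist_norm)
    also have "\<dots> \<le> nm x * nm (E F y \<ominus> y)" by (rule Cauchy_Schwarz) (use x y in auto)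
    also have "\<dots> \<le> nm x * (2 * d)" using * nx by (intro mult_left_mono) auto
    also have "\<dots> < (nm x + 1) * (2 * d)" using d by simp
    also have "\<dots> = e" using nx by (simp add: d_def field_simps)
    finally show ?thesis .
  qed
  then show "\<exists>X. finite X \<and> X \<subseteq> UNIV \<and>
      (\<forall>Y. finite Y \<and> X \<subseteq> Y \<and> Y \<subseteq> UNIV \<longrightarrow> dist (\<Sum>l\<in>Y. ip (P l x) (P l y)) (ip x y) < e)"
    using F0(1) by auto
qed

lemma Parseval_E:
  assumes x: "x \<in> V" and y: "y \<in> V"
  shows "((\<lambda>l. ip (P l x) (P l y)) has_sum ip x (E \<sigma> y)) \<sigma>"
proof -
  have "((\<lambda>l. ip (P l x) (P l (E \<sigma> y))) has_sum ip x (E \<sigma> y)) UNIV" by (rule Parseval) (use x y in auto)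
  then show ?thesis by (rule has_sum_cong_neutral[THEN iffD1, rotated -1]) (use x y in \<open>auto simp: P_E\<close>)
qed

lemma Parseval_nm:
  assumes x: "x \<in> V" shows "((\<lambda>l. (nm (P l x))\<^sup>2) has_sum (nm (E \<sigma> x))\<^sup>2) \<sigma>"
proof -
  have "((\<lambda>l. Re (ip (P l x) (P l x))) has_sum Re (ip x (E \<sigma> x))) \<sigma>"
    by (rule has_sum_Re[OF Parseval_E]) (use x in auto)
  moreover have "ip x (E \<sigma> x) = ip (E \<sigma> x) (E \<sigma> x)" using x by (simp add: E_sym E_E)
  ultimately show ?thesis using x by (simp add: nm_sq)
qed

lemma P_eqI:
  assumes x: "x \<in> V" and y: "y \<in> V" and eq: "\<And>l. P l x = P l y" shows "x = y"
  by (rule ip_eqI[OF x y]) (use Parseval[OF _ x] Parseval[OF _ y] eq has_sum_unique in fastforce)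

text \<open>Pairwise orthogonal components with summable squared norms have Cauchy partial sums.
  This supplies the value of the operator, whose components are prescribed.\<close>

lemma synthesis:
  assumes w: "\<And>l. w l \<in> V" "\<And>l. P l (w l) = w l" and sm: "(\<lambda>l. (nm (w l))\<^sup>2) summable_on UNIV"
  obtains y where "y \<in> V" "\<And>l. P l y = w l"
proof -
  define s where "s = (\<Sum>\<^sub>\<infinity>l. (nm (w l))\<^sup>2)"
  have le_s: "(\<Sum>l\<in>F. (nm (w l))\<^sup>2) \<le> s" if "finite F" for F
    unfolding s_def by (rule finite_sum_le_infsum[OF sm that]) auto
  have hs: "((\<lambda>l. (nm (w l))\<^sup>2) has_sum s) UNIV" using sm by (simp add: s_def)
  \<comment> \<open>The index set is uncountable; finite sets that nearly exhaust the total reduce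
    the construction to a sequence. The increasing unions \<open>G n\<close> make the partial sums
    comparable.\<close>
  have "\<exists>F. finite F \<and> s - 1 / real (Suc n) < (\<Sum>l\<in>F. (nm (w l))\<^sup>2)" for n
  proof -
    have "1 / real (Suc n) > 0" by simp
    from hs[unfolded has_sum_def tendsto_iff eventually_finite_subsets_at_top, rule_format, OF this]
    obtain F where "finite F" "dist (\<Sum>l\<in>F. (nm (w l))\<^sup>2) s < 1 / real (Suc n)" by blast
    then show ?thesis by (intro exI[of _ F]) (auto simp: dist_real_def)
  qed
  then obtain F where F: "\<And>n. finite (F n)" "\<And>n. s - 1 / real (Suc n) < (\<Sum>l\<in>F n. (nm (w l))\<^sup>2)" by metis
  define G where "G n = (\<Union>i\<le>n. F i)" for n
  have finG: "finite (G n)" for n using F(1) by (simp add: G_def)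
  have G: "G m \<subseteq> G n" if "m \<le> n" for m n unfolding G_def by (intro UN_mono) (use that in auto)
  have tail: "(\<Sum>l\<in>A. (nm (w l))\<^sup>2) \<le> 1 / real (Suc n)" if A: "finite A" "A \<inter> G n = {}" for A n
  proof -
    have "(\<Sum>l\<in>F n. (nm (w l))\<^sup>2) \<le> (\<Sum>l\<in>G n. (nm (w l))\<^sup>2)"
      by (rule sum_mono2[OF finG]) (auto simp: G_def)
    moreover have "(\<Sum>l\<in>A \<union> G n. (nm (w l))\<^sup>2) = (\<Sum>l\<in>A. (nm (w l))\<^sup>2) + (\<Sum>l\<in>G n. (nm (w l))\<^sup>2)"
      by (rule sum.union_disjoint) (use A finG in auto)
    ultimately show ?thesis using le_s[of "A \<union> G n"] F(2)[of n] A finG[of n] by simp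
  qed
  have w_orth: "ip (w l) (w m) = 0" if "l \<noteq> m" for l m
  proof -
    have "ip (w l) (w m) = ip (P l (w l)) (P m (w m))" by (simp add: w)
    also have "\<dots> = ip (w l) (P l (P m (w m)))" by (rule E_sym) (auto simp: w)
    also have "P l (P m (w m)) = nought" using P_E[OF w(1)[of m], of l "{m}"] that by simp
    finally show ?thesis by (simp add: w)
  qed
  have nm_sum: "(nm (vsum w A))\<^sup>2 = (\<Sum>l\<in>A. (nm (w l))\<^sup>2)" if A: "finite A" for A
  proof -
    have "ip (vsum w A) (vsum w A) = (\<Sum>l\<in>A. \<Sum>m\<in>A. ip (w l) (w m))"
      using A w by (simp add: ip_vsum_left ip_vsum_right) (rule sum.swap)
    also have "\<dots> = (\<Sum>l\<in>A. \<Sum>m\<in>A. if m = l then ip (w l) (w l) else 0)"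
      by (intro sum.cong refl) (use w_orth in auto)
    also have "\<dots> = (\<Sum>l\<in>A. ip (w l) (w l))" using A by simp
    finally show ?thesis using A w by (simp add: nm_sq)
  qed
  define t where "t n = vsum w (G n)" for n
  have tV: "t n \<in> V" for n unfolding t_def using finG w by auto
  have close: "(nm (t n \<ominus> t m))\<^sup>2 \<le> 1 / real (Suc m)" if "m \<le> n" for m n
  proof -
    have "t n \<ominus> t m = vsum w (G n - G m)"
      by (rule ip_eqI)
        (use finG w tV G[OF that] in \<open>auto simp: t_def ip_vsum_right sum_diff\<close>)
    then show ?thesis using nm_sum[of "G n - G m"] tail[of "G n - G m" m] finG by auto
  qed
  obtain y where y: "y \<in> V" "conv t y"
  proof (rule Cauchy_conv[of t])
    fix e :: real assume e: "e > 0"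
    obtain N where N: "1 / e\<^sup>2 < real N" using reals_Archimedean2 by blast
    have le: "nm (t n \<ominus> t m) < e" if mn: "N \<le> m" "m \<le> n" for m n
    proof -
      have "1 / e\<^sup>2 < real (Suc m)" using N mn by auto
      then have "1 / real (Suc m) < e\<^sup>2" using e by (simp add: field_simps del: of_nat_Suc)
      then have "(nm (t n \<ominus> t m))\<^sup>2 < e\<^sup>2" using close[OF mn(2)] by simp
      then show ?thesis using e by (simp add: power_less_imp_less_base)
    qed
    have "nm (t m \<ominus> t n) < e" if mn: "N \<le> m" "N \<le> n" for m n
      using le[of m n] le[of n m] mn nm_sub_commute[OF tV tV, of m n] by (cases "m \<le> n") auto
    then show "\<exists>N. \<forall>m\<ge>N. \<forall>n\<ge>N. nm (t m \<ominus> t n) < e" by blast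
  qed (use tV in auto)
  have Pt: "P l (t n) = (if l \<in> G n then w l else nought)" for l n
  proof (rule ip_eqI)
    fix z assume z: "z \<in> V"
    have Pw: "P l (w m) = (if m = l then w l else nought)" for m
      using P_E[OF w(1)[of m], of l "{m}"] w(2) by (cases "m = l") auto
    have "ip z (P l (t n)) = ip (P l z) (t n)" using E_sym[OF z tV] by simp
    also have "\<dots> = (\<Sum>m\<in>G n. ip (P l z) (w m))" unfolding t_def using finG w z by (simp add: ip_vsum_right)
    also have "\<dots> = (\<Sum>m\<in>G n. ip z (P l (w m)))" using E_sym[OF z w(1)] by simp
    also have "\<dots> = (\<Sum>m\<in>G n. if m = l then ip z (w l) else 0)"
      by (intro sum.cong refl) (use Pw z in auto)
    also have "\<dots> = (if l \<in> G n then ip z (w l) else 0)" using finG by simp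
    finally show "ip z (P l (t n)) = ip z (if l \<in> G n then w l else nought)" using z by auto
  qed (use tV w in auto)
  have "P l y = w l" for l
  proof (rule ip_eqI)
    fix z assume z: "z \<in> V"
    have "(\<lambda>n. ip (P l z) (t n)) \<longlonglongrightarrow> ip (P l z) y" by (rule conv_ip(1)) (use tV y z in auto)
    then have lim: "(\<lambda>n. ip z (P l (t n))) \<longlonglongrightarrow> ip z (P l y)" using E_sym z tV y by simp
    show "ip z (P l y) = ip z (w l)"
    proof (cases "\<exists>N. l \<in> G N")
      case True
      then obtain N where "l \<in> G N" by blast
      then have "\<forall>\<^sub>F n in sequentially. ip z (P l (t n)) = ip z (w l)"
        using G unfolding eventually_sequentially Pt by (intro exI[of _ N]) auto
      then have "(\<lambda>n. ip z (P l (t n))) \<longlonglongrightarrow> ip z (w l)" by (rule tendsto_eventually)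
      then show ?thesis by (rule LIMSEQ_unique[OF lim])
    next
      \<comment> \<open>Such an \<open>l\<close> is outside every \<open>G n\<close>, so
        \<open>w l\<close> belongs to every tail and vanishes.\<close>
      case False
      have "(nm (w l))\<^sup>2 \<le> 1 / real (Suc n)" for n using tail[of "{l}" n] False by simp
      moreover have "(\<lambda>n. 1 / real (Suc n)) \<longlonglongrightarrow> 0" by (intro LIMSEQ_Suc lim_1_over_n)
      ultimately have "(nm (w l))\<^sup>2 \<le> 0" by (intro LIMSEQ_le_const) auto
      then have "w l = nought" using w(1) by simp
      then show ?thesis using lim False z by (simp add: Pt LIMSEQ_const_iff)
    qed
  qed (use y w in auto)
  then show ?thesis using that y by blast
qed

end

section \<open>Integrals against spectral measures as sums\<close>

lemma nn_integral_count_space_has_sum: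
  fixes f :: "'i \<Rightarrow> real"
  assumes f: "(f has_sum s) A" and nn: "\<And>x. x \<in> A \<Longrightarrow> 0 \<le> f x"
  shows "(\<integral>\<^sup>+x. ennreal (f x) \<partial>count_space A) = ennreal s"
proof -
  have "f summable_on A" using f by (auto simp: summable_on_def)
  then have "Infinite_Set_Sum.abs_summable_on f A"
    using summable_on_iff_abs_summable_on_real[of f A] abs_summable_equivalent[of f A] by blast
  then show ?thesis
    using nn_integral_conv_infsetsum[of f A] nn infsetsum_infsum[of f A] infsumI[OF f] by simp
qed

lemma summable_on_comparison:
  fixes f g :: "'i \<Rightarrow> real"
  assumes "g summable_on A" "\<And>x. x \<in> A \<Longrightarrow> 0 \<le> f x" "\<And>x. x \<in> A \<Longrightarrow> f x \<le> g x"
  shows "f summable_on A"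
proof (rule nonneg_bdd_above_summable_on)
  show "bdd_above (sum f ` {F. F \<subseteq> A \<and> finite F})"
  proof (rule bdd_aboveI2)
    fix F assume "F \<in> {F. F \<subseteq> A \<and> finite F}"
    then have F: "F \<subseteq> A" "finite F" by auto
    have "sum f F \<le> sum g F" by (intro sum_mono) (use F assms in auto)
    also have "\<dots> \<le> infsum g A"
      by (rule finite_sum_le_infsum) (use F assms in \<open>auto intro: order_trans\<close>)
    finally show "sum f F \<le> infsum g A" .
  qed
qed (use assms in auto)

context diagonal_form
begin

abbreviation \<nu> where "\<nu> x \<equiv> spectral_measure H E x"

text \<open>The spectral measure is discrete, with mass \<open>|P l x|^2\<close> at
  \<open>l\<close>. The image under the identity map only restricts the weighted counting measure
  from all sets to Borel sets.\<close>

lemma spectral_measure_eq: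
  assumes x: "x \<in> V"
  shows "\<nu> x = distr (density (count_space UNIV) (\<lambda>l. ennreal ((nm (P l x))\<^sup>2))) borel (\<lambda>l. l)"
    (is "_ = ?N")
proof -
  have em: "emeasure ?N \<sigma> = ennreal ((nm (E \<sigma> x))\<^sup>2)" if \<sigma>: "\<sigma> \<in> sets borel" for \<sigma>
  proof -
    have "emeasure ?N \<sigma> = emeasure (density (count_space UNIV) (\<lambda>l. ennreal ((nm (P l x))\<^sup>2))) \<sigma>"
      using \<sigma> by (subst emeasure_distr) auto
    also have "\<dots> = (\<integral>\<^sup>+l\<in>\<sigma>. ennreal ((nm (P l x))\<^sup>2) \<partial>count_space UNIV)"
      by (rule emeasure_density) auto
    also have "\<dots> = (\<integral>\<^sup>+l. ennreal ((nm (P l x))\<^sup>2) \<partial>count_space \<sigma>)"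
      by (simp add: nn_integral_count_space_indicator)
    also have "\<dots> = ennreal ((nm (E \<sigma> x))\<^sup>2)"
      by (rule nn_integral_count_space_has_sum[OF Parseval_nm[OF x]]) simp
    finally show ?thesis .
  qed
  have "?N = measure_of (space ?N) (sets ?N) (emeasure ?N)" by (rule measure_of_of_measure[symmetric])
  also have "\<dots> = measure_of UNIV (sets borel) (emeasure ?N)" by simp
  also have "\<dots> = \<nu> x" unfolding spectral_measure_def
    by (rule measure_of_eq) (use em sets.sigma_sets_eq[of "borel :: real measure"] in auto)
  finally show ?thesis ..
qed

lemma spectral_integral:
  assumes x: "x \<in> V" and f: "f \<in> borel_measurable borel"
  shows "integrable (\<nu> x) f \<longleftrightarrow> (\<lambda>l. f l * (nm (P l x))\<^sup>2) summable_on UNIV"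
    and "integral\<^sup>L (\<nu> x) f = (\<Sum>\<^sub>\<infinity>l. f l * (nm (P l x))\<^sup>2)"
proof -
  let ?g = "\<lambda>l. f l * (nm (P l x))\<^sup>2"
  let ?M = "density (count_space UNIV) (\<lambda>l. ennreal ((nm (P l x))\<^sup>2))"
  have "integrable (\<nu> x) f \<longleftrightarrow> integrable ?M f"
    unfolding spectral_measure_eq[OF x] by (rule integrable_distr_eq) (use f in auto)
  also have "\<dots> \<longleftrightarrow> integrable (count_space UNIV) (\<lambda>l. (nm (P l x))\<^sup>2 *\<^sub>R f l)"
    by (rule integrable_density) auto
  also have "\<dots> \<longleftrightarrow> Infinite_Set_Sum.abs_summable_on ?g UNIV"
    by (simp add: abs_summable_on_def set_integrable_def mult.commute)
  also have "\<dots> \<longleftrightarrow> ?g summable_on UNIV"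
    using summable_on_iff_abs_summable_on_real[of ?g UNIV] abs_summable_equivalent[of ?g UNIV] by blast
  finally show *: "integrable (\<nu> x) f \<longleftrightarrow> ?g summable_on UNIV" .
  show "integral\<^sup>L (\<nu> x) f = (\<Sum>\<^sub>\<infinity>l. ?g l)"
  proof (cases "?g summable_on UNIV")
    case True
    have "integral\<^sup>L (\<nu> x) f = integral\<^sup>L ?M f"
      unfolding spectral_measure_eq[OF x] by (rule integral_distr) (use f in auto)
    also have "\<dots> = integral\<^sup>L (count_space UNIV) (\<lambda>l. (nm (P l x))\<^sup>2 *\<^sub>R f l)"
      by (rule integral_density) auto
    also have "\<dots> = infsetsum ?g UNIV"
      by (simp add: infsetsum_def mult.commute)
    also have "\<dots> = infsum ?g UNIV"
      using summable_on_iff_abs_summable_on_real[of ?g UNIV] abs_summable_equivalent[of ?g UNIV] True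
      by (intro infsetsum_infsum) blast
    finally show ?thesis .
  next
    \<comment> \<open>Without summability both the integral and the sum are 0 by convention.\<close>
    case False
    then show ?thesis using * by (simp add: not_integrable_integral_eq infsum_not_exists)
  qed
qed

lemma projection_valued_measure_E: "projection_valued_measure H E"
  unfolding projection_valued_measure_def
proof (intro conjI ballI allI impI)
  fix A :: "nat \<Rightarrow> real set" and x y
  assume dis: "disjoint_family A" and x: "x \<in> V" and y: "y \<in> V"
  let ?f = "\<lambda>l. ip (P l y) (P l x)"
  \<comment> \<open>For disjoint \<open>A n\<close>, a sum over the union is a sum over pairs
    \<open>(n, l)\<close> with \<open>l\<close> in \<open>A n\<close>; summing over \<open>l\<close>
    first gives countable additivity.\<close>
  have "inj_on snd (Sigma UNIV A)"
    using dis by (auto simp: inj_on_def disjoint_family_on_def)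
  moreover have "snd ` Sigma UNIV A = (\<Union>n. A n)" by force
  ultimately have "((?f \<circ> snd) has_sum ip y (E (\<Union>n. A n) x)) (Sigma UNIV A)"
    using has_sum_reindex[of snd "Sigma UNIV A" ?f] Parseval_E[OF y x, of "\<Union>n. A n"] by simp
  then have "((\<lambda>n. ip y (E (A n) x)) has_sum ip y (E (\<Union>n. A n) x)) UNIV"
    by (rule has_sum_Sigma[OF isUCont_plus]) (use Parseval_E[OF y x] in simp)
  then show "(\<lambda>n. ip y (E (A n) x)) sums ip y (E (\<Union>n. A n) x)" by (rule has_sum_imp_sums)
qed (use E_projector E_UNIV E_E in auto)

section \<open>The representing self-adjoint operator\<close>

lemma P_summable: "x \<in> V \<Longrightarrow> (\<lambda>l. (nm (P l x))\<^sup>2) summable_on UNIV"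
  using Parseval_nm[of x UNIV] unfolding summable_on_def by blast

text \<open>Multiplication by \<open>l\<close> on the components. Asking for the image vector
  itself, rather than for square summability of its would-be components, makes self-adjointness a
  comparison of components; \<open>DA_eq\<close> proves the two conditions equivalent by
  synthesis.\<close>

definition DA where "DA = {x \<in> V. \<exists>y\<in>V. \<forall>l. P l y = of_real l \<odot> P l x}"

definition A where "A x = (SOME y. y \<in> V \<and> (\<forall>l. P l y = of_real l \<odot> P l x))"

lemma DA_V: "x \<in> DA \<Longrightarrow> x \<in> V" by (simp add: DA_def)

lemma A_spec:
  assumes "x \<in> DA" shows "A x \<in> V" "P l (A x) = of_real l \<odot> P l x"
proof -
  have "A x \<in> V \<and> (\<forall>l. P l (A x) = of_real l \<odot> P l x)"
    unfolding A_def by (rule someI_ex) (use assms in \<open>auto simp: DA_def\<close>)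
  then show "A x \<in> V" "P l (A x) = of_real l \<odot> P l x" by auto
qed

lemma DA_I: "x \<in> V \<Longrightarrow> y \<in> V \<Longrightarrow> (\<And>l. P l y = of_real l \<odot> P l x) \<Longrightarrow> x \<in> DA \<and> A x = y"
proof -
  assume *: "x \<in> V" "y \<in> V" "\<And>l. P l y = of_real l \<odot> P l x"
  then have "x \<in> DA" by (auto simp: DA_def)
  then show ?thesis using A_spec[of x] * by (auto intro: P_eqI)
qed


lemma DA_eq: "DA = calculus_domain H E (\<lambda>l. l)"
proof (intro equalityI subsetI)
  fix x assume x: "x \<in> DA"
  have "(\<lambda>l. (nm (P l (A x)))\<^sup>2) summable_on UNIV"
    by (rule P_summable[OF A_spec(1)[OF x]])
  then have "(\<lambda>l. l\<^sup>2 * (nm (P l x))\<^sup>2) summable_on UNIV"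
    using A_spec[OF x] DA_V[OF x] by (simp add: power_mult_distrib)
  then show "x \<in> calculus_domain H E (\<lambda>l. l)"
    using DA_V[OF x] spectral_integral(1)[of x "\<lambda>l. l\<^sup>2"] by (simp add: calculus_domain_def)
next
  fix x assume "x \<in> calculus_domain H E (\<lambda>l. l)"
  then have x: "x \<in> V" "(\<lambda>l. l\<^sup>2 * (nm (P l x))\<^sup>2) summable_on UNIV"
    using spectral_integral(1)[of x "\<lambda>l. l\<^sup>2"] by (auto simp: calculus_domain_def)
  have "(\<lambda>l. (nm (of_real l \<odot> P l x))\<^sup>2) summable_on UNIV"
    using x by (simp add: power_mult_distrib)
  then obtain y where "y \<in> V" "\<And>l. P l y = of_real l \<odot> P l x"
    using synthesis[of "\<lambda>l. of_real l \<odot> P l x"] x by (auto simp: E_scl P_E)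
  then show "x \<in> DA" using x by (auto simp: DA_def)
qed

declare DA_V [simp, intro]

lemma A_lin:
  shows "x \<in> DA \<Longrightarrow> y \<in> DA \<Longrightarrow> x \<oplus> y \<in> DA \<and> A (x \<oplus> y) = A x \<oplus> A y"
    and "x \<in> DA \<Longrightarrow> a \<odot> x \<in> DA \<and> A (a \<odot> x) = a \<odot> A x"
proof -
  show "x \<oplus> y \<in> DA \<and> A (x \<oplus> y) = A x \<oplus> A y" if "x \<in> DA" "y \<in> DA"
    by (rule DA_I) (use that A_spec in \<open>auto simp: E_add scale_plus_right\<close>)
  show "a \<odot> x \<in> DA \<and> A (a \<odot> x) = a \<odot> A x" if "x \<in> DA"
    by (rule DA_I) (use that A_spec in \<open>auto simp: E_scl scale_scale mult.commute\<close>)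
qed

lemma eig_DA: "e \<in> V \<Longrightarrow> P l e \<in> DA \<and> A (P l e) = of_real l \<odot> P l e"
  by (rule DA_I) (auto simp: E_scl P_E)

lemma D_DA: "D \<subseteq> DA"
proof -
  have lin: "linear_subspace H DA"
    unfolding linear_subspace_def using A_lin DA_I[of nought nought] by auto
  have "eig l \<subseteq> DA" for l using eig_DA[of _ l] E_eig[of _ l "{l}"] by (metis eig_V singletonI subsetI)
  then show ?thesis using spanned lin_span_minimal[OF lin] by blast
qed

lemma superspace_dense:
  assumes "linear_subspace H S" "D \<subseteq> S" shows "dense_subspace H S"
  using D_dense closure_of_mono[OF assms(2), of "vtopology H"] closure_of_subset_topspace[of "vtopology H" S] assms(1)
  by (auto simp: dense_subspace_def)

lemma A_sym:
  assumes x: "x \<in> DA" and z: "z \<in> DA" shows "ip (A z) x = ip z (A x)"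
proof -
  have "((\<lambda>l. ip (P l (A z)) (P l x)) has_sum ip (A z) x) UNIV" by (rule Parseval) (use A_spec x z in auto)
  moreover have "((\<lambda>l. ip (P l z) (P l (A x))) has_sum ip z (A x)) UNIV" by (rule Parseval) (use A_spec x z in auto)
  moreover have "ip (P l (A z)) (P l x) = ip (P l z) (P l (A x))" for l using A_spec x z by simp
  ultimately show ?thesis using has_sum_unique by auto
qed

lemma self_adjoint_A: "self_adjoint H DA A"
  unfolding self_adjoint_def
proof (intro conjI ballI)
  have lin: "linear_subspace H DA"
    unfolding linear_subspace_def using A_lin DA_I[of nought nought] by auto
  show "dense_subspace H DA" by (rule superspace_dense[OF lin D_DA])
  show "linear_map_on H DA H A" using A_lin A_spec by (auto simp: linear_map_on_def)
  show "ip (A z) x = ip z (A x)" if "x \<in> DA" "z \<in> DA" for x z by (rule A_sym[OF that])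
  show "adjoint_domain H DA A = DA"
  proof (intro equalityI subsetI)
    fix x assume "x \<in> adjoint_domain H DA A"
    then obtain y where x: "x \<in> V" and y: "y \<in> V" "\<And>z. z \<in> DA \<Longrightarrow> ip (A z) x = ip z y"
      by (auto simp: adjoint_domain_def)
    \<comment> \<open>Test the adjoint relation on the vectors \<open>P l u\<close>, which lie in
      \<open>DA\<close> and are multiplied by \<open>l\<close>.\<close>
    have "P l y = of_real l \<odot> P l x" for l
    proof (rule ip_eqI)
      fix u assume u: "u \<in> V"
      have "ip u (P l y) = ip (P l u) y" using u y by (simp add: E_sym)
      also have "\<dots> = ip (A (P l u)) x" using y(2)[of "P l u"] eig_DA[OF u, of l] by simp
      also have "\<dots> = of_real l * ip (P l u) x" using eig_DA[OF u, of l] u x by simp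
      finally show "ip u (P l y) = ip u (of_real l \<odot> P l x)" using u x by (simp add: E_sym)
    qed (use x y in auto)
    then show "x \<in> DA" using DA_I x y by blast
  next
    fix x assume x: "x \<in> DA"
    then have "\<exists>y\<in>V. \<forall>z\<in>DA. ip (A z) x = ip z y" using A_sym A_spec(1) by blast
    then show "x \<in> adjoint_domain H DA A" using x by (auto simp: adjoint_domain_def)
  qed
qed

lemma has_sum_A:
  assumes x: "x \<in> DA" shows "ip x (A x) = of_real (integral\<^sup>L (\<nu> x) (\<lambda>l. l))"
proof -
  have "((\<lambda>l. ip (P l x) (P l (A x))) has_sum ip x (A x)) UNIV" by (rule Parseval) (use A_spec x in auto)
  moreover have "ip (P l x) (P l (A x)) = of_real (l * (nm (P l x))\<^sup>2)" for l
    using A_spec[OF x] x by (simp add: ip_self)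
  ultimately have *: "((\<lambda>l. of_real (l * (nm (P l x))\<^sup>2)) has_sum ip x (A x)) UNIV" by simp
  from has_sum_Re[OF this] have "((\<lambda>l. l * (nm (P l x))\<^sup>2) has_sum Re (ip x (A x))) UNIV" by simp
  from infsumI[OF this] have "Re (ip x (A x)) = integral\<^sup>L (\<nu> x) (\<lambda>l. l)"
    using spectral_integral(2)[of x "\<lambda>l. l"] x by simp
  moreover have "Im (ip x (A x)) = 0"
    using A_sym[OF x x] inner_commute[OF A_spec(1)[OF x] DA_V[OF x]] by (simp add: complex_eq_iff)
  ultimately show ?thesis by (simp add: complex_eq_iff)
qed

lemma resolution: "resolution_of_identity H DA A E"
  unfolding resolution_of_identity_def
  using projection_valued_measure_E DA_eq has_sum_A by auto

section \<open>The quadratic form of the operator on its form domain\<close>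

definition DQ where "DQ = {x \<in> V. (\<lambda>l. \<bar>l\<bar> * (nm (P l x))\<^sup>2) summable_on UNIV}"

definition QQ where "QQ x y = (\<Sum>\<^sub>\<infinity>l. of_real l * ip (P l x) (P l y))"


lemma DQ_eq: "DQ = calculus_domain H E (\<lambda>l. sqrt \<bar>l\<bar>)"
proof -
  have "integrable (\<nu> x) (\<lambda>l. \<bar>l\<bar>) \<longleftrightarrow> (\<lambda>l. \<bar>l\<bar> * (nm (P l x))\<^sup>2) summable_on UNIV" if "x \<in> V" for x
    by (rule spectral_integral(1)[OF that]) simp
  then show ?thesis by (simp add: DQ_def calculus_domain_def cong: conj_cong)
qed

lemma DQ_I: "x \<in> V \<Longrightarrow> (\<lambda>l. \<bar>l\<bar> * (nm (P l x))\<^sup>2) summable_on UNIV \<Longrightarrow> x \<in> DQ"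
  by (simp add: DQ_def)

lemma DQ_D:
  assumes "x \<in> DQ"
  shows DQ_V [simp, intro]: "x \<in> V" and "(\<lambda>l. \<bar>l\<bar> * (nm (P l x))\<^sup>2) summable_on UNIV"
  using assms by (auto simp: DQ_def)

lemma DA_DQ: "DA \<subseteq> DQ"
proof
  fix x assume x: "x \<in> DA"
  have "(\<lambda>l. (nm (P l (A x)))\<^sup>2 + (nm (P l x))\<^sup>2) summable_on UNIV"
    by (intro summable_on_add P_summable A_spec(1)[OF x] DA_V[OF x])
  then have "(\<lambda>l. \<bar>l\<bar> * (nm (P l x))\<^sup>2) summable_on UNIV"
  proof (rule summable_on_comparison)
    fix l :: real
    have "\<bar>l\<bar> \<le> l\<^sup>2 + 1"
    proof -
      have "0 \<le> (\<bar>l\<bar> - 1)\<^sup>2 + \<bar>l\<bar>" by simp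
      then show ?thesis by (simp add: power2_diff)
    qed
    then have "\<bar>l\<bar> * (nm (P l x))\<^sup>2 \<le> (l\<^sup>2 + 1) * (nm (P l x))\<^sup>2" by (rule mult_right_mono) simp
    then show "\<bar>l\<bar> * (nm (P l x))\<^sup>2 \<le> (nm (P l (A x)))\<^sup>2 + (nm (P l x))\<^sup>2"
      using A_spec[OF x] x by (simp add: power_mult_distrib algebra_simps)
  qed simp
  then show "x \<in> DQ" using x by (intro DQ_I) auto
qed

lemma DQ_lin: "linear_subspace H DQ"
  unfolding linear_subspace_def
proof (intro conjI ballI allI)
  show "nought \<in> DQ" by (rule DQ_I) auto
  fix x assume x: "x \<in> DQ"
  show "a \<odot> x \<in> DQ" for a
    using summable_on_cmult_right[OF DQ_D(2)[OF x], of "(cmod a)\<^sup>2"] x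
    by (intro DQ_I) (auto simp: E_scl power_mult_distrib mult.left_commute)
  fix y assume y: "y \<in> DQ"
  have "(\<lambda>l. 2 * (\<bar>l\<bar> * (nm (P l x))\<^sup>2 + \<bar>l\<bar> * (nm (P l y))\<^sup>2)) summable_on UNIV"
    by (intro summable_on_cmult_right summable_on_add DQ_D(2) x y)
  then have "(\<lambda>l. \<bar>l\<bar> * (nm (P l (x \<oplus> y)))\<^sup>2) summable_on UNIV"
  proof (rule summable_on_comparison)
    fix l
    let ?u = "P l x" and ?v = "P l y"
    have uv: "?u \<in> V" "?v \<in> V" using x y by auto
    have "(nm (?u \<oplus> ?v))\<^sup>2 \<le> (nm ?u + nm ?v)\<^sup>2" by (rule power_mono[OF nm_triangle]) (use uv in auto)
    also have "\<dots> \<le> 2 * ((nm ?u)\<^sup>2 + (nm ?v)\<^sup>2)"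
      using zero_le_power2[of "nm ?u - nm ?v"] by (simp add: power2_sum power2_diff)
    finally have "\<bar>l\<bar> * (nm (?u \<oplus> ?v))\<^sup>2 \<le> \<bar>l\<bar> * (2 * ((nm ?u)\<^sup>2 + (nm ?v)\<^sup>2))"
      by (rule mult_left_mono) simp
    then show "\<bar>l\<bar> * (nm (P l (x \<oplus> y)))\<^sup>2 \<le> 2 * (\<bar>l\<bar> * (nm ?u)\<^sup>2 + \<bar>l\<bar> * (nm ?v)\<^sup>2)"
      using x y by (simp add: E_add algebra_simps)
  qed simp
  then show "x \<oplus> y \<in> DQ" using x y by (intro DQ_I) auto
qed (use DQ_V in auto)

lemma QQ_summable:
  assumes x: "x \<in> DQ" and y: "y \<in> DQ"
  shows "(\<lambda>l. of_real l * ip (P l x) (P l y)) summable_on UNIV"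
proof -
  have "(\<lambda>l. \<bar>l\<bar> * (nm (P l x))\<^sup>2 + \<bar>l\<bar> * (nm (P l y))\<^sup>2) summable_on UNIV"
    by (intro summable_on_add DQ_D(2) x y)
  then have "(\<lambda>l. norm (of_real l * ip (P l x) (P l y))) summable_on UNIV"
  proof (rule summable_on_comparison)
    fix l
    let ?u = "P l x" and ?v = "P l y"
    have uv: "?u \<in> V" "?v \<in> V" using x y by auto
    have "0 \<le> nm ?u * nm ?v" by (intro mult_nonneg_nonneg nm_nonneg uv)
    then have "nm ?u * nm ?v \<le> (nm ?u)\<^sup>2 + (nm ?v)\<^sup>2"
      using zero_le_power2[of "nm ?u - nm ?v"] unfolding power2_diff by linarith
    then have "cmod (ip ?u ?v) \<le> (nm ?u)\<^sup>2 + (nm ?v)\<^sup>2" using Cauchy_Schwarz[OF uv] by linarith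
    then have "\<bar>l\<bar> * cmod (ip ?u ?v) \<le> \<bar>l\<bar> * ((nm ?u)\<^sup>2 + (nm ?v)\<^sup>2)" by (rule mult_left_mono) simp
    then show "norm (of_real l * ip ?u ?v) \<le> \<bar>l\<bar> * (nm ?u)\<^sup>2 + \<bar>l\<bar> * (nm ?v)\<^sup>2"
      by (simp add: norm_mult algebra_simps)
  qed simp
  then show ?thesis by (rule abs_summable_summable)
qed

lemma QQ_has_sum:
  "x \<in> DQ \<Longrightarrow> y \<in> DQ \<Longrightarrow> ((\<lambda>l. of_real l * ip (P l x) (P l y)) has_sum QQ x y) UNIV"
  unfolding QQ_def by (intro has_sum_infsum QQ_summable)

lemma D_DQ: "D \<subseteq> DQ" using D_DA DA_DQ by blast

lemma QQ_I: "((\<lambda>l. of_real l * ip (P l x) (P l y)) has_sum c) UNIV \<Longrightarrow> QQ x y = c"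
  unfolding QQ_def by (rule infsumI)

text \<open>For fixed \<open>x\<close> the vectors \<open>y\<close> at which the series has the
  value \<open>Q x y\<close> form a subspace. It contains the eigenvectors, for which a single term
  of the series survives.\<close>

lemma QQ_eq_Q:
  assumes x: "x \<in> D" and y: "y \<in> D" shows "QQ x y = Q x y"
proof -
  let ?W = "{y \<in> D. ((\<lambda>l. of_real l * ip (P l x) (P l y)) has_sum Q x y) UNIV}"
  have "linear_subspace H ?W"
    unfolding linear_subspace_def
  proof (intro conjI ballI allI)
    show "nought \<in> ?W" using subspaceD(3)[OF D_lin] Q_rules(2)[OF x, of nought 0] x by simp
    fix y assume y: "y \<in> ?W"
    then have y': "y \<in> D" "((\<lambda>l. of_real l * ip (P l x) (P l y)) has_sum Q x y) UNIV" by auto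
    show "a \<odot> y \<in> ?W" for a
      using has_sum_cmult_right[OF y'(2), of a] y'(1)
        subspaceD(5)[OF D_lin] Q_rules(2)[OF x] x by (simp add: E_scl mult.left_commute)
    fix z assume z: "z \<in> ?W"
    then have z': "z \<in> D" "((\<lambda>l. of_real l * ip (P l x) (P l z)) has_sum Q x z) UNIV" by auto
    show "y \<oplus> z \<in> ?W"
      using has_sum_add[OF y'(2) z'(2)] y'(1) z'(1)
        subspaceD(4)[OF D_lin] Q_rules(1)[OF x] x by (simp add: E_add distrib_left)
  qed auto
  moreover have "eig m \<subseteq> ?W" for m
  proof
    fix e assume e: "e \<in> eig m"
    have "((\<lambda>l. of_real l * ip (P l x) (P l e)) has_sum (of_real m * ip (P m x) (P m e))) {m}" by (rule has_sum_finiteI) auto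
    moreover have "of_real m * ip (P m x) (P m e) = Q x e"
      using eig_Q[OF e x] Q_rules(5)[OF x eig_D[OF e]] inner_commute[of e x] e x
      by (simp add: E_sym E_eig[OF e])
    ultimately have "((\<lambda>l. of_real l * ip (P l x) (P l e)) has_sum Q x e) {m}" by simp
    then have "((\<lambda>l. of_real l * ip (P l x) (P l e)) has_sum Q x e) UNIV"
      by (rule has_sum_cong_neutral[THEN iffD1, rotated -1]) (use x in \<open>auto simp: E_eig[OF e]\<close>)
    then show "e \<in> ?W" using eig_D[OF e] by simp
  qed
  ultimately have "lin_span (\<Union>l. eig l) \<subseteq> ?W" by (intro lin_span_minimal UN_least)
  then show ?thesis using y spanned by (auto intro: QQ_I)
qed

lemma QQ_hermitian: "hermitian_form H DQ QQ"
  unfolding hermitian_form_def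
proof (intro conjI ballI allI)
  show "dense_subspace H DQ" by (rule superspace_dense[OF DQ_lin D_DQ])
  fix x y assume x: "x \<in> DQ" and y: "y \<in> DQ"
  note xy = QQ_has_sum[OF x y]
  show "QQ x (a \<odot> y) = a * QQ x y" for a
    by (rule QQ_I) (use has_sum_cmult_right[OF xy, of a] x y in \<open>simp add: E_scl mult.left_commute\<close>)
  show "QQ (a \<odot> x) y = cnj a * QQ x y" for a
    by (rule QQ_I) (use has_sum_cmult_right[OF xy, of "cnj a"] x y in \<open>simp add: E_scl mult.left_commute\<close>)
  have "((\<lambda>l. cnj (of_real l * ip (P l y) (P l x))) has_sum cnj (QQ y x)) UNIV"
    using QQ_has_sum[OF y x] by (subst has_sum_cnj_iff)
  moreover have "cnj (of_real l * ip (P l y) (P l x)) = of_real l * ip (P l x) (P l y)" for l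
    using inner_commute[of "P l x" "P l y"] x y by simp
  ultimately show "QQ x y = cnj (QQ y x)" by (intro QQ_I) (simp only:)
  fix z assume z: "z \<in> DQ"
  show "QQ x (y \<oplus> z) = QQ x y + QQ x z"
    by (rule QQ_I) (use has_sum_add[OF xy QQ_has_sum[OF x z]] x y z in \<open>simp add: E_add distrib_left\<close>)
  show "QQ (x \<oplus> y) z = QQ x z + QQ y z"
    by (rule QQ_I)
      (use has_sum_add[OF QQ_has_sum[OF x z] QQ_has_sum[OF y z]] x y z in \<open>simp add: E_add distrib_left\<close>)
qed

lemma spectral_norm_sq:
  assumes x: "x \<in> DQ"
  shows "((\<lambda>l. (1 + \<bar>l\<bar>) * (nm (P l x))\<^sup>2) has_sum (spectral_norm H E x)\<^sup>2) UNIV"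
proof -
  have "(\<lambda>l. (nm (P l x))\<^sup>2 + \<bar>l\<bar> * (nm (P l x))\<^sup>2) summable_on UNIV"
    by (intro summable_on_add P_summable DQ_D x)
  then have *: "(\<lambda>l. (1 + \<bar>l\<bar>) * (nm (P l x))\<^sup>2) summable_on UNIV" by (simp add: distrib_right)
  then have "0 \<le> (\<Sum>\<^sub>\<infinity>l. (1 + \<bar>l\<bar>) * (nm (P l x))\<^sup>2)" by (intro infsum_nonneg) simp
  then have "(spectral_norm H E x)\<^sup>2 = (\<Sum>\<^sub>\<infinity>l. (1 + \<bar>l\<bar>) * (nm (P l x))\<^sup>2)"
    using spectral_integral(2)[of x "\<lambda>l. 1 + \<bar>l\<bar>"] x by (simp add: spectral_norm_def)
  then show ?thesis using * by simp
qed

text \<open>Cut off the spectrum of \<open>x\<close> to a finite set \<open>F\<close>, then approximate in the Hilbert space norm, which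
  is equivalent to the spectral norm on the range of \<open>E F\<close>.\<close>

lemma spectral_closure_eq: "spectral_closure H E D = DQ"
proof -
  have "\<exists>y\<in>D. spectral_norm H E (x \<ominus> y) < e" if x: "x \<in> DQ" and e: "e > 0" for x and e :: real
  proof -
    let ?g = "\<lambda>l. (1 + \<bar>l\<bar>) * (nm (P l x))\<^sup>2"
    have "e\<^sup>2 / 2 > 0" using e by simp
    from spectral_norm_sq[OF x, unfolded has_sum_def tendsto_iff eventually_finite_subsets_at_top, rule_format, OF this]
    obtain F where F: "finite F" "dist (sum ?g F) ((spectral_norm H E x)\<^sup>2) < e\<^sup>2 / 2" by blast
    define M where "M = (\<Sum>l\<in>F. 1 + \<bar>l\<bar>) + 1"
    have M: "M > 0" unfolding M_def by (intro add_nonneg_pos sum_nonneg) auto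
    have M': "1 + \<bar>l\<bar> \<le> M" if "l \<in> F" for l
      using member_le_sum[of l F "\<lambda>l. 1 + \<bar>l\<bar>"] that F by (simp add: M_def)
    \<comment> \<open>\<open>M\<close> bounds the weights \<open>1 + |l|\<close> on
      \<open>F\<close>, and \<open>M * d^2 = e^2 / 2\<close>: one half of \<open>e^2\<close> is
      spent on \<open>F\<close>, the other on the tail of \<open>x\<close>.\<close>
    define d where "d = e / sqrt (2 * M)"
    have d: "d > 0" using e M by (simp add: d_def)
    obtain z where z: "z \<in> D" "nm (x \<ominus> z) < d" using D_approx[OF DQ_V[OF x] d] .
    \<comment> \<open>The cut-off is still in \<open>D\<close> and has no components off
      \<open>F\<close>, where the error is therefore exactly the tail of \<open>x\<close>, whatever
      \<open>z\<close> does there.\<close>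
    define y where "y = E F z"
    have y: "y \<in> D" unfolding y_def by (rule D_reduction(1)[OF z(1)])
    have xy: "x \<ominus> y \<in> DQ" using x y D_DQ subspaceD(6)[OF DQ_lin] by blast
    let ?h = "\<lambda>l. (1 + \<bar>l\<bar>) * (nm (P l (x \<ominus> y)))\<^sup>2"
    have out: "?h l = ?g l" if "l \<notin> F" for l
      using that x z by (simp add: y_def E_sub P_E)
    have "((\<lambda>l. ?g l) has_sum ((spectral_norm H E x)\<^sup>2 - sum ?g F)) (UNIV - F)"
      by (rule has_sum_Diff[OF spectral_norm_sq[OF x]]) (use F in auto)
    then have "(?h has_sum ((spectral_norm H E x)\<^sup>2 - sum ?g F)) (UNIV - F)"
      by (rule has_sum_cong[THEN iffD1, rotated]) (metis DiffD2 out)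
    moreover have "(?h has_sum sum ?h F) F" using F by simp
    ultimately have "(?h has_sum ((spectral_norm H E x)\<^sup>2 - sum ?g F + sum ?h F)) ((UNIV - F) \<union> F)"
      by (rule has_sum_Un_disjoint) auto
    then have "(?h has_sum ((spectral_norm H E x)\<^sup>2 - sum ?g F + sum ?h F)) UNIV" by simp
    then have "(spectral_norm H E (x \<ominus> y))\<^sup>2 = (spectral_norm H E x)\<^sup>2 - sum ?g F + sum ?h F"
      using spectral_norm_sq[OF xy] has_sum_unique by blast
    moreover have "(spectral_norm H E x)\<^sup>2 - sum ?g F < e\<^sup>2 / 2"
      using F(2) unfolding dist_real_def by linarith
    moreover have "sum ?h F \<le> e\<^sup>2 / 2"
    proof -
      have "sum ?h F \<le> (\<Sum>l\<in>F. M * (nm (P l (x \<ominus> z)))\<^sup>2)"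
      proof (rule sum_mono)
        fix l assume l: "l \<in> F"
        then have "P l (x \<ominus> y) = P l (x \<ominus> z)" using x z by (simp add: y_def E_sub P_E)
        then show "?h l \<le> M * (nm (P l (x \<ominus> z)))\<^sup>2" using M'[OF l] by (simp add: mult_right_mono)
      qed
      also have "\<dots> = M * (\<Sum>l\<in>F. (nm (P l (x \<ominus> z)))\<^sup>2)" by (simp add: sum_distrib_left)
      also have "\<dots> \<le> M * d\<^sup>2"
      proof (rule mult_left_mono)
        have "(\<Sum>l\<in>F. (nm (P l (x \<ominus> z)))\<^sup>2) = (nm (E F (x \<ominus> z)))\<^sup>2"
          using has_sum_unique[OF _ Parseval_nm[of "x \<ominus> z" F]] has_sum_finite[OF F(1)] x z by blast
        also have "\<dots> \<le> (nm (x \<ominus> z))\<^sup>2" by (rule power_mono[OF E_nm]) (use x z in auto)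
        also have "\<dots> \<le> d\<^sup>2" by (rule power_mono) (use x z in auto)
        finally show "(\<Sum>l\<in>F. (nm (P l (x \<ominus> z)))\<^sup>2) \<le> d\<^sup>2" .
      qed (use M in simp)
      also have "\<dots> = e\<^sup>2 / 2" using M by (simp add: d_def power_divide)
      finally show ?thesis .
    qed
    ultimately have "(spectral_norm H E (x \<ominus> y))\<^sup>2 < e\<^sup>2" by linarith
    then have "spectral_norm H E (x \<ominus> y) < e" using e by (simp add: power_less_imp_less_base)
    then show ?thesis using y by blast
  qed
  then show ?thesis unfolding spectral_closure_def DQ_eq[symmetric] by auto
qed

lemma QQ_integral:
  assumes x: "x \<in> DQ" shows "QQ x x = of_real (integral\<^sup>L (\<nu> x) (\<lambda>l. l))"
proof -
  have "(\<lambda>l. \<bar>l * (nm (P l x))\<^sup>2\<bar>) summable_on UNIV" using DQ_D(2)[OF x] by (simp add: abs_mult)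
  then have "(\<lambda>l. l * (nm (P l x))\<^sup>2) summable_on UNIV"
    using abs_summable_summable[of "\<lambda>l. l * (nm (P l x))\<^sup>2" UNIV] by simp
  then have "((\<lambda>l. l * (nm (P l x))\<^sup>2) has_sum integral\<^sup>L (\<nu> x) (\<lambda>l. l)) UNIV"
    using spectral_integral(2)[of x "\<lambda>l. l"] x by simp
  from has_sum_of_real[OF this, where 'a = complex]
  show ?thesis by (intro QQ_I) (use x in \<open>simp add: ip_self\<close>)
qed

theorem strongly_representable_A: "strongly_representable H D Q DA A"
  unfolding strongly_representable_def
proof (intro conjI self_adjoint_A exI[of _ E] exI[of _ DQ] exI[of _ QQ] resolution DA_DQ ballI)
  show "form_extends H DQ QQ D Q"
    using QQ_hermitian D_DQ QQ_eq_Q by (simp add: form_extends_def)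
  show "D \<subseteq> calculus_domain H E (\<lambda>l. sqrt \<bar>l\<bar>)" using D_DQ by (simp add: DQ_eq)
qed (use spectral_closure_eq QQ_integral in auto)

end

section \<open>The Hilbert space of square integrable functions\<close>

lemma borel_measurable_cnj [measurable]:
  "f \<in> borel_measurable M \<Longrightarrow> (\<lambda>x. cnj (f x)) \<in> borel_measurable M"
  by (rule borel_measurable_continuous_on[where f = cnj]) (intro continuous_intros)

lemma square_integrableD:
  assumes "f \<in> square_integrable M"
  shows "f \<in> borel_measurable M" "integrable M (\<lambda>x. (cmod (f x))\<^sup>2)"
  using assms by (auto simp: square_integrable_def)

lemma square_integrable_bound:
  assumes "f \<in> borel_measurable M" "integrable M g" "AE x in M. (cmod (f x))\<^sup>2 \<le> g x"
  shows "f \<in> square_integrable M"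
  unfolding square_integrable_def
  by (intro CollectI conjI assms(1) Bochner_Integration.integrable_bound[OF assms(2)])
    (use assms in auto)

lemma square_integrable_zero [simp]: "(\<lambda>_. 0) \<in> square_integrable M"
  by (simp add: square_integrable_def)

lemma square_integrable_add:
  assumes f: "f \<in> square_integrable M" and g: "g \<in> square_integrable M"
  shows "(\<lambda>x. f x + g x) \<in> square_integrable M"
proof (rule square_integrable_bound)
  note [measurable] = square_integrableD(1)[OF f] square_integrableD(1)[OF g]
  show "(\<lambda>x. f x + g x) \<in> borel_measurable M" by measurable
  show "integrable M (\<lambda>x. 2 * (cmod (f x))\<^sup>2 + 2 * (cmod (g x))\<^sup>2)"
    using square_integrableD(2)[OF f] square_integrableD(2)[OF g] by simp
  have "(cmod (f x + g x))\<^sup>2 \<le> 2 * (cmod (f x))\<^sup>2 + 2 * (cmod (g x))\<^sup>2" for x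
  proof -
    have "(cmod (f x + g x))\<^sup>2 \<le> (cmod (f x) + cmod (g x))\<^sup>2"
      by (intro power_mono norm_triangle_ineq) simp
    then show ?thesis
      using zero_le_power2[of "cmod (f x) - cmod (g x)"] unfolding power2_sum power2_diff by linarith
  qed
  then show "AE x in M. (cmod (f x + g x))\<^sup>2 \<le> 2 * (cmod (f x))\<^sup>2 + 2 * (cmod (g x))\<^sup>2" by simp
qed

lemma square_integrable_scale:
  assumes f: "f \<in> square_integrable M" shows "(\<lambda>x. a * f x) \<in> square_integrable M"
proof -
  note [measurable] = square_integrableD(1)[OF f]
  show ?thesis using square_integrableD(2)[OF f]
    by (auto simp: square_integrable_def norm_mult power_mult_distrib)
qed

lemma square_integrable_diff:
  assumes "f \<in> square_integrable M" "g \<in> square_integrable M"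
  shows "(\<lambda>x. f x - g x) \<in> square_integrable M"
  using square_integrable_add[OF assms(1) square_integrable_scale[OF assms(2), of "-1"]] by simp

lemma integrable_cnj_mult:
  assumes f: "f \<in> square_integrable M" and g: "g \<in> square_integrable M"
  shows "integrable M (\<lambda>x. cnj (f x) * g x)"
proof (rule Bochner_Integration.integrable_bound)
  note [measurable] = square_integrableD(1)[OF f] square_integrableD(1)[OF g]
  show "integrable M (\<lambda>x. (cmod (f x))\<^sup>2 + (cmod (g x))\<^sup>2)"
    using square_integrableD(2)[OF f] square_integrableD(2)[OF g] by simp
  show "(\<lambda>x. cnj (f x) * g x) \<in> borel_measurable M" by measurable
  have "cmod (f x) * cmod (g x) \<le> (cmod (f x))\<^sup>2 + (cmod (g x))\<^sup>2" for x
  proof -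
    have "0 \<le> cmod (f x) * cmod (g x)" by simp
    then show ?thesis
      using zero_le_power2[of "cmod (f x) - cmod (g x)"] unfolding power2_diff by linarith
  qed
  then show "AE x in M. norm (cnj (f x) * g x) \<le> norm ((cmod (f x))\<^sup>2 + (cmod (g x))\<^sup>2)"
    by (simp add: norm_mult)
qed

section \<open>Vectors as classes of functions\<close>

lemma L2_class_self: "f \<in> square_integrable M \<Longrightarrow> f \<in> L2_class M f"
  by (simp add: L2_class_def)

lemma L2_rep_class:
  assumes f: "f \<in> square_integrable M"
  shows "L2_rep (L2_class M f) \<in> square_integrable M" "AE x in M. L2_rep (L2_class M f) x = f x"
proof -
  have "L2_rep (L2_class M f) \<in> L2_class M f"
    unfolding L2_rep_def by (rule someI[where P = "\<lambda>h. h \<in> L2_class M f", OF L2_class_self[OF f]])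
  then show "L2_rep (L2_class M f) \<in> square_integrable M" "AE x in M. L2_rep (L2_class M f) x = f x"
    by (auto simp: L2_class_def)
qed

lemma L2_class_cong:
  assumes "AE x in M. f x = g x" shows "L2_class M f = L2_class M g"
proof -
  have "(AE x in M. h x = f x) \<longleftrightarrow> (AE x in M. h x = g x)" for h
    using assms by (auto elim: eventually_elim2)
  then show ?thesis by (auto simp: L2_class_def)
qed

lemma L2_class_rep:
  assumes "A \<in> carrier (L2 M)"
  shows "L2_rep A \<in> square_integrable M" "L2_class M (L2_rep A) = A"
proof -
  obtain f where f: "f \<in> square_integrable M" "A = L2_class M f" using assms by (auto simp: L2_def)
  show "L2_rep A \<in> square_integrable M" "L2_class M (L2_rep A) = A"
    using L2_rep_class[OF f(1)] L2_class_cong[OF L2_rep_class(2)[OF f(1)]] unfolding f(2) by auto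
qed

lemma L2_carrierI [simp, intro]: "f \<in> square_integrable M \<Longrightarrow> L2_class M f \<in> carrier (L2 M)"
  by (simp add: L2_def)

lemma L2_cases:
  assumes "A \<in> carrier (L2 M)" obtains f where "f \<in> square_integrable M" "A = L2_class M f"
  using L2_class_rep[OF assms] by metis

lemma L2_zero: "vzero (L2 M) = L2_class M (\<lambda>_. 0)"
  by (simp add: L2_def)

text \<open>The operations are given through the chosen \<open>L2_rep\<close>; with this rule and
  its companions below, any square integrable representative may be used instead.\<close>

lemma L2_plus:
  assumes "f \<in> square_integrable M" "g \<in> square_integrable M"
  shows "vplus (L2 M) (L2_class M f) (L2_class M g) = L2_class M (\<lambda>x. f x + g x)"
  using L2_rep_class(2)[OF assms(1)] L2_rep_class(2)[OF assms(2)]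
  by (auto simp: L2_def intro!: L2_class_cong elim: eventually_elim2)

lemma L2_scale:
  assumes "f \<in> square_integrable M"
  shows "vscale (L2 M) a (L2_class M f) = L2_class M (\<lambda>x. a * f x)"
  using L2_rep_class(2)[OF assms] by (auto simp: L2_def intro!: L2_class_cong)

lemma L2_inner:
  assumes "f \<in> square_integrable M" "g \<in> square_integrable M"
  shows "vinner (L2 M) (L2_class M f) (L2_class M g) = (\<integral>x. cnj (f x) * g x \<partial>M)"
proof -
  note [measurable] = square_integrableD(1)[OF assms(1)] square_integrableD(1)[OF assms(2)]
    square_integrableD(1)[OF L2_rep_class(1)[OF assms(1)]]
    square_integrableD(1)[OF L2_rep_class(1)[OF assms(2)]]
  have "(\<integral>x. cnj (L2_rep (L2_class M f) x) * L2_rep (L2_class M g) x \<partial>M) = (\<integral>x. cnj (f x) * g x \<partial>M)"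
  proof (rule integral_cong_AE)
    show "AE x in M. cnj (L2_rep (L2_class M f) x) * L2_rep (L2_class M g) x = cnj (f x) * g x"
      using L2_rep_class(2)[OF assms(1)] L2_rep_class(2)[OF assms(2)] by eventually_elim simp
  qed measurable
  then show ?thesis by (simp add: L2_def)
qed

lemma L2_minus:
  assumes "f \<in> square_integrable M" "g \<in> square_integrable M"
  shows "vminus (L2 M) (L2_class M f) (L2_class M g) = L2_class M (\<lambda>x. f x - g x)"
  using assms by (simp add: vminus_def L2_scale L2_plus square_integrable_scale[of _ _ "-1", simplified])

lemma L2_norm_sq:
  assumes f: "f \<in> square_integrable M"
  shows "(vnorm (L2 M) (L2_class M f))\<^sup>2 = (\<integral>x. (cmod (f x))\<^sup>2 \<partial>M)"
    and "vinner (L2 M) (L2_class M f) (L2_class M f) = of_real (\<integral>x. (cmod (f x))\<^sup>2 \<partial>M)"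
proof -
  have "(\<integral>x. cnj (f x) * f x \<partial>M) = (\<integral>x. of_real ((cmod (f x))\<^sup>2) \<partial>M)"
    by (rule arg_cong[where f = "integral\<^sup>L M"])
      (simp only: complex_norm_square mult.commute)
  also have "\<dots> = of_real (\<integral>x. (cmod (f x))\<^sup>2 \<partial>M)" by (rule integral_complex_of_real)
  finally show *: "vinner (L2 M) (L2_class M f) (L2_class M f) = of_real (\<integral>x. (cmod (f x))\<^sup>2 \<partial>M)"
    using L2_inner[OF f f] by simp
  have "0 \<le> (\<integral>x. (cmod (f x))\<^sup>2 \<partial>M)" by (rule integral_nonneg_AE) simp
  then show "(vnorm (L2 M) (L2_class M f))\<^sup>2 = (\<integral>x. (cmod (f x))\<^sup>2 \<partial>M)"
    unfolding vnorm_def * by simp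
qed

lemma L2_inner_product_space: "inner_product_space (L2 M)"
proof (rule inner_product_space.intro)
  let ?H = "L2 M"
  note sq = square_integrable_add square_integrable_scale
  show "comm_group \<lparr>carrier = carrier ?H, monoid.mult = vplus ?H, one = vzero ?H\<rparr>"
  proof (rule comm_groupI, goal_cases)
    case (1 x y) then show ?case by (auto elim!: L2_cases simp: L2_plus sq)
  next
    case 2 then show ?case by (simp add: L2_zero)
  next
    case (3 x y z) then show ?case by (auto elim!: L2_cases simp: L2_plus sq add.assoc)
  next
    case (4 x y) then show ?case by (auto elim!: L2_cases simp: L2_plus add.commute)
  next
    case (5 x) then show ?case by (auto elim!: L2_cases simp: L2_plus L2_zero)
  next
    case (6 x)
    then obtain f where f: "f \<in> square_integrable M" "x = L2_class M f" by (auto elim: L2_cases)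
    show ?case
      by (rule bexI[of _ "L2_class M (\<lambda>x. - 1 * f x)"])
        (use f square_integrable_scale[OF f(1), of "-1"] in \<open>auto simp: L2_plus L2_zero\<close>)
  qed
  fix x y z assume x: "x \<in> carrier ?H"
  obtain f where f: "f \<in> square_integrable M" "x = L2_class M f" using x by (rule L2_cases)
  show "vscale ?H a x \<in> carrier ?H" for a using f by (simp add: L2_scale sq)
  show "vscale ?H (a + b) x = vplus ?H (vscale ?H a x) (vscale ?H b x)" for a b
    using f by (simp add: L2_scale L2_plus sq distrib_right)
  show "vscale ?H a (vscale ?H b x) = vscale ?H (a * b) x" for a b
    using f by (simp add: L2_scale sq mult.assoc)
  show "vscale ?H 1 x = x" using f by (simp add: L2_scale)
  have "0 \<le> (\<integral>x. (cmod (f x))\<^sup>2 \<partial>M)" by (rule integral_nonneg_AE) simp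
  then show "0 \<le> Re (vinner ?H x x)" using L2_norm_sq(2)[OF f(1)] f(2) by simp
  show "x = vzero ?H" if "vinner ?H x x = 0"
  proof -
    have "(\<integral>x. (cmod (f x))\<^sup>2 \<partial>M) = 0" using that L2_norm_sq(2)[OF f(1)] f(2) by simp
    then have "AE x in M. (cmod (f x))\<^sup>2 = 0"
      using integral_nonneg_eq_0_iff_AE[OF square_integrableD(2)[OF f(1)]] by simp
    then show ?thesis unfolding f(2) L2_zero by (intro L2_class_cong) simp
  qed
  assume y: "y \<in> carrier ?H"
  obtain g where g: "g \<in> square_integrable M" "y = L2_class M g" using y by (rule L2_cases)
  show "vscale ?H a (vplus ?H x y) = vplus ?H (vscale ?H a x) (vscale ?H a y)" for a
    using f g by (simp add: L2_scale L2_plus sq distrib_left)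
  show "vinner ?H x y = cnj (vinner ?H y x)"
  proof -
    have "(\<integral>x. cnj (f x) * g x \<partial>M) = (\<integral>x. cnj (cnj (g x) * f x) \<partial>M)"
      by (simp add: mult.commute)
    also have "\<dots> = cnj (\<integral>x. cnj (g x) * f x \<partial>M)" by (rule Bochner_Integration.integral_cnj)
    finally show ?thesis using f g by (simp add: L2_inner)
  qed
  show "vinner ?H x (vscale ?H a y) = a * vinner ?H x y" for a
    using f g by (simp add: L2_scale L2_inner sq mult.left_commute[of _ a])
  assume z: "z \<in> carrier ?H"
  obtain h where h: "h \<in> square_integrable M" "z = L2_class M h" using z by (rule L2_cases)
  show "vinner ?H x (vplus ?H y z) = vinner ?H x y + vinner ?H x z"
    using f g h integrable_cnj_mult[OF f(1) g(1)] integrable_cnj_mult[OF f(1) h(1)]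
    by (simp add: L2_inner L2_plus sq distrib_left)
qed

text \<open>Riesz--Fischer: along a rapidly Cauchy subsequence with differences \<open>g k\<close>, the function
  \<open>\<Sum>k. 2\<^sup>k \<bar>g k\<bar>\<^sup>2\<close> is integrable, hence finite almost everywhere, which forces pointwise convergence;
  Fatou's lemma identifies the pointwise limit as the limit in \<open>L2 M\<close>.\<close>

lemma L2_rapid_limit:
  fixes f :: "nat \<Rightarrow> 'g \<Rightarrow> complex"
  assumes f: "\<And>n. f n \<in> square_integrable M"
    and rapid: "\<And>n. (\<integral>x. (cmod (f (Suc n) x - f n x))\<^sup>2 \<partial>M) \<le> (1/4)^n"
  shows "AE x in M. convergent (\<lambda>n. f n x)"
proof -
  note [measurable] = square_integrableD(1)[OF f]
  define g where "g n x = f (Suc n) x - f n x" for n x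
  have g: "g n \<in> square_integrable M" for n
    unfolding g_def using square_integrable_diff[OF f f] by simp
  note [measurable] = square_integrableD(1)[OF g]
  define S where "S x = (\<Sum>n. ennreal (2^n * (cmod (g n x))\<^sup>2))" for x
  have [measurable]: "S \<in> borel_measurable M" unfolding S_def by measurable
  have "(\<integral>\<^sup>+x. S x \<partial>M) = (\<Sum>n. \<integral>\<^sup>+x. ennreal (2^n * (cmod (g n x))\<^sup>2) \<partial>M)"
    unfolding S_def by (rule nn_integral_suminf) measurable
  also have "\<dots> \<le> (\<Sum>n. ennreal ((1/2)^n))"
  proof (intro suminf_le)
    fix n
    have "(\<integral>\<^sup>+x. ennreal (2^n * (cmod (g n x))\<^sup>2) \<partial>M) = ennreal (\<integral>x. 2^n * (cmod (g n x))\<^sup>2 \<partial>M)"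
      by (rule nn_integral_eq_integral) (use square_integrableD(2)[OF g] in auto)
    also have "\<dots> \<le> ennreal ((1/2)^n)"
    proof (rule ennreal_leI)
      have "(\<integral>x. 2^n * (cmod (g n x))\<^sup>2 \<partial>M) \<le> 2^n * (1/4)^n"
        using rapid[of n] by (simp add: g_def)
      also have "\<dots> = (1/2)^n" by (simp flip: power_mult_distrib)
      finally show "(\<integral>x. 2^n * (cmod (g n x))\<^sup>2 \<partial>M) \<le> (1/2)^n" .
    qed
    finally show "(\<integral>\<^sup>+x. ennreal (2^n * (cmod (g n x))\<^sup>2) \<partial>M) \<le> ennreal ((1/2)^n)" .
  qed auto
  also have "\<dots> = ennreal (\<Sum>n. (1/2)^n)" by (rule suminf_ennreal2) auto
  also have "\<dots> < \<infinity>" by simp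
  finally have "(\<integral>\<^sup>+x. S x \<partial>M) \<noteq> \<infinity>" by simp
  then have "AE x in M. S x \<noteq> \<infinity>" by (intro nn_integral_PInf_AE) auto
  then show ?thesis
  proof eventually_elim
    fix x assume fin: "S x \<noteq> \<infinity>"
    define s where "s = enn2real (S x)"
    have S: "S x = ennreal s" "0 \<le> s" using fin by (auto simp: s_def less_top)
    \<comment> \<open>A single term of \<open>S x\<close> is at most \<open>s\<close>, which leaves
      geometric decay with ratio \<open>sqrt (1/2)\<close>.\<close>
    have bd: "cmod (g n x) \<le> sqrt s * (sqrt (1/2))^n" for n
    proof -
      have "ennreal (2^n * (cmod (g n x))\<^sup>2) \<le> S x"
      proof -
        have "(\<Sum>n\<in>{n}. ennreal (2^n * (cmod (g n x))\<^sup>2)) \<le> S x"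
          unfolding S_def by (rule sum_le_suminf) auto
        then show ?thesis by simp
      qed
      then have "2^n * (cmod (g n x))\<^sup>2 \<le> s" using S by (simp add: ennreal_le_iff)
      then have "(cmod (g n x))\<^sup>2 \<le> s * (1/2)^n" by (simp add: field_simps power_divide)
      then have "cmod (g n x) \<le> sqrt (s * (1/2)^n)" by (rule real_le_rsqrt)
      then show ?thesis unfolding real_sqrt_mult real_sqrt_power .
    qed
    have sg: "summable (\<lambda>n. sqrt s * (sqrt (1/2))^n)"
      by (intro summable_mult summable_geometric) (simp add: real_sqrt_lt_1_iff)
    have "summable (\<lambda>n. g n x)" by (rule summable_comparison_test'[OF sg, of 0]) (rule bd)
    then have "convergent (\<lambda>n. \<Sum>k<n. g k x)" by (simp add: summable_iff_convergent)
    then have "convergent (\<lambda>n. f 0 x + (\<Sum>k<n. g k x))" by (intro convergent_add convergent_const)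
    then show "convergent (\<lambda>n. f n x)"
      using sum_lessThan_telescope[of "\<lambda>n. f n x"] by (simp add: g_def)
  qed
qed

lemma L2_hilbert_space: "hilbert_space (L2 M)"
proof -
  interpret inner_product_space "L2 M" by (rule L2_inner_product_space)
  show ?thesis
  proof (unfold_locales, unfold ms.mcomplete_def, intro allI impI)
    fix s assume Cau: "ms.MCauchy s"
    have sV: "s n \<in> V" for n using Cau by (auto simp: ms.MCauchy_def)
    have C: "\<exists>N. \<forall>m\<ge>N. \<forall>n\<ge>N. nm (sub (s m) (s n)) < e" if "e > 0" for e
      using Cau that sV unfolding ms.MCauchy_def by (fastforce simp: vdist_def)
    have "\<exists>N. \<forall>m\<ge>N. \<forall>n\<ge>N. nm (sub (s m) (s n)) < (1/2)^k" for k by (rule C) simp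
    then obtain N where N: "\<And>k m n. m \<ge> N k \<Longrightarrow> n \<ge> N k \<Longrightarrow> nm (sub (s m) (s n)) < (1/2)^k" by metis
    \<comment> \<open>The sum takes \<open>r k\<close> beyond \<open>N k\<close> and keeps it
      monotone; the summand \<open>k\<close> makes it strictly increasing.\<close>
    define r where "r k = (\<Sum>i\<le>k. N i) + k" for k
    have r: "strict_mono r" by (rule strict_mono_Suc_iff[THEN iffD2]) (simp add: r_def)
    have rN: "N k \<le> r k" for k
      using member_le_sum[of k "{..k}" N] by (simp add: r_def)
    define f where "f k = L2_rep (s (r k))" for k
    have f: "f k \<in> square_integrable M" "s (r k) = L2_class M (f k)" for k
      using L2_class_rep[OF sV] by (auto simp: f_def)
    note [measurable] = square_integrableD(1)[OF f(1)]
    have nmf: "(nm (sub (s (r i)) (s (r j))))\<^sup>2 = (\<integral>x. (cmod (f i x - f j x))\<^sup>2 \<partial>M)" for i j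
      unfolding f(2) L2_minus[OF f(1) f(1)] by (rule L2_norm_sq(1)[OF square_integrable_diff[OF f(1) f(1)]])
    have "(\<integral>x. (cmod (f (Suc k) x - f k x))\<^sup>2 \<partial>M) \<le> (1/4)^k" for k
    proof -
      have "r k \<le> r (Suc k)" using r by (simp add: strict_mono_less_eq)
      then have "nm (sub (s (r (Suc k))) (s (r k))) < (1/2)^k" using N rN by (meson order_trans)
      then have "(nm (sub (s (r (Suc k))) (s (r k))))\<^sup>2 \<le> ((1/2)^k)\<^sup>2"
        by (intro power_mono) (use sV in auto)
      also have "((1/2)^k)\<^sup>2 = (1/4 :: real)^k" by (simp add: power2_eq_square flip: power_mult_distrib)
      finally show ?thesis by (simp add: nmf)
    qed
    from L2_rapid_limit[OF f(1) this] have conv: "AE x in M. convergent (\<lambda>n. f n x)" .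
    define F where "F x = lim (\<lambda>n. f n x)" for x
    have [measurable]: "F \<in> borel_measurable M" unfolding F_def by measurable
    have lim: "AE x in M. (\<lambda>n. f n x) \<longlonglongrightarrow> F x"
      using conv by eventually_elim (simp add: F_def convergent_LIMSEQ_iff)
    have Fatou: "(\<integral>\<^sup>+x. ennreal ((cmod (f n x - F x))\<^sup>2) \<partial>M) \<le> ennreal (e\<^sup>2)"
      if e: "\<And>m. m \<ge> n \<Longrightarrow> nm (sub (s (r n)) (s (r m))) \<le> e" for n e
    proof -
      have "(\<integral>\<^sup>+x. ennreal ((cmod (f n x - F x))\<^sup>2) \<partial>M)
          = (\<integral>\<^sup>+x. liminf (\<lambda>m. ennreal ((cmod (f n x - f m x))\<^sup>2)) \<partial>M)"
      proof (rule nn_integral_cong_AE)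
        show "AE x in M. ennreal ((cmod (f n x - F x))\<^sup>2) = liminf (\<lambda>m. ennreal ((cmod (f n x - f m x))\<^sup>2))"
          using lim
        proof eventually_elim
          fix x assume "(\<lambda>n. f n x) \<longlonglongrightarrow> F x"
          then have "(\<lambda>m. ennreal ((cmod (f n x - f m x))\<^sup>2)) \<longlonglongrightarrow> ennreal ((cmod (f n x - F x))\<^sup>2)"
            by (intro tendsto_intros)
          then show "ennreal ((cmod (f n x - F x))\<^sup>2) = liminf (\<lambda>m. ennreal ((cmod (f n x - f m x))\<^sup>2))"
            by (intro lim_imp_Liminf[symmetric]) auto
        qed
      qed
      also have "\<dots> \<le> liminf (\<lambda>m. \<integral>\<^sup>+x. ennreal ((cmod (f n x - f m x))\<^sup>2) \<partial>M)"
        by (rule nn_integral_liminf) measurable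
      also have "\<dots> \<le> ennreal (e\<^sup>2)"
      proof (rule Liminf_le)
        have "(\<integral>\<^sup>+x. ennreal ((cmod (f n x - f m x))\<^sup>2) \<partial>M) \<le> ennreal (e\<^sup>2)" if "m \<ge> n" for m
        proof -
          have "(\<integral>\<^sup>+x. ennreal ((cmod (f n x - f m x))\<^sup>2) \<partial>M) = ennreal (\<integral>x. (cmod (f n x - f m x))\<^sup>2 \<partial>M)"
            by (rule nn_integral_eq_integral)
              (use square_integrableD(2)[OF square_integrable_diff[OF f(1) f(1)]] in auto)
          also have "\<dots> \<le> ennreal (e\<^sup>2)"
            unfolding nmf[symmetric] by (intro ennreal_leI power_mono e that) (use sV in auto)
          finally show ?thesis .
        qed
        then show "\<forall>\<^sub>F m in sequentially. (\<integral>\<^sup>+x. ennreal ((cmod (f n x - f m x))\<^sup>2) \<partial>M) \<le> ennreal (e\<^sup>2)"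
          unfolding eventually_sequentially by blast
      qed simp
      finally show ?thesis .
    qed
    have sqd: "(\<lambda>x. f n x - F x) \<in> square_integrable M" and nd: "(\<integral>x. (cmod (f n x - F x))\<^sup>2 \<partial>M) \<le> e\<^sup>2"
      if e: "\<And>m. m \<ge> n \<Longrightarrow> nm (sub (s (r n)) (s (r m))) \<le> e" for n e
    proof -
      have fin: "(\<integral>\<^sup>+x. ennreal ((cmod (f n x - F x))\<^sup>2) \<partial>M) < \<infinity>"
        using Fatou[OF e] by (simp add: order_le_less_trans)
      have int: "integrable M (\<lambda>x. (cmod (f n x - F x))\<^sup>2)"
        by (rule integrableI_nonneg) (use fin in auto)
      then show "(\<lambda>x. f n x - F x) \<in> square_integrable M" by (simp add: square_integrable_def)
      have "ennreal (\<integral>x. (cmod (f n x - F x))\<^sup>2 \<partial>M) \<le> ennreal (e\<^sup>2)"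
        using Fatou[OF e] nn_integral_eq_integral[OF int] by simp
      then show "(\<integral>x. (cmod (f n x - F x))\<^sup>2 \<partial>M) \<le> e\<^sup>2" by simp
    qed
    have small: "nm (sub (s (r n)) (s (r m))) \<le> (1/2)^k" if "k \<le> n" "n \<le> m" for k n m
    proof -
      have "r k \<le> r n" "r k \<le> r m" using r that by (simp_all add: strict_mono_less_eq)
      then show ?thesis using N[of k "r n" "r m"] rN[of k] by simp
    qed
    \<comment> \<open>Square integrability is known for the differences \<open>f n - F\<close> only;
      \<open>F\<close> is recovered from \<open>f 0\<close>.\<close>
    have "(\<lambda>x. f 0 x - (f 0 x - F x)) \<in> square_integrable M"
      by (intro square_integrable_diff f sqd[of 0 1]) (use small[of 0] in simp)
    then have F: "F \<in> square_integrable M" by simp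
    define x where "x = L2_class M F"
    have xV: "x \<in> V" using F by (auto simp: x_def)
    have d: "nm (sub (s (r n)) (x)) \<le> (1/2)^n" for n
    proof (rule power2_le_imp_le)
      have "(nm (sub (s (r n)) (x)))\<^sup>2 = (\<integral>x. (cmod (f n x - F x))\<^sup>2 \<partial>M)"
        unfolding f(2) x_def L2_minus[OF f(1) F] by (rule L2_norm_sq(1)[OF square_integrable_diff[OF f(1) F]])
      also have "\<dots> \<le> ((1/2)^n)\<^sup>2" by (rule nd) (rule small, auto)
      finally show "(nm (sub (s (r n)) (x)))\<^sup>2 \<le> ((1/2)^n)\<^sup>2" .
    qed simp
    have "conv (s \<circ> r) x" unfolding conv_def
    proof (rule Lim_null_comparison)
      show "(\<lambda>n. (1/2 :: real)^n) \<longlonglongrightarrow> 0" by (rule LIMSEQ_power_zero) simp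
      show "\<forall>\<^sub>F n in sequentially. norm (nm (sub ((s \<circ> r) n) (x))) \<le> (1/2)^n"
        using d sV xV by simp
    qed
    then have "limitin (vtopology (L2 M)) (s \<circ> r) x sequentially"
      using limitin_iff[of "s \<circ> r" x] sV xV by auto
    then have "limitin ms.mtopology s x sequentially"
      unfolding vtopology_eq using ms.MCauchy_convergent_subsequence[OF Cau r] by simp
    then show "\<exists>x. limitin ms.mtopology s x sequentially" by blast
  qed
qed

section \<open>Haar measure on a compact metrisable group\<close>

text \<open>Balls of radius \<open>1 / (n + 1)\<close> around finite nets, for all \<open>n\<close>,
  form a countable base. It is wanted for the measurability of the group multiplication.\<close>

lemma compact_metrizable_imp_second_countable:
  assumes "compact_space X" "metrizable_space X" shows "second_countable X"
proof -
  obtain M d where "Metric_space M d" and X: "X = Metric_space.mtopology M d"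
    using assms(2) by (auto simp: metrizable_space_def)
  interpret Metric_space M d by fact
  have "mtotally_bounded M"
    using assms(1) compactin_imp_mtotally_bounded[of M] by (simp add: X compact_space_def)
  then have "\<exists>K. finite K \<and> K \<subseteq> M \<and> M \<subseteq> (\<Union>x\<in>K. mball x (1 / real (Suc n)))" for n
    by (auto simp: mtotally_bounded_def)
  then obtain K where K: "\<And>n. finite (K n)" "\<And>n. K n \<subseteq> M"
    "\<And>n. M \<subseteq> (\<Union>x\<in>K n. mball x (1 / real (Suc n)))" by metis
  define \<B> where "\<B> = (\<Union>n. (\<lambda>x. mball x (1 / real (Suc n))) ` K n)"
  show ?thesis unfolding second_countable_def
  proof (intro exI[of _ \<B>] conjI allI impI ballI)
    show "countable \<B>" unfolding \<B>_def by (intro countable_UN) (auto intro: countable_finite K(1))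
    show "openin X V" if "V \<in> \<B>" for V using that by (auto simp: \<B>_def X)
    fix U x assume U: "openin X U \<and> x \<in> U"
    then have x: "x \<in> M" using openin_subset[of X U] by (auto simp: X)
    obtain r where r: "r > 0" "mball x r \<subseteq> U" using U by (auto simp: X openin_mtopology)
    obtain n where n: "2 / r < real n" using reals_Archimedean2 by blast
    have d2: "1 / real (Suc n) + 1 / real (Suc n) < r"
    proof -
      have "2 / r < real (Suc n)" using n by simp
      then show ?thesis using r by (simp add: field_simps del: of_nat_Suc)
    qed
    obtain y where y: "y \<in> K n" "x \<in> mball y (1 / real (Suc n))" using K(3)[of n] x by blast
    have "mball y (1 / real (Suc n)) \<subseteq> mball x r"
    proof
      fix z assume z: "z \<in> mball y (1 / real (Suc n))"
      then have "d x z \<le> d y x + d y z" using y triangle[of x y z] commute[of x y] by auto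
      also have "\<dots> < r" using y z d2 by auto
      finally show "z \<in> mball x r" using x z by auto
    qed
    then show "\<exists>V\<in>\<B>. x \<in> V \<and> V \<subseteq> U" using y r by (auto simp: \<B>_def)
  qed
qed

locale haar_group = compact_metrisable_group G T for G (structure) and T +
  fixes M
  assumes haar: "haar_measure G T M"
begin

lemma sets_M: "sets M = sigma_sets (carrier G) {U. openin T U}"
  using haar topspace_eq by (simp add: haar_measure_def)

lemma open_sub: "openin T U \<Longrightarrow> U \<subseteq> carrier G"
  using openin_subset[of T U] topspace_eq by simp

lemma open_sets: "openin T U \<Longrightarrow> U \<in> sets M"
  by (simp add: sets_M sigma_sets.Basic)

lemma space_M: "space M = carrier G"
proof
  show "space M \<subseteq> carrier G"
    using sets.top[of M] sigma_sets_into_sp[of "{U. openin T U}" "carrier G" "space M"] open_sub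
    by (auto simp: sets_M)
  have "carrier G \<in> sets M" using open_sets openin_topspace topspace_eq by metis
  then show "carrier G \<subseteq> space M" by (rule sets.sets_into_space)
qed

lemma finite_M: "finite_measure M" using haar by (simp add: haar_measure_def)

sublocale finite_measure M by (rule finite_M)

sublocale pair_sigma_finite M M ..

lemma emeasure_pos: "emeasure M (space M) \<noteq> 0" using haar by (simp add: haar_measure_def)

lemma measurable_openI:
  assumes "f \<in> space N \<rightarrow> carrier G" "\<And>U. openin T U \<Longrightarrow> f -` U \<inter> space N \<in> sets N"
  shows "f \<in> measurable N M"
  by (rule measurable_sigma_sets[OF sets_M]) (use assms open_sub in auto)

lemma measurable_continuous:
  assumes "continuous_map T T f" shows "f \<in> measurable M M"
proof (rule measurable_openI)
  show "f \<in> space M \<rightarrow> carrier G"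
    using assms topspace_eq by (auto simp: space_M continuous_map_def)
  fix U assume "openin T U"
  then have "openin T {x \<in> topspace T. f x \<in> U}" by (rule openin_continuous_map_preimage[OF assms])
  then have "openin T (f -` U \<inter> space M)"
    by (simp add: topspace_eq space_M vimage_def Int_def conj_commute)
  then show "f -` U \<inter> space M \<in> sets M" by (rule open_sets)
qed

lemma measurable_inv [measurable]: "(\<lambda>x. inv x) \<in> measurable M M"
  by (rule measurable_continuous[OF continuous_inv])

text \<open>The preimage of an open set is open in the product topology, hence a union of open
  rectangles. With a countable base countably many suffice, which puts it into the product of the
  Borel algebras.\<close>

lemma measurable_mult [measurable]: "(\<lambda>(x, y). x \<otimes> y) \<in> measurable (M \<Otimes>\<^sub>M M) M"
proof (rule measurable_openI)
  show "(\<lambda>(x, y). x \<otimes> y) \<in> space (M \<Otimes>\<^sub>M M) \<rightarrow> carrier G"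
    by (auto simp: space_pair_measure space_M)
  fix U assume U: "openin T U"
  let ?W = "(\<lambda>(x, y). x \<otimes> y) -` U \<inter> space (M \<Otimes>\<^sub>M M)"
  have W: "?W = {p \<in> topspace (prod_topology T T). (case p of (x, y) \<Rightarrow> x \<otimes> y) \<in> U}"
    by (auto simp: space_pair_measure space_M topspace_eq)
  have op: "openin (prod_topology T T) ?W"
    unfolding W by (rule openin_continuous_map_preimage[OF continuous_mult U])
  have rect: "\<exists>A B. openin T A \<and> openin T B \<and> x \<in> A \<and> y \<in> B \<and> A \<times> B \<subseteq> ?W" if "(x, y) \<in> ?W" for x y
    using op[unfolded openin_prod_topology_alt, rule_format, OF that] by blast
  obtain \<B> where \<B>: "countable \<B>" "\<And>A. A \<in> \<B> \<Longrightarrow> openin T A"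
    "\<And>A x. openin T A \<Longrightarrow> x \<in> A \<Longrightarrow> \<exists>B\<in>\<B>. x \<in> B \<and> B \<subseteq> A"
    using compact_metrizable_imp_second_countable[OF compact metrisable]
    unfolding second_countable_def by metis
  define \<R> where "\<R> = {(A, B) \<in> \<B> \<times> \<B>. A \<times> B \<subseteq> ?W}"
  have "countable \<R>" by (rule countable_subset[of _ "\<B> \<times> \<B>"]) (auto simp: \<R>_def \<B>)
  then have "(\<Union>(A, B)\<in>\<R>. A \<times> B) \<in> sets (M \<Otimes>\<^sub>M M)"
    by (rule sets.countable_UN') (auto simp: \<R>_def \<B> intro!: pair_measureI open_sets)
  moreover have "?W = (\<Union>(A, B)\<in>\<R>. A \<times> B)"
  proof (intro equalityI subsetI)
    fix p assume p: "p \<in> ?W"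
    obtain x y where xy: "p = (x, y)" by (cases p)
    obtain A B where AB: "openin T A" "openin T B" "x \<in> A" "y \<in> B" "A \<times> B \<subseteq> ?W"
      using rect[OF p[unfolded xy]] by blast
    obtain A' B' where "A' \<in> \<B>" "x \<in> A'" "A' \<subseteq> A" "B' \<in> \<B>" "y \<in> B'" "B' \<subseteq> B"
      using \<B>(3) AB by metis
    then have "(A', B') \<in> \<R>" "p \<in> A' \<times> B'" using AB xy by (auto simp: \<R>_def)
    then show "p \<in> (\<Union>(A, B)\<in>\<R>. A \<times> B)" by blast
  qed (auto simp: \<R>_def)
  ultimately show "?W \<in> sets (M \<Otimes>\<^sub>M M)" by simp
qed

lemma measurable_mult' [measurable (raw)]:
  "f \<in> measurable N M \<Longrightarrow> g \<in> measurable N M \<Longrightarrow> (\<lambda>x. f x \<otimes> g x) \<in> measurable N M"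
  using measurable_compose[OF measurable_Pair measurable_mult, of f N g] by simp

lemma measurable_element: "g \<in> carrier G \<Longrightarrow> (\<lambda>x. g) \<in> measurable N M"
  by (rule measurable_const) (simp add: space_M)

section \<open>Invariance under translations and inversion\<close>

lemma distr_left:
  assumes g: "g \<in> carrier G" shows "distr M M (\<lambda>x. g \<otimes> x) = M"
proof (rule measure_eqI)
  note [measurable] = measurable_element[OF g]
  fix A assume "A \<in> sets (distr M M (\<lambda>x. g \<otimes> x))"
  then have A: "A \<in> sets M" by simp
  have AG: "A \<subseteq> carrier G" using sets.sets_into_space[OF A] by (simp add: space_M)
  have "emeasure (distr M M (\<lambda>x. g \<otimes> x)) A = emeasure M ((\<lambda>x. g \<otimes> x) -` A \<inter> space M)"
    using A by (subst emeasure_distr) auto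
  also have "(\<lambda>x. g \<otimes> x) -` A \<inter> space M = (\<lambda>x. inv g \<otimes> x) ` A"
  proof (intro equalityI subsetI)
    fix x assume x: "x \<in> (\<lambda>x. g \<otimes> x) -` A \<inter> space M"
    then have "x = inv g \<otimes> (g \<otimes> x)" using g by (simp add: space_M m_assoc[symmetric])
    then show "x \<in> (\<lambda>x. inv g \<otimes> x) ` A" using x by blast
  qed (use g AG in \<open>auto simp: space_M m_assoc[symmetric]\<close>)
  also have "emeasure M \<dots> = emeasure M A"
    using haar g A by (simp add: haar_measure_def)
  finally show "emeasure (distr M M (\<lambda>x. g \<otimes> x)) A = emeasure M A" .
qed simp

text \<open>Unimodularity: integrate \<open>1\<^sub>A(x y)\<close> over the product of the inverse image measure and \<open>M\<close>
  in both orders.\<close>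

lemma distr_inv: "distr M M (\<lambda>x. inv x) = M"
proof (rule measure_eqI)
  fix A assume "A \<in> sets (distr M M (\<lambda>x. inv x))"
  then have A [measurable]: "A \<in> sets M" by simp
  let ?\<mu> = "emeasure M"
  define c where "c = (\<integral>\<^sup>+x. indicator A (inv x) \<partial>M)"
  have left: "(\<integral>\<^sup>+y. F (z \<otimes> y) \<partial>M) = (\<integral>\<^sup>+y. F y \<partial>M)"
    if z: "z \<in> carrier G" and F [measurable]: "F \<in> borel_measurable M" for z and F :: "'a \<Rightarrow> ennreal"
  proof -
    note [measurable] = measurable_element[OF z]
    have "(\<integral>\<^sup>+y. F y \<partial>M) = (\<integral>\<^sup>+y. F y \<partial>distr M M (\<lambda>x. z \<otimes> x))" by (simp add: distr_left[OF z])
    also have "\<dots> = (\<integral>\<^sup>+y. F (z \<otimes> y) \<partial>M)" by (rule nn_integral_distr) auto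
    finally show ?thesis by simp
  qed
  have "(\<integral>\<^sup>+x. \<integral>\<^sup>+y. indicator A (inv x \<otimes> y) \<partial>M \<partial>M) = (\<integral>\<^sup>+x. ?\<mu> A \<partial>M)"
    by (rule nn_integral_cong) (simp add: left[where F = "indicator A"] space_M)
  then have 1: "(\<integral>\<^sup>+x. \<integral>\<^sup>+y. indicator A (inv x \<otimes> y) \<partial>M \<partial>M) = ?\<mu> A * ?\<mu> (space M)" by simp
  have "(\<integral>\<^sup>+x. \<integral>\<^sup>+y. indicator A (inv x \<otimes> y) \<partial>M \<partial>M) = (\<integral>\<^sup>+y. \<integral>\<^sup>+x. indicator A (inv x \<otimes> y) \<partial>M \<partial>M)"
    by (rule Fubini'[symmetric]) measurable
  also have "\<dots> = (\<integral>\<^sup>+y. c \<partial>M)"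
  proof (rule nn_integral_cong)
    fix y assume "y \<in> space M"
    then have y: "y \<in> carrier G" by (simp add: space_M)
    note [measurable] = measurable_element[OF y]
    \<comment> \<open>Replacing \<open>x\<close> by \<open>y x\<close> cancels \<open>y\<close>, as
      \<open>(y x)^-1 y = x^-1\<close>: the inner integral is the constant \<open>c\<close>. The
      finite nonzero total mass can then be cancelled.\<close>
    have "(\<integral>\<^sup>+x. indicator A (inv x \<otimes> y) \<partial>M) = (\<integral>\<^sup>+x. indicator A (inv (y \<otimes> x) \<otimes> y) \<partial>M)"
      by (rule left[OF y, symmetric]) measurable
    also have "\<dots> = c" unfolding c_def
      by (rule nn_integral_cong) (use y in \<open>simp add: space_M inv_mult_group m_assoc\<close>)
    finally show "(\<integral>\<^sup>+x. indicator A (inv x \<otimes> y) \<partial>M) = c" .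
  qed
  finally have "?\<mu> A * ?\<mu> (space M) = c * ?\<mu> (space M)" using 1 by simp
  then have e: "?\<mu> (space M) * ?\<mu> A = ?\<mu> (space M) * c" by (simp add: mult.commute)
  note fin = emeasure_finite[of "space M", unfolded infinity_ennreal_def]
  have "?\<mu> A = c"
    by (rule antisym) (use e in \<open>simp_all flip: ennreal_mult_le_mult_iff[OF emeasure_pos fin]\<close>)
  also have "c = emeasure (distr M M (\<lambda>x. inv x)) A"
  proof -
    have "c = (\<integral>\<^sup>+x. indicator A x \<partial>distr M M (\<lambda>x. inv x))"
      unfolding c_def by (rule nn_integral_distr[symmetric]) auto
    then show ?thesis by simp
  qed
  finally show "emeasure (distr M M (\<lambda>x. inv x)) A = ?\<mu> A" by simp
qed simp

lemma distr_comp: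
  assumes "f \<in> measurable M M" "distr M M f = M" "g \<in> measurable M M" "distr M M g = M"
  shows "distr M M (\<lambda>x. f (g x)) = M"
  using distr_distr[OF assms(1,3)] assms(2,4) by (simp add: comp_def)

text \<open>Right translation is a composition of inversions and a left translation:
  \<open>x g = (g^-1 x^-1)^-1\<close>.\<close>

lemma distr_right:
  assumes g: "g \<in> carrier G" shows "distr M M (\<lambda>x. x \<otimes> g) = M"
proof -
  have ig: "inv g \<in> carrier G" using g by simp
  note [measurable] = measurable_element[OF ig] measurable_element[OF g]
  have "distr M M (\<lambda>x. inv g \<otimes> inv x) = M"
    by (rule distr_comp[OF _ distr_left[OF ig] _ distr_inv]) measurable
  then have "distr M M (\<lambda>x. inv (inv g \<otimes> inv x)) = M"
    by (intro distr_comp[where f = "\<lambda>x. inv x" and g = "\<lambda>x. inv g \<otimes> inv x"] distr_inv) measurable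
  moreover have "distr M M (\<lambda>x. inv (inv g \<otimes> inv x)) = distr M M (\<lambda>x. x \<otimes> g)"
    by (rule distr_cong) (use g in \<open>auto simp: space_M inv_mult_group\<close>)
  ultimately show ?thesis by simp
qed

lemma integral_invariant:
  fixes F :: "'a \<Rightarrow> complex"
  assumes "distr M M f = M" "f \<in> measurable M M" "F \<in> borel_measurable M"
  shows "(\<integral>x. F (f x) \<partial>M) = (\<integral>x. F x \<partial>M)"
  using integral_distr[OF assms(2,3)] assms(1) by simp

lemma integrable_invariant:
  fixes F :: "'a \<Rightarrow> 'c :: {banach, second_countable_topology}"
  assumes "distr M M f = M" "f \<in> measurable M M" "F \<in> borel_measurable M"
  shows "integrable M (\<lambda>x. F (f x)) \<longleftrightarrow> integrable M F"
  using integrable_distr_eq[OF assms(2,3)] assms(1) by simp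

lemma AE_invariant:
  assumes "distr M M f = M" "f \<in> measurable M M" "AE x in M. P x"
  shows "AE x in M. P (f x)"
proof -
  have "AE x in distr M M f. P x" unfolding assms(1) by (rule assms(3))
  then show ?thesis by (rule AE_distrD[OF assms(2)])
qed

text \<open>By compactness finitely many left translates of \<open>U\<close> cover the group. Were
  \<open>U\<close> null, so would be the whole group.\<close>

lemma open_measure_pos:
  assumes U: "openin T U" and ne: "\<one> \<in> U" shows "measure M U > 0"
proof -
  have UG: "U \<subseteq> carrier G" using open_sub[OF U] .
  have tr: "openin T ((\<lambda>x. g \<otimes> x) ` U)" if g: "g \<in> carrier G" for g
  proof -
    have "continuous_map T (prod_topology T T) (\<lambda>x. (inv g, x))"
      by (intro continuous_map_pairedI) (use g topspace_eq in auto)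
    then have c: "continuous_map T T (\<lambda>x. inv g \<otimes> x)"
      using continuous_map_compose[OF _ continuous_mult] by (fastforce simp: comp_def)
    have "(\<lambda>x. g \<otimes> x) ` U = {x \<in> topspace T. inv g \<otimes> x \<in> U}"
    proof (intro equalityI subsetI)
      fix x assume x: "x \<in> {x \<in> topspace T. inv g \<otimes> x \<in> U}"
      then have "x = g \<otimes> (inv g \<otimes> x)" using g by (simp add: topspace_eq m_assoc[symmetric])
      then show "x \<in> (\<lambda>x. g \<otimes> x) ` U" using x by blast
    qed (use g UG in \<open>auto simp: topspace_eq m_assoc[symmetric]\<close>)
    then show ?thesis using openin_continuous_map_preimage[OF c U] by simp
  qed
  let ?\<U> = "(\<lambda>g. (\<lambda>x. g \<otimes> x) ` U) ` carrier G"
  have "compactin T (carrier G)" using compact by (simp add: compact_space_def topspace_eq)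
  note cpt = this[unfolded compactin_def, THEN conjunct2, rule_format, of ?\<U>]
  have "carrier G \<subseteq> \<Union> ?\<U>"
  proof
    fix g assume g: "g \<in> carrier G"
    then have "g \<in> (\<lambda>x. g \<otimes> x) ` U" using imageI[OF ne, of "\<lambda>x. g \<otimes> x"] by simp
    then show "g \<in> \<Union> ?\<U>" using g by blast
  qed
  then obtain F where F: "finite F" "F \<subseteq> ?\<U>" "carrier G \<subseteq> \<Union> F"
    using cpt tr by auto
  show ?thesis
  proof (rule ccontr)
    assume "\<not> measure M U > 0"
    then have 0: "emeasure M U = 0"
      using measure_nonneg[of M U] by (simp add: emeasure_eq_measure)
    have "A \<in> null_sets M" if A: "A \<in> F" for A
    proof -
      obtain g where g: "g \<in> carrier G" "A = (\<lambda>x. g \<otimes> x) ` U" using A F by blast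
      have "emeasure M A = 0"
        using haar g open_sets[OF U] 0 by (simp add: haar_measure_def)
      then show ?thesis using open_sets[OF tr[OF g(1)]] g(2) by (simp add: null_sets_def)
    qed
    then have "\<Union> F \<in> null_sets M" using F(1) by (intro null_sets.finite_Union) auto
    then have "emeasure M (carrier G) = 0"
      using F(3) by (metis emeasure_eq_0 null_setsD1 null_setsD2)
    then show False using emeasure_pos by (simp add: space_M)
  qed
qed

text \<open>Neighbourhoods whose indicator functions are symmetric class functions.\<close>

definition central_nbhd :: "'a set \<Rightarrow> bool" where
  "central_nbhd U \<longleftrightarrow> openin T U \<and> \<one> \<in> U \<and> (\<forall>x\<in>U. inv x \<in> U) \<and>
     (\<forall>g\<in>carrier G. \<forall>x\<in>U. g \<otimes> x \<otimes> inv g \<in> U)"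

text \<open>Shrink \<open>N\<close> to a symmetric \<open>N'\<close> and remove all conjugates of
  its complement \<open>C\<close>. They form the image of a compact set under a continuous map,
  hence a closed set, and it misses the identity because \<open>C\<close> does.\<close>

lemma central_nbhd_exists:
  assumes N: "openin T N" "\<one> \<in> N" obtains U where "central_nbhd U" "U \<subseteq> N"
proof -
  define N' where "N' = N \<inter> {x \<in> topspace T. inv x \<in> N}"
  have N': "openin T N'" unfolding N'_def
    by (intro openin_Int N openin_continuous_map_preimage[OF continuous_inv])
  have N'G: "N' \<subseteq> carrier G" using open_sub[OF N'] .
  define C where "C = topspace T - N'"
  have C_inv: "inv c \<in> C" if "c \<in> C" for c
    using that by (auto simp: C_def N'_def topspace_eq)
  have "compactin T C" unfolding C_def by (intro closedin_compact_space compact closedin_diff N') auto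
  then have cp: "compactin (prod_topology T T) (topspace T \<times> C)"
    using compact by (auto simp: compactin_Times compact_space_def)
  define conj where "conj = (\<lambda>(g, c). g \<otimes> c \<otimes> inv g)"
  have "continuous_map (prod_topology T T) T conj"
  proof -
    note m = continuous_map_compose[OF continuous_map_pairedI continuous_mult, unfolded comp_def, simplified]
    have 1: "continuous_map (prod_topology T T) T (\<lambda>p. fst p \<otimes> snd p)"
      by (intro m continuous_map_fst continuous_map_snd)
    have 2: "continuous_map (prod_topology T T) T (\<lambda>p. inv (fst p))"
      using continuous_map_compose[OF continuous_map_fst continuous_inv] by (simp add: comp_def)
    show ?thesis unfolding conj_def case_prod_unfold by (rule m[OF 1 2])
  qed
  then have "compactin T (conj ` (topspace T \<times> C))" using cp by (rule image_compactin[rotated])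
  then have cl: "closedin T (conj ` (topspace T \<times> C))"
    by (rule compactin_imp_closedin[OF metrizable_imp_Hausdorff_space[OF metrisable]])
  define U where "U = topspace T - conj ` (topspace T \<times> C)"
  have CG: "C \<subseteq> carrier G" by (auto simp: C_def topspace_eq)
  have inU: "x \<in> U \<longleftrightarrow> x \<in> carrier G \<and> (\<forall>g\<in>carrier G. \<forall>c\<in>C. x \<noteq> g \<otimes> c \<otimes> inv g)" for x
    by (auto simp: U_def conj_def topspace_eq)
  have "central_nbhd U" unfolding central_nbhd_def
  proof (intro conjI ballI)
    show "openin T U" unfolding U_def by (intro openin_diff openin_topspace cl)
    show "\<one> \<in> U" unfolding inU
    proof (intro conjI ballI notI)
      fix g c assume g: "g \<in> carrier G" and c: "c \<in> C" and e: "\<one> = g \<otimes> c \<otimes> inv g"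
      have cG: "c \<in> carrier G" using c CG by blast
      have "c = inv g \<otimes> (g \<otimes> c \<otimes> inv g) \<otimes> g" using g cG by (simp add: m_assoc) (simp add: m_assoc[symmetric])
      then have "c = \<one>" using e g by (metis inv_closed l_inv r_one)
      then show False using c N by (simp add: C_def N'_def topspace_eq)
    qed simp
    fix x assume x: "x \<in> U"
    then have xG: "x \<in> carrier G" by (simp add: inU)
    show "inv x \<in> U" unfolding inU
    proof (intro conjI ballI notI)
      fix g c assume g: "g \<in> carrier G" and c: "c \<in> C" and e: "inv x = g \<otimes> c \<otimes> inv g"
      have cG: "c \<in> carrier G" using c CG by blast
      have "x = inv (g \<otimes> c \<otimes> inv g)" using e xG by (metis inv_inv)
      also have "\<dots> = g \<otimes> inv c \<otimes> inv g" using g cG by (simp add: inv_mult_group m_assoc)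
      finally show False using x g C_inv[OF c] by (auto simp: inU)
    qed (use xG in simp)
    fix h assume h: "h \<in> carrier G"
    show "h \<otimes> x \<otimes> inv h \<in> U" unfolding inU
    proof (intro conjI ballI notI)
      fix g c assume g: "g \<in> carrier G" and c: "c \<in> C" and e: "h \<otimes> x \<otimes> inv h = g \<otimes> c \<otimes> inv g"
      have cG: "c \<in> carrier G" using c CG by blast
      have "x = inv h \<otimes> (h \<otimes> x \<otimes> inv h) \<otimes> h"
        using h xG by (simp add: m_assoc) (simp add: m_assoc[symmetric])
      also have "\<dots> = (inv h \<otimes> g) \<otimes> c \<otimes> inv (inv h \<otimes> g)"
        unfolding e using h g cG by (simp add: inv_mult_group m_assoc)
      finally show False using x g h c by (auto simp: inU)
    qed (use h xG in simp)
  qed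
  moreover have "U \<subseteq> N"
  proof
    fix x assume x: "x \<in> U"
    then have xG: "x \<in> carrier G" by (simp add: inU)
    have "x \<notin> C" using x xG unfolding inU by (metis inv_one one_closed l_one r_one)
    then show "x \<in> N" using xG by (simp add: C_def N'_def topspace_eq)
  qed
  ultimately show ?thesis by (rule that)
qed

end

section \<open>The left regular representation and its convolution operators\<close>

context haar_group
begin

sublocale hilbert_space "L2 M" by (rule L2_hilbert_space)

abbreviation add' (infixl "\<oplus>" 65) where "x \<oplus> y \<equiv> vplus (L2 M) x y"
abbreviation sub' (infixl "\<ominus>" 65) where "x \<ominus> y \<equiv> vminus (L2 M) x y"
abbreviation scl' (infixr "\<odot>" 75) where "a \<odot> x \<equiv> vscale (L2 M) a x"
abbreviation L where "L \<equiv> left_regular G M"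

lemma translate_measurable:
  "g \<in> carrier G \<Longrightarrow> f \<in> borel_measurable M \<Longrightarrow> (\<lambda>x. f (inv g \<otimes> x)) \<in> borel_measurable M"
proof -
  assume g: "g \<in> carrier G" and [measurable]: "f \<in> borel_measurable M"
  note [measurable] = measurable_element[OF inv_closed[OF g]]
  show ?thesis by measurable
qed

lemma left_measurable: "g \<in> carrier G \<Longrightarrow> (\<lambda>x. g \<otimes> x) \<in> measurable M M"
  using measurable_element[of g M] by measurable

lemma square_integrable_translate:
  assumes g: "g \<in> carrier G" and f: "f \<in> square_integrable M"
  shows "(\<lambda>x. f (inv g \<otimes> x)) \<in> square_integrable M"
proof -
  have ig: "inv g \<in> carrier G" using g by simp
  note [measurable] = square_integrableD(1)[OF f]
  have "integrable M (\<lambda>x. (cmod (f (inv g \<otimes> x)))\<^sup>2) \<longleftrightarrow> integrable M (\<lambda>x. (cmod (f x))\<^sup>2)"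
    by (rule integrable_invariant[OF distr_left[OF ig] left_measurable[OF ig]]) measurable
  then show ?thesis
    using translate_measurable[OF g square_integrableD(1)[OF f]] square_integrableD(2)[OF f]
    by (simp add: square_integrable_def)
qed

lemma L_class:
  assumes g: "g \<in> carrier G" and f: "f \<in> square_integrable M"
  shows "L g (L2_class M f) = L2_class M (\<lambda>x. f (inv g \<otimes> x))"
  unfolding left_regular_def
  by (intro L2_class_cong AE_invariant[OF distr_left left_measurable L2_rep_class(2)[OF f]])
    (use g in auto)

lemma L_closed [simp, intro]: "g \<in> carrier G \<Longrightarrow> v \<in> V \<Longrightarrow> L g v \<in> V"
  by (auto elim!: L2_cases simp: L_class square_integrable_translate)

lemma L_add: "g \<in> carrier G \<Longrightarrow> u \<in> V \<Longrightarrow> v \<in> V \<Longrightarrow> L g (u \<oplus> v) = L g u \<oplus> L g v"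
  by (auto elim!: L2_cases simp: L_class L2_plus square_integrable_translate square_integrable_add)

lemma L_scl: "g \<in> carrier G \<Longrightarrow> v \<in> V \<Longrightarrow> L g (a \<odot> v) = a \<odot> L g v"
  by (auto elim!: L2_cases simp: L_class L2_scale square_integrable_translate square_integrable_scale)

lemma L_ip:
  assumes g: "g \<in> carrier G" and u: "u \<in> V" and v: "v \<in> V"
  shows "ip (L g u) (L g v) = ip u v"
proof -
  have ig: "inv g \<in> carrier G" using g by simp
  obtain f where f: "f \<in> square_integrable M" "u = L2_class M f" using u by (rule L2_cases)
  obtain h where h: "h \<in> square_integrable M" "v = L2_class M h" using v by (rule L2_cases)
  note [measurable] = square_integrableD(1)[OF f(1)] square_integrableD(1)[OF h(1)]
  have "(\<integral>x. cnj (f (inv g \<otimes> x)) * h (inv g \<otimes> x) \<partial>M) = (\<integral>x. cnj (f x) * h x \<partial>M)"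
    by (rule integral_invariant[OF distr_left[OF ig] left_measurable[OF ig]]) measurable
  then show ?thesis
    using g f h by (simp add: L_class L2_inner square_integrable_translate)
qed

lemma L_mult:
  assumes g: "g \<in> carrier G" and h: "h \<in> carrier G" and v: "v \<in> V"
  shows "L g (L h v) = L (g \<otimes> h) v"
proof -
  obtain f where f: "f \<in> square_integrable M" "v = L2_class M f" using v by (rule L2_cases)
  have "L2_class M (\<lambda>x. f (inv h \<otimes> (inv g \<otimes> x))) = L2_class M (\<lambda>x. f (inv (g \<otimes> h) \<otimes> x))"
    by (intro L2_class_cong AE_I2) (use g h in \<open>simp add: space_M inv_mult_group m_assoc\<close>)
  then show ?thesis using g h f by (simp add: L_class square_integrable_translate)
qed

lemma L_one: "v \<in> V \<Longrightarrow> L \<one> v = v"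
proof -
  assume "v \<in> V"
  then obtain f where f: "f \<in> square_integrable M" "v = L2_class M f" by (rule L2_cases)
  have "L2_class M (\<lambda>x. f (inv \<one> \<otimes> x)) = L2_class M f"
    by (intro L2_class_cong AE_I2) (simp add: space_M)
  then show ?thesis using f by (simp add: L_class)
qed

lemma L_adjoint:
  assumes g: "g \<in> carrier G" and u: "u \<in> V" and v: "v \<in> V"
  shows "ip (L g u) v = ip u (L (inv g) v)"
proof -
  have "ip u (L (inv g) v) = ip (L g u) (L g (L (inv g) v))"
    by (rule L_ip[symmetric]) (use g u v in auto)
  also have "L g (L (inv g) v) = v" using L_mult[of g "inv g" v] g v by (simp add: L_one)
  finally show ?thesis by simp
qed

text \<open>Justifies the exchange of integrals in \<open>K_weak\<close>. The product of two values
  is dominated by the sum of their squares, and by invariance the integral of the translated square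
  does not depend on \<open>g\<close>; so \<open>B\<close> is a uniform bound on a space of finite
  measure.\<close>

lemma coefficient_integrable:
  assumes f': "f' \<in> square_integrable M" and f: "f \<in> square_integrable M"
  shows "integrable (M \<Otimes>\<^sub>M M) (\<lambda>(g, x). cnj (f' x) * f (inv g \<otimes> x))"
proof (rule Fubini_integrable)
  note [measurable] = square_integrableD(1)[OF f] square_integrableD(1)[OF f']
  show "(\<lambda>(g, x). cnj (f' x) * f (inv g \<otimes> x)) \<in> borel_measurable (M \<Otimes>\<^sub>M M)" by measurable
  have int: "integrable M (\<lambda>x. cnj (f' x) * f (inv g \<otimes> x))" if "g \<in> carrier G" for g
    by (rule integrable_cnj_mult[OF f' square_integrable_translate[OF that f]])
  then show "AE g in M. integrable M (\<lambda>x. case (g, x) of (g, x) \<Rightarrow> cnj (f' x) * f (inv g \<otimes> x))"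
    by (intro AE_I2) (simp add: space_M)
  define B where "B = (\<integral>x. (cmod (f' x))\<^sup>2 \<partial>M) + (\<integral>x. (cmod (f x))\<^sup>2 \<partial>M)"
  have "(\<integral>x. norm (cnj (f' x) * f (inv g \<otimes> x)) \<partial>M) \<le> B" if g: "g \<in> carrier G" for g
  proof -
    have ig: "inv g \<in> carrier G" using g by simp
    note sq = square_integrable_translate[OF g f]
    have "(\<integral>x. norm (cnj (f' x) * f (inv g \<otimes> x)) \<partial>M)
        \<le> (\<integral>x. (cmod (f' x))\<^sup>2 + (cmod (f (inv g \<otimes> x)))\<^sup>2 \<partial>M)"
    proof (rule integral_mono)
      show "integrable M (\<lambda>x. norm (cnj (f' x) * f (inv g \<otimes> x)))" by (rule integrable_norm[OF int[OF g]])
      show "integrable M (\<lambda>x. (cmod (f' x))\<^sup>2 + (cmod (f (inv g \<otimes> x)))\<^sup>2)"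
        by (intro Bochner_Integration.integrable_add square_integrableD(2) f' sq)
      fix x
      show "norm (cnj (f' x) * f (inv g \<otimes> x)) \<le> (cmod (f' x))\<^sup>2 + (cmod (f (inv g \<otimes> x)))\<^sup>2"
      proof -
        have "0 \<le> cmod (f' x) * cmod (f (inv g \<otimes> x))" by simp
        then show ?thesis
          using zero_le_power2[of "cmod (f' x) - cmod (f (inv g \<otimes> x))"]
          unfolding power2_diff norm_mult complex_mod_cnj by linarith
      qed
    qed
    also have "\<dots> = (\<integral>x. (cmod (f' x))\<^sup>2 \<partial>M) + (\<integral>x. (cmod (f (inv g \<otimes> x)))\<^sup>2 \<partial>M)"
      by (rule Bochner_Integration.integral_add) (intro square_integrableD(2) f' sq)+
    also have "(\<integral>x. (cmod (f (inv g \<otimes> x)))\<^sup>2 \<partial>M) = (\<integral>x. (cmod (f x))\<^sup>2 \<partial>M)"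
      using L_ip[OF g L2_carrierI[OF f] L2_carrierI[OF f]] L2_norm_sq(2)[OF f] L2_norm_sq(2)[OF sq]
      by (simp add: L_class[OF g f])
    finally show ?thesis by (simp add: B_def)
  qed
  then show "integrable M (\<lambda>g. \<integral>x. norm (case (g, x) of (g, x) \<Rightarrow> cnj (f' x) * f (inv g \<otimes> x)) \<partial>M)"
    by (intro integrable_const_bound[where B = B] AE_I2) (auto simp: space_M)
qed

lemma coefficient:
  assumes "f' \<in> square_integrable M" "f \<in> square_integrable M" "g \<in> carrier G"
  shows "ip (L2_class M f') (L g (L2_class M f)) = (\<integral>x. cnj (f' x) * f (inv g \<otimes> x) \<partial>M)"
  using assms by (simp add: L_class L2_inner square_integrable_translate)

text \<open>Measurability and integrability of matrix coefficients in \<open>g\<close> are read off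
  from Fubini's theorem.\<close>

lemma ip_L_integrable:
  assumes u: "u \<in> V" and v: "v \<in> V" shows "integrable M (\<lambda>g. ip u (L g v))"
proof -
  obtain f' where f': "f' \<in> square_integrable M" "u = L2_class M f'" using u by (rule L2_cases)
  obtain f where f: "f \<in> square_integrable M" "v = L2_class M f" using v by (rule L2_cases)
  have "integrable M (\<lambda>g. \<integral>x. cnj (f' x) * f (inv g \<otimes> x) \<partial>M)"
    using integrable_fst'[OF coefficient_integrable[OF f'(1) f(1)]] by simp
  also have "?this \<longleftrightarrow> ?thesis"
    by (rule Bochner_Integration.integrable_cong[OF refl])
      (use f f' in \<open>simp add: coefficient space_M\<close>)
  finally show ?thesis .
qed

lemma ip_L_measurable [measurable]: "u \<in> V \<Longrightarrow> v \<in> V \<Longrightarrow> (\<lambda>g. ip u (L g v)) \<in> borel_measurable M"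
  by (rule borel_measurable_integrable[OF ip_L_integrable])

section \<open>Convolution operators\<close>

lemma integrable_weighted:
  fixes F :: "'a \<Rightarrow> complex"
  assumes "integrable M F" "U \<in> sets M" shows "integrable M (\<lambda>g. indicator U g * F g)"
proof (rule Bochner_Integration.integrable_bound[OF assms(1)])
  note [measurable] = assms(2) borel_measurable_integrable[OF assms(1)]
  show "(\<lambda>g. indicator U g * F g) \<in> borel_measurable M" by measurable
qed (simp add: norm_mult indicator_def)

text \<open>Written as an integral operator with bounded kernel, which is the form that shows it to
  be Hilbert--Schmidt. Its form as an average of translations is \<open>kern_eq\<close>.\<close>

definition kern :: "'a set \<Rightarrow> ('a \<Rightarrow> complex) \<Rightarrow> 'a \<Rightarrow> complex" where
  "kern U f x = (\<integral>y. indicator U (x \<otimes> inv y) * f y \<partial>M)"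

text \<open>Convolution from the left with the indicator function of \<open>U\<close>.\<close>

definition K :: "'a set \<Rightarrow> ('a \<Rightarrow> complex) set \<Rightarrow> ('a \<Rightarrow> complex) set" where
  "K U A = L2_class M (kern U (L2_rep A))"

context
  fixes U assumes U [measurable]: "U \<in> sets M"
begin

lemma one_square_integrable: "(\<lambda>_. 1) \<in> square_integrable M"
  by (simp add: square_integrable_def)

lemma square_integrable_integrable: "f \<in> square_integrable M \<Longrightarrow> integrable M f"
  using integrable_cnj_mult[OF one_square_integrable, of f] by simp

lemma kern_integrable:
  assumes f: "f \<in> square_integrable M" and x: "x \<in> carrier G"
  shows "integrable M (\<lambda>y. indicator U (x \<otimes> inv y) * f y)"
proof (rule Bochner_Integration.integrable_bound[OF square_integrable_integrable[OF f]])
  note [measurable] = square_integrableD(1)[OF f] measurable_element[OF x]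
  show "(\<lambda>y. indicator U (x \<otimes> inv y) * f y) \<in> borel_measurable M" by measurable
qed (auto simp: norm_mult indicator_def)

lemma kern_square_integrable:
  assumes f: "f \<in> square_integrable M" shows "kern U f \<in> square_integrable M"
proof (rule square_integrable_bound)
  note [measurable] = square_integrableD(1)[OF f]
  show "kern U f \<in> borel_measurable M" unfolding kern_def[abs_def] by measurable
  have "cmod (kern U f x) \<le> (\<integral>y. cmod (f y) \<partial>M)" if x: "x \<in> carrier G" for x
  proof -
    have "cmod (kern U f x) \<le> (\<integral>y. cmod (indicator U (x \<otimes> inv y) * f y) \<partial>M)"
      unfolding kern_def by (rule integral_norm_bound)
    also have "\<dots> \<le> (\<integral>y. cmod (f y) \<partial>M)"
      by (intro integral_mono integrable_norm kern_integrable f x square_integrable_integrable)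
        (auto simp: norm_mult indicator_def)
    finally show ?thesis .
  qed
  then show "AE x in M. (cmod (kern U f x))\<^sup>2 \<le> (\<integral>y. cmod (f y) \<partial>M)\<^sup>2"
    by (intro AE_I2 power_mono) (auto simp: space_M)
qed simp

lemma K_class:
  assumes f: "f \<in> square_integrable M" shows "K U (L2_class M f) = L2_class M (kern U f)"
  unfolding K_def
proof (intro L2_class_cong AE_I2)
  fix x assume "x \<in> space M"
  then have x: "x \<in> carrier G" by (simp add: space_M)
  note [measurable] = square_integrableD(1)[OF f] square_integrableD(1)[OF L2_rep_class(1)[OF f]]
    measurable_element[OF x]
  show "kern U (L2_rep (L2_class M f)) x = kern U f x" unfolding kern_def
    by (rule integral_cong_AE) (use L2_rep_class(2)[OF f] in auto)
qed

lemma K_closed [simp, intro]: "v \<in> V \<Longrightarrow> K U v \<in> V"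
  by (auto elim!: L2_cases simp: K_class kern_square_integrable)

text \<open>Substitute \<open>y = g^-1 x\<close>. This preserves the measure because it composes
  inversion with a right translation, so unimodularity enters here.\<close>

lemma kern_eq:
  assumes f: "f \<in> square_integrable M" and x: "x \<in> carrier G"
  shows "kern U f x = (\<integral>g. indicator U g * f (inv g \<otimes> x) \<partial>M)"
proof -
  note [measurable] = square_integrableD(1)[OF f] measurable_element[OF x]
  have d: "distr M M (\<lambda>g. inv g \<otimes> x) = M"
    by (rule distr_comp[where f = "\<lambda>y. y \<otimes> x", OF _ distr_right[OF x] _ distr_inv]) measurable
  have "(\<integral>g. indicator U (x \<otimes> inv (inv g \<otimes> x)) * f (inv g \<otimes> x) \<partial>M) = kern U f x"
    unfolding kern_def by (rule integral_invariant[OF d]) measurable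
  moreover have "(\<integral>g. indicator U (x \<otimes> inv (inv g \<otimes> x)) * f (inv g \<otimes> x) \<partial>M)
      = (\<integral>g. indicator U g * f (inv g \<otimes> x) \<partial>M)"
    by (rule Bochner_Integration.integral_cong)
      (use x in \<open>auto simp: space_M inv_mult_group m_assoc[symmetric]\<close>)
  ultimately show ?thesis by simp
qed

text \<open>\<open>K U\<close> is the weak integral of \<open>L g\<close> over \<open>U\<close>.
  Linearity, symmetry, commutation with translations and stability of invariant subspaces are all
  derived from this formula.\<close>

lemma K_weak:
  assumes u: "u \<in> V" and v: "v \<in> V"
  shows "ip u (K U v) = (\<integral>g. indicator U g * ip u (L g v) \<partial>M)"
proof -
  obtain f' where f': "f' \<in> square_integrable M" "u = L2_class M f'" using u by (rule L2_cases)
  obtain f where f: "f \<in> square_integrable M" "v = L2_class M f" using v by (rule L2_cases)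
  note [measurable] = square_integrableD(1)[OF f(1)] square_integrableD(1)[OF f'(1)]
  have int: "integrable (M \<Otimes>\<^sub>M M) (\<lambda>(g, x). indicator U g * (cnj (f' x) * f (inv g \<otimes> x)))"
    by (rule Bochner_Integration.integrable_bound[OF coefficient_integrable[OF f'(1) f(1)]])
      (auto simp: norm_mult indicator_def)
  have "ip u (K U v) = (\<integral>x. cnj (f' x) * kern U f x \<partial>M)"
    unfolding f(2) f'(2) K_class[OF f(1)] by (rule L2_inner[OF f'(1) kern_square_integrable[OF f(1)]])
  also have "\<dots> = (\<integral>x. \<integral>g. indicator U g * (cnj (f' x) * f (inv g \<otimes> x)) \<partial>M \<partial>M)"
  proof (rule Bochner_Integration.integral_cong[OF refl])
    fix x assume "x \<in> space M"
    then have x: "x \<in> carrier G" by (simp add: space_M)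
    have "cnj (f' x) * kern U f x = (\<integral>g. cnj (f' x) * (indicator U g * f (inv g \<otimes> x)) \<partial>M)"
      unfolding kern_eq[OF f(1) x] by (rule integral_mult_right_zero[symmetric])
    then show "cnj (f' x) * kern U f x = (\<integral>g. indicator U g * (cnj (f' x) * f (inv g \<otimes> x)) \<partial>M)"
      by (simp add: mult.left_commute)
  qed
  also have "\<dots> = (\<integral>g. \<integral>x. indicator U g * (cnj (f' x) * f (inv g \<otimes> x)) \<partial>M \<partial>M)"
    by (rule Fubini_integral[OF int])
  also have "\<dots> = (\<integral>g. indicator U g * ip u (L g v) \<partial>M)"
    by (rule Bochner_Integration.integral_cong[OF refl])
      (use f f' in \<open>simp add: space_M coefficient\<close>)
  finally show ?thesis .
qed

lemma weighted_integrable: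
  "u \<in> V \<Longrightarrow> v \<in> V \<Longrightarrow> integrable M (\<lambda>g. indicator U g * ip u (L g v))"
  by (intro integrable_weighted ip_L_integrable U)

lemma K_add:
  assumes u: "u \<in> V" and v: "v \<in> V" shows "K U (u \<oplus> v) = K U u \<oplus> K U v"
proof (rule ip_eqI)
  fix z assume z: "z \<in> V"
  have "ip z (K U (u \<oplus> v)) = (\<integral>g. indicator U g * ip z (L g u) + indicator U g * ip z (L g v) \<partial>M)"
    using u v z unfolding K_weak[OF z add_closed[OF u v]]
    by (intro Bochner_Integration.integral_cong refl) (simp add: space_M L_add distrib_left)
  also have "\<dots> = ip z (K U u) + ip z (K U v)"
    unfolding K_weak[OF z u] K_weak[OF z v]
    by (rule Bochner_Integration.integral_add[OF weighted_integrable[OF z u] weighted_integrable[OF z v]])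
  finally show "ip z (K U (u \<oplus> v)) = ip z (K U u \<oplus> K U v)" using u v z by simp
qed (use u v in auto)

lemma K_scl:
  assumes v: "v \<in> V" shows "K U (a \<odot> v) = a \<odot> K U v"
proof (rule ip_eqI)
  fix z assume z: "z \<in> V"
  have "ip z (K U (a \<odot> v)) = (\<integral>g. a * (indicator U g * ip z (L g v)) \<partial>M)"
    using v z unfolding K_weak[OF z scl_closed[OF v]]
    by (intro Bochner_Integration.integral_cong refl) (simp add: space_M L_scl mult.left_commute)
  also have "\<dots> = a * ip z (K U v)"
    unfolding K_weak[OF z v] by (rule integral_mult_right_zero)
  finally show "ip z (K U (a \<odot> v)) = ip z (a \<odot> K U v)" using v z by simp
qed (use v in auto)

text \<open>\<open>K U b\<close> evaluated at \<open>x\<close> is the Fourier coefficient at \<open>b\<close> of the function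
  \<open>y \<mapsto> 1\<^sub>U(x y\<^sup>-\<^sup>1)\<close>, so Bessel's inequality bounds the sum pointwise.\<close>

lemma K_HS:
  assumes B: "orthonormal B"
  shows "(\<Sum>b\<in>B. (nm (K U b))\<^sup>2) \<le> (measure M (space M))\<^sup>2"
proof -
  define r where "r b = L2_rep b" for b :: "('a \<Rightarrow> complex) set"
  have r: "r b \<in> square_integrable M" "L2_class M (r b) = b" if "b \<in> B" for b
    using L2_class_rep[OF orthonormalD(2)[OF B that]] by (auto simp: r_def)
  have nK: "(nm (K U b))\<^sup>2 = (\<integral>x. (cmod (kern U (r b) x))\<^sup>2 \<partial>M)" if b: "b \<in> B" for b
    using K_class[OF r(1)[OF b]] L2_norm_sq(1)[OF kern_square_integrable[OF r(1)[OF b]]]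
    by (simp add: r(2)[OF b])
  have int: "integrable M (\<lambda>x. (cmod (kern U (r b) x))\<^sup>2)" if "b \<in> B" for b
    by (rule square_integrableD(2)[OF kern_square_integrable[OF r(1)[OF that]]])
  have "(\<Sum>b\<in>B. (nm (K U b))\<^sup>2) = (\<integral>x. (\<Sum>b\<in>B. (cmod (kern U (r b) x))\<^sup>2) \<partial>M)"
    using int by (simp add: nK)
  also have "\<dots> \<le> (\<integral>x. measure M (space M) \<partial>M)"
  proof (rule integral_mono')
    fix x assume "x \<in> space M"
    then have x: "x \<in> carrier G" by (simp add: space_M)
    note [measurable] = measurable_element[OF x]
    define k :: "'a \<Rightarrow> complex" where "k y = indicator U (x \<otimes> inv y)" for y
    have [measurable]: "k \<in> borel_measurable M" unfolding k_def[abs_def] by measurable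
    have k1: "(cmod (k y))\<^sup>2 \<le> 1" for y by (simp add: k_def indicator_def)
    have ksq: "k \<in> square_integrable M"
      by (rule square_integrable_bound[of _ _ "\<lambda>_. 1"]) (use k1 in auto)
    have kV: "L2_class M k \<in> V" using ksq by auto
    have "kern U (r b) x = ip (L2_class M k) b" if b: "b \<in> B" for b
    proof -
      have "ip (L2_class M k) b = (\<integral>y. cnj (k y) * r b y \<partial>M)"
        using L2_inner[OF ksq r(1)[OF b]] by (simp add: r(2)[OF b])
      moreover have "cnj (k y) = k y" for y by (simp add: k_def indicator_def)
      ultimately show ?thesis by (simp add: kern_def k_def)
    qed
    then have "(\<Sum>b\<in>B. (cmod (kern U (r b) x))\<^sup>2) = (\<Sum>b\<in>B. (cmod (ip b (L2_class M k)))\<^sup>2)"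
      by (intro sum.cong refl) (metis B complex_mod_cnj inner_commute kV orthonormalD(2))
    also have "\<dots> \<le> (nm (L2_class M k))\<^sup>2" by (rule Bessel[OF B kV])
    also have "\<dots> = (\<integral>y. (cmod (k y))\<^sup>2 \<partial>M)" by (rule L2_norm_sq(1)[OF ksq])
    also have "\<dots> \<le> (\<integral>y. 1 \<partial>M)"
      by (rule integral_mono) (use square_integrableD(2)[OF ksq] k1 in auto)
    finally show "(\<Sum>b\<in>B. (cmod (kern U (r b) x))\<^sup>2) \<le> measure M (space M)" by simp
  qed auto
  also have "\<dots> = (measure M (space M))\<^sup>2" by (simp add: power2_eq_square)
  finally show ?thesis .
qed

text \<open>The component \<open>r\<close> of \<open>K U v\<close> orthogonal to \<open>S\<close> is
  orthogonal to every \<open>L g v\<close>, so the weak integral gives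
  \<open>ip r (K U v) = 0\<close> and thus \<open>r = 0\<close>.\<close>

lemma K_invariant_subspace:
  assumes S: "closed_subspace (L2 M) S" and inv: "\<And>g v. g \<in> carrier G \<Longrightarrow> v \<in> S \<Longrightarrow> L g v \<in> S"
    and v: "v \<in> S"
  shows "K U v \<in> S"
proof -
  have vV: "v \<in> V" using subspaceD(2)[OF closed_subspaceD(1)[OF S] v] .
  note p = orth_proj[OF S K_closed[OF vV]]
  define w where "w = orth_proj (L2 M) S (K U v)"
  have wV: "w \<in> V" using p(1) subspaceD(2)[OF closed_subspaceD(1)[OF S]] by (simp add: w_def)
  define r where "r = K U v \<ominus> w"
  have rV: "r \<in> V" using vV wV by (simp add: r_def)
  have orth: "ip r z = 0" if z: "z \<in> S" for z
    using p(2)[OF z] inner_commute[OF rV subspaceD(2)[OF closed_subspaceD(1)[OF S] z]]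
    by (simp add: r_def w_def)
  have "ip r (K U v) = (\<integral>g. 0 \<partial>M)"
    unfolding K_weak[OF rV vV]
    by (intro Bochner_Integration.integral_cong refl) (simp add: space_M orth inv v)
  then have "ip r r = 0" using orth[of w] p(1) rV vV wV by (simp add: r_def w_def)
  then have "K U v \<ominus> w = vzero (L2 M)" using inner_definite rV by (simp add: r_def)
  then have "K U v = w" using vV wV by simp
  then show ?thesis using p(1) by (simp add: w_def)
qed

text \<open>Pair \<open>K U v\<close> with \<open>v\<close>: the real part of the integrand is at
  least \<open>d\<close> on a set of positive measure.\<close>

lemma K_nonzero:
  assumes v: "v \<in> V" and d: "d > 0" "\<And>g. g \<in> U \<Longrightarrow> d \<le> Re (ip v (L g v))" and pos: "measure M U > 0"
  shows "K U v \<noteq> vzero (L2 M)"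
proof
  assume "K U v = vzero (L2 M)"
  then have "0 = Re (\<integral>g. indicator U g * ip v (L g v) \<partial>M)" using K_weak[OF v v] v by simp
  also have "\<dots> = (\<integral>g. Re (indicator U g * ip v (L g v)) \<partial>M)"
    by (rule integral_Re[symmetric, OF weighted_integrable[OF v v]])
  also have "\<dots> \<ge> (\<integral>g. indicator U g * d \<partial>M)"
  proof (rule integral_mono)
    show "integrable M (\<lambda>g. indicator U g * d)"
      by (intro integrable_mult_left integrable_real_indicator U) (simp add: less_top[symmetric])
    show "integrable M (\<lambda>g. Re (indicator U g * ip v (L g v)))"
      by (rule integrable_Re[OF weighted_integrable[OF v v]])
    show "indicator U g * d \<le> Re (indicator U g * ip v (L g v))" for g
      using d(2)[of g] by (cases "g \<in> U") auto
  qed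
  also have "(\<integral>g. indicator U g * d \<partial>M) = measure M U * d" by simp
  finally show False using mult_pos_pos[OF pos d(1)] by simp
qed

end

section \<open>Convolution with a central neighbourhood\<close>

context
  fixes U assumes U: "central_nbhd U"
begin

lemma central_sets [measurable]: "U \<in> sets M"
  using U open_sets by (simp add: central_nbhd_def)

lemma central_carrier: "U \<subseteq> carrier G"
  using U open_sub by (simp add: central_nbhd_def)

lemma central_inv: "x \<in> carrier G \<Longrightarrow> inv x \<in> U \<longleftrightarrow> x \<in> U"
  using U by (metis central_nbhd_def inv_inv)

lemma central_conj:
  assumes g: "g \<in> carrier G" and x: "x \<in> carrier G" shows "g \<otimes> x \<otimes> inv g \<in> U \<longleftrightarrow> x \<in> U"
proof
  assume "g \<otimes> x \<otimes> inv g \<in> U"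
  then have "inv g \<otimes> (g \<otimes> x \<otimes> inv g) \<otimes> inv (inv g) \<in> U" using U g unfolding central_nbhd_def by blast
  also have "inv g \<otimes> (g \<otimes> x \<otimes> inv g) \<otimes> inv (inv g) = x"
    using g x by (simp add: m_assoc) (simp add: m_assoc[symmetric])
  finally show "x \<in> U" .
qed (use U g in \<open>simp add: central_nbhd_def\<close>)

lemma central_integral_inv:
  fixes F :: "'a \<Rightarrow> complex"
  assumes F [measurable]: "F \<in> borel_measurable M"
  shows "(\<integral>g. indicator U g * F (inv g) \<partial>M) = (\<integral>g. indicator U g * F g \<partial>M)"
proof -
  have "(\<integral>g. indicator U (inv g) * F (inv g) \<partial>M) = (\<integral>g. indicator U g * F g \<partial>M)"
    by (rule integral_invariant[OF distr_inv]) measurable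
  moreover have "(\<integral>g. indicator U (inv g) * F (inv g) \<partial>M) = (\<integral>g. indicator U g * F (inv g) \<partial>M)"
    by (rule Bochner_Integration.integral_cong) (auto simp: space_M indicator_def central_inv)
  ultimately show ?thesis by simp
qed

text \<open>The adjoint of \<open>L g\<close> is \<open>L (inv g)\<close>, and inversion preserves
  both \<open>U\<close> and Haar measure.\<close>

lemma K_sym:
  assumes u: "u \<in> V" and v: "v \<in> V" shows "ip (K U u) v = ip u (K U v)"
proof -
  have "ip (K U u) v = cnj (ip v (K U u))" using inner_commute[of "K U u" v] u v central_sets by auto
  also have "\<dots> = (\<integral>g. cnj (indicator U g * ip v (L g u)) \<partial>M)"
    unfolding K_weak[OF central_sets v u] by (rule Bochner_Integration.integral_cnj[symmetric])
  also have "\<dots> = (\<integral>g. indicator U g * ip u (L (inv g) v) \<partial>M)"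
  proof (rule Bochner_Integration.integral_cong[OF refl])
    fix g assume "g \<in> space M"
    then have g: "g \<in> carrier G" by (simp add: space_M)
    have "cnj (ip v (L g u)) = ip (L g u) v" using inner_commute[of "L g u" v] g u v by simp
    then show "cnj (indicator U g * ip v (L g u)) = indicator U g * ip u (L (inv g) v)"
      using L_adjoint[OF g u v] by (simp add: indicator_def)
  qed
  also have "\<dots> = (\<integral>g. indicator U g * ip u (L g v) \<partial>M)"
    by (rule central_integral_inv[OF ip_L_measurable[OF u v]])
  also have "\<dots> = ip u (K U v)" by (rule K_weak[OF central_sets u v, symmetric])
  finally show ?thesis .
qed

text \<open>Conjugating by \<open>L h\<close> turns \<open>L g\<close> into the translation by
  \<open>h g h^-1\<close>. The substitution is absorbed since conjugation preserves \<open>U\<close>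
  and, by left and right invariance, Haar measure.\<close>

lemma K_commute:
  assumes h: "h \<in> carrier G" and v: "v \<in> V" shows "K U (L h v) = L h (K U v)"
proof (rule ip_eqI)
  note Us = central_sets
  have ih: "inv h \<in> carrier G" using h by simp
  fix u assume u: "u \<in> V"
  note [measurable] = measurable_element[OF h] measurable_element[OF ih]
    ip_L_measurable[OF u L_closed[OF h v]]
  have d: "distr M M (\<lambda>g. h \<otimes> g \<otimes> inv h) = M"
    by (rule distr_comp[where f = "\<lambda>y. y \<otimes> inv h", OF _ distr_right[OF ih] _ distr_left[OF h]]) measurable
  have "ip u (L h (K U v)) = ip (L (inv h) u) (K U v)"
    using L_adjoint[OF ih u, of "K U v"] h v Us by simp
  also have "\<dots> = (\<integral>g. indicator U g * ip (L (inv h) u) (L g v) \<partial>M)"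
    by (rule K_weak[OF Us]) (use h u v in auto)
  also have "\<dots> = (\<integral>g. indicator U (h \<otimes> g \<otimes> inv h) * ip u (L (h \<otimes> g \<otimes> inv h) (L h v)) \<partial>M)"
  proof (rule Bochner_Integration.integral_cong[OF refl])
    fix g assume "g \<in> space M"
    then have g: "g \<in> carrier G" by (simp add: space_M)
    have "ip (L (inv h) u) (L g v) = ip u (L h (L g v))" using L_adjoint[OF ih u] h g v by simp
    also have "L h (L g v) = L (h \<otimes> g \<otimes> inv h \<otimes> h) v" using h g v by (simp add: L_mult m_assoc)
    also have "\<dots> = L (h \<otimes> g \<otimes> inv h) (L h v)" using h g v by (simp add: L_mult)
    finally show "indicator U g * ip (L (inv h) u) (L g v)
        = indicator U (h \<otimes> g \<otimes> inv h) * ip u (L (h \<otimes> g \<otimes> inv h) (L h v))"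
      by (simp add: indicator_def central_conj[OF h g])
  qed
  also have "\<dots> = (\<integral>g. indicator U g * ip u (L g (L h v)) \<partial>M)"
    by (rule integral_invariant[OF d]) measurable
  also have "\<dots> = ip u (K U (L h v))" by (rule K_weak[OF Us u, symmetric]) (use h v in auto)
  finally show "ip u (K U (L h v)) = ip u (L h (K U v))" by simp
qed (use h v central_sets in auto)

definition eigen :: "real \<Rightarrow> ('a \<Rightarrow> complex) set set" where
  "eigen c = {v \<in> V. K U v = of_real c \<odot> v}"

lemma eigen_closed: "closed_subspace (L2 M) (eigen c)"
proof -
  have "eigen c = {v \<in> V. \<forall>z\<in>V. ip (K U z \<ominus> of_real c \<odot> z) v = 0}"
    unfolding eigen_def
  proof (intro Collect_cong conj_cong refl)
    fix v assume v: "v \<in> V"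
    have *: "ip (K U z \<ominus> of_real c \<odot> z) v = ip z (K U v) - ip z (of_real c \<odot> v)" if "z \<in> V" for z
      using that v K_sym[OF that v] K_closed[OF central_sets] by simp
    show "K U v = of_real c \<odot> v \<longleftrightarrow> (\<forall>z\<in>V. ip (K U z \<ominus> of_real c \<odot> z) v = 0)"
    proof
      assume "\<forall>z\<in>V. ip (K U z \<ominus> of_real c \<odot> z) v = 0"
      then show "K U v = of_real c \<odot> v"
        by (intro ip_eqI) (use * v K_closed[OF central_sets v] in simp_all)
    qed (use * in simp)
  qed
  then show ?thesis
    using closed_subspace_weak[of V "\<lambda>z. K U z \<ominus> of_real c \<odot> z"] central_sets by auto
qed

lemma eigen_L: "g \<in> carrier G \<Longrightarrow> v \<in> eigen c \<Longrightarrow> L g v \<in> eigen c"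
  by (simp add: eigen_def K_commute L_scl)

lemma eigen_orth:
  assumes "u \<in> eigen c" "v \<in> eigen d" "c \<noteq> d" shows "ip u v = 0"
  using K_sym[of u v] assms by (simp add: eigen_def)

text \<open>Each unit vector of the eigenspace contributes \<open>c^2\<close> to the
  Hilbert--Schmidt sum, which is bounded by the square of the total mass.\<close>

lemma eigen_fdim:
  assumes c: "c \<noteq> 0" shows "fdim (eigen c)"
proof -
  have "card B \<le> nat \<lceil>(measure M (space M))\<^sup>2 / c\<^sup>2\<rceil>" if B: "B \<subseteq> eigen c" "orthonormal B" for B
  proof -
    have "real (card B) * c\<^sup>2 = (\<Sum>b\<in>B. (nm (K U b))\<^sup>2)"
    proof -
      have "(nm (K U b))\<^sup>2 = c\<^sup>2" if b: "b \<in> B" for b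
        using b B orthonormalD(2,4)[OF B(2) b] by (auto simp: eigen_def power_mult_distrib)
      then show ?thesis by simp
    qed
    also have "\<dots> \<le> (measure M (space M))\<^sup>2" by (rule K_HS[OF central_sets B(2)])
    finally have "real (card B) \<le> (measure M (space M))\<^sup>2 / c\<^sup>2" using c by (simp add: field_simps)
    then show ?thesis by linarith
  qed
  then show ?thesis using closed_subspaceD(1)[OF eigen_closed] by (auto simp: fdim_def)
qed

end

end

section \<open>Isotypic components lie in eigenspaces of convolution operators\<close>

lemma (in inner_product_space) closedin_half_space:
  assumes w: "w \<in> V" shows "closedin (vtopology H) {y \<in> V. Re (ip w y) \<le> a}"
  unfolding closedin_seq
proof (intro conjI allI impI)
  fix s x assume *: "(\<forall>n. s n \<in> {y \<in> V. Re (ip w y) \<le> a}) \<and> x \<in> V \<and> conv s x"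
  then have "(\<lambda>n. Re (ip w (s n))) \<longlonglongrightarrow> Re (ip w x)"
    by (intro tendsto_Re conv_ip(1)) (use w in auto)
  then have "Re (ip w x) \<le> a" by (rule LIMSEQ_le_const2) (use * in auto)
  then show "x \<in> {y \<in> V. Re (ip w y) \<le> a}" using * by simp
qed auto

lemma unitary_repD:
  assumes "unitary_rep G T K \<rho>"
  shows "hilbert_space K"
    and "g \<in> carrier G \<Longrightarrow> v \<in> carrier K \<Longrightarrow> \<rho> g v \<in> carrier K"
    and "g \<in> carrier G \<Longrightarrow> inj_on (\<rho> g) (carrier K)"
    and "g \<in> carrier G \<Longrightarrow> h \<in> carrier G \<Longrightarrow> v \<in> carrier K \<Longrightarrow> \<rho> (g \<otimes>\<^bsub>G\<^esub> h) v = \<rho> g (\<rho> h v)"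
    and "v \<in> carrier K \<Longrightarrow> continuous_map T (vtopology K) (\<lambda>g. \<rho> g v)"
proof -
  show "\<rho> g v \<in> carrier K" if "g \<in> carrier G" "v \<in> carrier K"
  proof -
    have "bij_betw (\<rho> g) (carrier K) (carrier K)"
      using assms that by (auto simp: unitary_rep_def unitary_map_def)
    then show ?thesis using that(2) by (rule bij_betw_apply)
  qed
qed (use assms in \<open>auto simp: unitary_rep_def unitary_map_def bij_betw_def\<close>)

context haar_group
begin

text \<open>The operator of the identity element is idempotent by the homomorphism law and injective
  by unitarity.\<close>

lemma rep_one:
  assumes "unitary_rep G T K0 \<rho>" "v \<in> carrier K0" shows "\<rho> \<one> v = v"
proof (rule inj_onD[OF unitary_repD(3)[OF assms(1)]])
  show "\<rho> \<one> (\<rho> \<one> v) = \<rho> \<one> v" using unitary_repD(4)[OF assms(1), of \<one> \<one> v] assms(2) by simp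
qed (use unitary_repD(2)[OF assms(1)] assms(2) in auto)

text \<open>Linearity of \<open>\<Theta>\<close> is not required because isometric surjections are linear.\<close>

definition realizes ::
    "(nat \<Rightarrow> complex) inner_space \<Rightarrow> ('a \<Rightarrow> (nat \<Rightarrow> complex) \<Rightarrow> (nat \<Rightarrow> complex)) \<Rightarrow>
      ((nat \<Rightarrow> complex) \<Rightarrow> ('a \<Rightarrow> complex) set) \<Rightarrow> ('a \<Rightarrow> complex) set set \<Rightarrow> bool" where
  "realizes K0 \<rho> \<Theta> S \<longleftrightarrow> \<Theta> ` carrier K0 = S \<and>
     (\<forall>x\<in>carrier K0. \<forall>y\<in>carrier K0. ip (\<Theta> x) (\<Theta> y) = vinner K0 x y) \<and>
     (\<forall>g\<in>carrier G. \<forall>x\<in>carrier K0. \<Theta> (\<rho> g x) = L g (\<Theta> x))"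

text \<open>\<open>\<Theta>\<close> follows one equivalence into \<open>K1\<close> and the other one
  back. All copies \<open>S\<close> of a class are thereby compared with one fixed model
  \<open>K0\<close>, so that matrix coefficients can be computed there.\<close>

lemma realizes_exists:
  assumes S: "invariant_subspace G (L2 M) L S"
    and eq1: "unitarily_equivalent G (L2 M\<lparr>carrier := S\<rparr>, L) (K1, \<rho>1)"
    and eq2: "unitarily_equivalent G (K0, \<rho>) (K1, \<rho>1)"
    and rep: "unitary_rep G T K0 \<rho>"
  shows "\<exists>\<Theta>. realizes K0 \<rho> \<Theta> S"
proof -
  obtain U1 where U1: "bij_betw U1 S (carrier K1)"
    "\<And>x y. x \<in> S \<Longrightarrow> y \<in> S \<Longrightarrow> vinner K1 (U1 x) (U1 y) = ip x y"
    "\<And>g v. g \<in> carrier G \<Longrightarrow> v \<in> S \<Longrightarrow> U1 (L g v) = \<rho>1 g (U1 v)"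
    using eq1 by (auto simp: unitarily_equivalent_def unitary_map_def)
  obtain U2 where U2: "bij_betw U2 (carrier K0) (carrier K1)"
    "\<And>x y. x \<in> carrier K0 \<Longrightarrow> y \<in> carrier K0 \<Longrightarrow> vinner K1 (U2 x) (U2 y) = vinner K0 x y"
    "\<And>g v. g \<in> carrier G \<Longrightarrow> v \<in> carrier K0 \<Longrightarrow> U2 (\<rho> g v) = \<rho>1 g (U2 v)"
    using eq2 by (auto simp: unitarily_equivalent_def unitary_map_def)
  have LS: "L g v \<in> S" if "g \<in> carrier G" "v \<in> S" for g v
    using S that by (auto simp: invariant_subspace_def)
  define \<Theta> where "\<Theta> x = inv_into S U1 (U2 x)" for x
  have T: "\<Theta> x \<in> S" "U1 (\<Theta> x) = U2 x" if "x \<in> carrier K0" for x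
  proof -
    have "U2 x \<in> U1 ` S" using that U1(1) U2(1) by (auto simp: bij_betw_def)
    then show "\<Theta> x \<in> S" "U1 (\<Theta> x) = U2 x" by (auto simp: \<Theta>_def inv_into_into f_inv_into_f)
  qed
  have inj: "inj_on U1 S" using U1(1) by (simp add: bij_betw_def)
  have "realizes K0 \<rho> \<Theta> S" unfolding realizes_def
  proof (intro conjI ballI)
    show "\<Theta> ` carrier K0 = S"
    proof (intro equalityI subsetI)
      fix v assume v: "v \<in> S"
      then have "U1 v \<in> U2 ` carrier K0" using U1(1) U2(1) by (auto simp: bij_betw_def)
      then obtain x where x: "x \<in> carrier K0" "U1 v = U2 x" by blast
      have "v = \<Theta> x" by (rule inj_onD[OF inj]) (use x T v in auto)
      then show "v \<in> \<Theta> ` carrier K0" using x by blast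
    qed (use T in auto)
    show "ip (\<Theta> x) (\<Theta> y) = vinner K0 x y" if "x \<in> carrier K0" "y \<in> carrier K0" for x y
      using U1(2)[OF T(1)[OF that(1)] T(1)[OF that(2)]] U2(2)[OF that] T(2) that by simp
    show "\<Theta> (\<rho> g x) = L g (\<Theta> x)" if g: "g \<in> carrier G" and x: "x \<in> carrier K0" for g x
    proof (rule inj_onD[OF inj])
      have "\<rho> g x \<in> carrier K0" by (rule unitary_repD(2)[OF rep g x])
      then show "U1 (\<Theta> (\<rho> g x)) = U1 (L g (\<Theta> x))" "\<Theta> (\<rho> g x) \<in> S"
        using T U1(3)[OF g T(1)[OF x]] U2(3)[OF g x] x by auto
      show "L g (\<Theta> x) \<in> S" by (rule LS[OF g T(1)[OF x]])
    qed
  qed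
  then show ?thesis by blast
qed

text \<open>Schur's lemma: the eigenspace of the convolution operator provided by compactness is invariant,
  hence exhausts an irreducible subspace.\<close>

lemma irreducible_in_eigen:
  assumes irr: "irreducible_rep G T K0 \<rho>" and S: "invariant_subspace G (L2 M) L S"
    and \<Theta>: "realizes K0 \<rho> \<Theta> S" and U: "central_nbhd U"
    and w: "w \<in> carrier K0" and d: "d > 0" "\<And>g. g \<in> U \<Longrightarrow> d \<le> Re (vinner K0 w (\<rho> g w))"
  shows "\<exists>c. c \<noteq> 0 \<and> S \<subseteq> eigen U c \<and>
    of_real c * vinner K0 w w = (\<integral>g. indicator U g * vinner K0 w (\<rho> g w) \<partial>M)"
proof -
  note Us = central_sets[OF U]
  have rep: "unitary_rep G T K0 \<rho>" using irr by (simp add: irreducible_rep_def)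
  interpret k0: hilbert_space K0 by (rule unitary_repD(1)[OF rep])
  have cS: "closed_subspace (L2 M) S" using S by (simp add: invariant_subspace_def)
  have LS: "L g v \<in> S" if "g \<in> carrier G" "v \<in> S" for g v
    using S that by (auto simp: invariant_subspace_def)
  have SV: "v \<in> V" if "v \<in> S" for v using subspaceD(2)[OF closed_subspaceD(1)[OF cS] that] .
  have TS: "\<Theta> x \<in> S" if "x \<in> carrier K0" for x using \<Theta> that by (auto simp: realizes_def)
  have TV: "\<Theta> x \<in> V" if "x \<in> carrier K0" for x using SV TS that by blast
  have Tip: "ip (\<Theta> x) (\<Theta> y) = vinner K0 x y" if "x \<in> carrier K0" "y \<in> carrier K0" for x y
    using \<Theta> that by (auto simp: realizes_def)
  have TL: "\<Theta> (\<rho> g x) = L g (\<Theta> x)" if "g \<in> carrier G" "x \<in> carrier K0" for g x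
    using \<Theta> that by (auto simp: realizes_def)
  have Tsurj: "\<exists>x\<in>carrier K0. v = \<Theta> x" if "v \<in> S" for v using \<Theta> that by (auto simp: realizes_def)
  define v where "v = \<Theta> w"
  have v: "v \<in> S" "v \<in> V" using TS[OF w] TV[OF w] by (auto simp: v_def)
  have cf: "ip v (L g v) = vinner K0 w (\<rho> g w)" if g: "g \<in> carrier G" for g
    using Tip[OF w unitary_repD(2)[OF rep g w]] TL[OF g w] by (simp add: v_def)
  have pos: "measure M U > 0" using open_measure_pos U by (simp add: central_nbhd_def)
  have Kv: "K U v \<noteq> vzero (L2 M)"
    by (rule K_nonzero[OF Us v(2) d(1) _ pos]) (use d(2) cf central_carrier[OF U] in auto)
  have HS: "HS_operator (L2 M) S (K U) ((measure M (space M))\<^sup>2)"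
  proof unfold_locales
    show "K U x \<in> S" if "x \<in> S" for x by (rule K_invariant_subspace[OF Us cS LS that])
  qed (use cS K_add[OF Us] K_scl[OF Us] K_sym[OF U] K_HS[OF Us] SV in auto)
  have ne: "S \<noteq> {vzero (L2 M)}"
    using v(1) Kv K_scl[OF Us zero_closed, of 0] K_closed[OF Us zero_closed] by auto
  obtain e c where e: "e \<in> S" "e \<noteq> vzero (L2 M)" "K U e = of_real c \<odot> e"
    and c0: "c = 0 \<longrightarrow> (\<forall>x\<in>S. K U x = vzero (L2 M))"
    using HS_operator.HS_eigenvector[OF HS ne] by blast
  have c: "c \<noteq> 0" using c0 Kv v(1) by blast
  \<comment> \<open>Irreducibility is given for \<open>K0\<close>, so the eigenspace is pulled back
    along \<open>\<Theta>\<close> to a closed invariant subspace of \<open>K0\<close>. Its being a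
    subspace rests on the linearity of \<open>\<Theta>\<close>, derived next.\<close>
  define X where "X = {x \<in> carrier K0. \<Theta> x \<in> eigen U c}"
  note eigS = closed_subspaceD[OF eigen_closed[OF U, of c]]
  have T_eq: "u = z" if "u \<in> S" "z \<in> S" "\<And>y. y \<in> carrier K0 \<Longrightarrow> ip (\<Theta> y) u = ip (\<Theta> y) z" for u z
  proof -
    have "u \<ominus> z \<in> S" by (rule subspaceD(6)[OF closed_subspaceD(1)[OF cS] that(1,2)])
    then obtain y where "y \<in> carrier K0" "u \<ominus> z = \<Theta> y" using Tsurj by blast
    then have "ip (u \<ominus> z) u = ip (u \<ominus> z) z" using that(3) by simp
    then have "ip (u \<ominus> z) (u \<ominus> z) = 0" using SV that(1,2) by simp
    then have "u \<ominus> z = vzero (L2 M)" using inner_definite SV that(1,2) by blast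
    then show ?thesis using SV that(1,2) by simp
  qed
  have T_add: "\<Theta> (vplus K0 x y) = \<Theta> x \<oplus> \<Theta> y" if "x \<in> carrier K0" "y \<in> carrier K0" for x y
    by (rule T_eq) (use that TS TV Tip subspaceD(4)[OF closed_subspaceD(1)[OF cS]] in auto)
  have T_scl: "\<Theta> (vscale K0 a x) = a \<odot> \<Theta> x" if "x \<in> carrier K0" for a x
    by (rule T_eq) (use that TS TV Tip subspaceD(5)[OF closed_subspaceD(1)[OF cS]] in auto)
  have T0: "\<Theta> (vzero K0) = vzero (L2 M)"
    using T_scl[of "vzero K0" 0] TV[of "vzero K0"] by simp
  have T_sub: "\<Theta> (vminus K0 x y) = \<Theta> x \<ominus> \<Theta> y" if "x \<in> carrier K0" "y \<in> carrier K0" for x y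
    using that by (simp add: vminus_def T_add T_scl)
  have T_nm: "nm (\<Theta> x) = vnorm K0 x" if "x \<in> carrier K0" for x
    using Tip[OF that that] by (simp add: vnorm_def)
  have "closed_subspace K0 X" unfolding closed_subspace_def k0.closedin_seq
  proof (intro conjI allI impI)
    show "linear_subspace K0 X"
      using subspaceD(3-5)[OF eigS(1)] by (auto simp: linear_subspace_def X_def T_add T_scl T0)
    fix s x assume *: "(\<forall>n. s n \<in> X) \<and> x \<in> carrier K0 \<and> k0.conv s x"
    have "conv (\<lambda>n. \<Theta> (s n)) (\<Theta> x)"
      using * T_sub[symmetric] T_nm unfolding conv_def k0.conv_def by (simp add: X_def)
    moreover have "\<Theta> (s n) \<in> eigen U c" for n using * by (simp add: X_def)
    ultimately have "\<Theta> x \<in> eigen U c" using eigS(2)[of "\<lambda>n. \<Theta> (s n)"] TV * by blast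
    then show "x \<in> X" using * by (simp add: X_def)
  qed (auto simp: X_def)
  then have "invariant_subspace G K0 \<rho> X"
    using unitary_repD(2)[OF rep] TL eigen_L[OF U]
    by (auto simp: invariant_subspace_def X_def)
  then have X: "X = {vzero K0} \<or> X = carrier K0" using irr by (simp add: irreducible_rep_def)
  obtain x0 where x0: "x0 \<in> carrier K0" "e = \<Theta> x0" using Tsurj e by blast
  have "x0 \<in> X" using x0 e SV[OF e(1)] by (simp add: X_def eigen_def[OF U])
  moreover have "x0 \<noteq> vzero K0" using x0 e T0 by auto
  ultimately have "X = carrier K0" using X by auto
  then have Seig: "S \<subseteq> eigen U c" using Tsurj by (auto simp: X_def)
  \<comment> \<open>Evaluating \<open>K U v = c v\<close> at \<open>v\<close> expresses
    \<open>c\<close> through \<open>K0\<close>, \<open>w\<close> and \<open>U\<close> alone: any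
    other copy of the representation has the same eigenvalue.\<close>
  have "of_real c * vinner K0 w w = of_real c * ip v v" using Tip[OF w w] by (simp add: v_def)
  also have "\<dots> = ip v (K U v)" using Seig v by (auto simp: eigen_def[OF U])
  also have "\<dots> = (\<integral>g. indicator U g * vinner K0 w (\<rho> g w) \<partial>M)"
    unfolding K_weak[OF Us v(2) v(2)]
    by (rule Bochner_Integration.integral_cong) (auto simp: space_M cf)
  finally show ?thesis using c Seig by blast
qed

text \<open>Fix one model \<open>K0\<close> of the class and one nonzero vector \<open>w\<close>.
  Near the identity the coefficient \<open>vinner K0 w (\<rho> g w)\<close> stays close to the
  squared norm of \<open>w\<close>; \<open>N\<close> is where its real part exceeds half of that.
  For \<open>U\<close> inside \<open>N\<close> every copy yields the same nonzero eigenvalue, and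
  eigenspaces are closed, so they contain the closed span of the copies.\<close>

lemma isotypic_in_eigen:
  assumes \<alpha>: "\<alpha> \<in> dual G T"
  shows "\<exists>N. openin T N \<and> \<one> \<in> N \<and> (\<forall>U. central_nbhd U \<longrightarrow> U \<subseteq> N \<longrightarrow>
    (\<exists>c. c \<noteq> 0 \<and> isotypic G (L2 M) L \<alpha> \<subseteq> eigen U c))"
proof -
  let ?R = "{(r, s). r \<in> irreps G T \<and> s \<in> irreps G T \<and> unitarily_equivalent G r s}"
  obtain r0 where r0: "r0 \<in> irreps G T" "\<alpha> = ?R `` {r0}"
    using \<alpha> unfolding dual_def by (auto elim!: quotientE)
  obtain K0 \<rho> where r0': "r0 = (K0, \<rho>)" by (cases r0)
  have irr: "irreducible_rep G T K0 \<rho>" using r0 r0' by (simp add: irreps_def)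
  have rep: "unitary_rep G T K0 \<rho>" using irr by (simp add: irreducible_rep_def)
  interpret k0: hilbert_space K0 by (rule unitary_repD(1)[OF rep])
  have "carrier K0 \<noteq> {vzero K0}" using irr by (simp add: irreducible_rep_def)
  then obtain w where w: "w \<in> carrier K0" "w \<noteq> vzero K0" using k0.zero_closed by blast
  define d where "d = Re (vinner K0 w w) / 2"
  have d: "d > 0"
    using w k0.nm_sq[OF w(1)] k0.nm_eq_0[OF w(1)] zero_less_power2[of "vnorm K0 w"]
    unfolding d_def by linarith
  define N where "N = topspace T - {g \<in> topspace T. \<rho> g w \<in> {y \<in> carrier K0. Re (vinner K0 w y) \<le> d}}"
  have oN: "openin T N" unfolding N_def
    by (intro openin_diff openin_topspace
        closedin_continuous_map_preimage[OF unitary_repD(5)[OF rep w(1)] k0.closedin_half_space[OF w(1)]])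
  have oneN: "\<one> \<in> N" using rep_one[OF rep w(1)] d w by (simp add: N_def topspace_eq d_def)
  have "\<exists>c. c \<noteq> 0 \<and> isotypic G (L2 M) L \<alpha> \<subseteq> eigen U c" if U: "central_nbhd U" and UN: "U \<subseteq> N" for U
  proof -
    have dU: "d \<le> Re (vinner K0 w (\<rho> g w))" if "g \<in> U" for g
      using that UN unitary_repD(2)[OF rep _ w(1), of g] by (auto simp: N_def topspace_eq)
    define \<S> where "\<S> = {S. invariant_subspace G (L2 M) L S \<and>
      (\<exists>r\<in>\<alpha>. unitarily_equivalent G (L2 M\<lparr>carrier := S\<rparr>, L) r)}"
    have ex: "\<exists>c. c \<noteq> 0 \<and> S \<subseteq> eigen U c \<and>
        of_real c * vinner K0 w w = (\<integral>g. indicator U g * vinner K0 w (\<rho> g w) \<partial>M)" if S: "S \<in> \<S>" for S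
    proof -
      have inv: "invariant_subspace G (L2 M) L S" using S by (simp add: \<S>_def)
      obtain r where r: "r \<in> \<alpha>" "unitarily_equivalent G (L2 M\<lparr>carrier := S\<rparr>, L) r"
        using S by (auto simp: \<S>_def)
      obtain K1 \<rho>1 where r': "r = (K1, \<rho>1)" by (cases r)
      have "unitarily_equivalent G (K0, \<rho>) (K1, \<rho>1)" using r(1) r' r0 r0' by auto
      then obtain \<Theta> where "realizes K0 \<rho> \<Theta> S"
        using realizes_exists[OF inv _ _ rep] r(2) r' by blast
      then show ?thesis by (rule irreducible_in_eigen[OF irr inv _ U w(1) d dU])
    qed
    have ww: "vinner K0 w w \<noteq> 0" using d by (auto simp: d_def)
    have "\<exists>c. c \<noteq> 0 \<and> (\<forall>S\<in>\<S>. S \<subseteq> eigen U c)"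
    proof (cases "\<S> = {}")
      \<comment> \<open>If no subspace carries the class, its isotypic part is trivial and any
        nonzero number serves.\<close>
      case True then show ?thesis by (intro exI[of _ 1]) auto
    next
      case False
      then obtain S0 where "S0 \<in> \<S>" by blast
      from ex[OF this] obtain c where c: "c \<noteq> 0"
        "of_real c * vinner K0 w w = (\<integral>g. indicator U g * vinner K0 w (\<rho> g w) \<partial>M)" by blast
      have "S \<subseteq> eigen U c" if S: "S \<in> \<S>" for S
      proof -
        obtain c' where c': "S \<subseteq> eigen U c'"
          "of_real c' * vinner K0 w w = (\<integral>g. indicator U g * vinner K0 w (\<rho> g w) \<partial>M)" using ex[OF S] by blast
        have "c' = c" using c(2) c'(2) ww by (metis mult_cancel_right of_real_eq_iff)
        then show ?thesis using c' by simp
      qed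
      then show ?thesis using c by blast
    qed
    then obtain c where c: "c \<noteq> 0" "\<And>S. S \<in> \<S> \<Longrightarrow> S \<subseteq> eigen U c" by blast
    have "isotypic G (L2 M) L \<alpha> = closed_span (L2 M) (\<Union>\<S>)" by (simp add: isotypic_def \<S>_def)
    also have "\<dots> \<subseteq> eigen U c"
      by (rule closed_span_minimal[OF eigen_closed[OF U]]) (use c in blast)
    finally show ?thesis using c by blast
  qed
  then show ?thesis using oN oneN by blast
qed

text \<open>Eigenspaces for different eigenvalues are orthogonal, so their orthonormal bases unite
  to an orthonormal system that expands the whole span.\<close>

lemma eigen_span_fdim:
  assumes U: "central_nbhd U" and C: "finite C" "0 \<notin> C"
  shows "fdim (lin_span (\<Union>c\<in>C. eigen U c))"
proof -
  have "\<exists>B. B \<subseteq> eigen U c \<and> orthonormal B \<and> (\<forall>x\<in>eigen U c. fourier B x = x)" if "c \<in> C" for c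
    using fdim_basis[OF eigen_fdim[OF U, of c]] that C by metis
  then obtain B where B: "\<And>c. c \<in> C \<Longrightarrow> B c \<subseteq> eigen U c" "\<And>c. c \<in> C \<Longrightarrow> orthonormal (B c)"
    "\<And>c x. c \<in> C \<Longrightarrow> x \<in> eigen U c \<Longrightarrow> fourier (B c) x = x" by metis
  let ?B = "\<Union>c\<in>C. B c"
  have eV: "x \<in> V" if "x \<in> eigen U c" for x c using that by (simp add: eigen_def[OF U])
  have on: "orthonormal ?B"
    unfolding orthonormal_def
  proof (intro conjI ballI)
    show "finite ?B" using C(1) orthonormalD(1)[OF B(2)] by auto
    show "?B \<subseteq> V" using orthonormalD(2)[OF B(2)] by auto
    fix x y assume "x \<in> ?B" "y \<in> ?B"
    then obtain c c' where c: "c \<in> C" "x \<in> B c" "c' \<in> C" "y \<in> B c'" by blast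
    show "ip x y = (if x = y then 1 else 0)"
    proof (cases "c = c'")
      case True
      then show ?thesis using orthonormalD(3,5)[OF B(2)[OF c(1)]] c by auto
    next
      case False
      then have "ip x y = 0" using eigen_orth[OF U] B(1) c by blast
      moreover from this have "x \<noteq> y" using orthonormalD(3)[OF B(2)[OF c(1)] c(2)] by auto
      ultimately show ?thesis by simp
    qed
  qed
  have sub: "eigen U c \<subseteq> {x \<in> V. fourier ?B x = x}" if c: "c \<in> C" for c
  proof (intro subsetI CollectI conjI)
    fix x assume x: "x \<in> eigen U c"
    then show xV: "x \<in> V" by (rule eV)
    show "fourier ?B x = x"
    proof (rule ip_eqI)
      fix z assume z: "z \<in> V"
      have "ip z (fourier ?B x) = (\<Sum>b\<in>?B. ip b x * ip z b)" by (rule ip_fourier_right[OF on xV z])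
      also have "\<dots> = (\<Sum>b\<in>B c. ip b x * ip z b)"
      proof (rule sum.mono_neutral_right)
        show "finite ?B" by (rule orthonormalD(1)[OF on])
        show "\<forall>b\<in>?B - B c. ip b x * ip z b = 0"
        proof
          fix b assume b: "b \<in> ?B - B c"
          then obtain c' where c': "c' \<in> C" "b \<in> B c'" "c' \<noteq> c" by blast
          then have "ip b x = 0" using eigen_orth[OF U _ x] B(1) by blast
          then show "ip b x * ip z b = 0" by simp
        qed
      qed (use c in auto)
      also have "\<dots> = ip z (fourier (B c) x)" by (rule ip_fourier_right[OF B(2)[OF c] xV z, symmetric])
      finally show "ip z (fourier ?B x) = ip z x" using B(3)[OF c x] by simp
    qed (use xV on in auto)
  qed
  have lin: "linear_subspace (L2 M) {x \<in> V. fourier ?B x = x}"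
    by (rule closed_subspaceD(1)[OF closed_subspace_fourier[OF on]])
  have "fdim {x \<in> V. fourier ?B x = x}" by (rule fdimI[OF lin on]) simp
  moreover have "linear_subspace (L2 M) (lin_span (\<Union>c\<in>C. eigen U c))"
    by (rule linear_subspace_lin_span) (use eV in auto)
  moreover have "lin_span (\<Union>c\<in>C. eigen U c) \<subseteq> {x \<in> V. fourier ?B x = x}"
    by (rule lin_span_minimal[OF lin UN_least[OF sub]])
  ultimately show ?thesis by (rule fdim_subset)
qed

text \<open>Each class restricts \<open>U\<close> to a neighbourhood of the identity; finitely many
  restrictions can be met by one \<open>U\<close>. The algebraic span of the eigenspaces is
  finite-dimensional, hence closed, and so absorbs the closed span.\<close>

lemma finite_isotypic_span:
  assumes \<Delta>: "finite \<Delta>" "\<Delta> \<subseteq> dual G T"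
  obtains U C where "central_nbhd U" "finite C" "0 \<notin> C"
    "closed_span (L2 M) (\<Union>\<alpha>\<in>\<Delta>. isotypic G (L2 M) L \<alpha>) \<subseteq> lin_span (\<Union>c\<in>C. eigen U c)"
proof -
  have "\<forall>\<alpha>\<in>\<Delta>. \<exists>N. openin T N \<and> \<one> \<in> N \<and> (\<forall>U. central_nbhd U \<longrightarrow> U \<subseteq> N \<longrightarrow>
      (\<exists>c. c \<noteq> 0 \<and> isotypic G (L2 M) L \<alpha> \<subseteq> eigen U c))"
    using isotypic_in_eigen \<Delta>(2) by blast
  then obtain N where N: "\<And>\<alpha>. \<alpha> \<in> \<Delta> \<Longrightarrow> openin T (N \<alpha>)" "\<And>\<alpha>. \<alpha> \<in> \<Delta> \<Longrightarrow> \<one> \<in> N \<alpha>"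
    "\<And>\<alpha> U. \<alpha> \<in> \<Delta> \<Longrightarrow> central_nbhd U \<Longrightarrow> U \<subseteq> N \<alpha> \<Longrightarrow>
      \<exists>c. c \<noteq> 0 \<and> isotypic G (L2 M) L \<alpha> \<subseteq> eigen U c"
    unfolding bchoice_iff by blast
  \<comment> \<open>Intersecting with the whole space covers the case of empty
    \<open>\<Delta>\<close>.\<close>
  have "openin T (topspace T \<inter> \<Inter> (N ` \<Delta>))"
    using openin_INT[OF \<Delta>(1) N(1)] by (simp add: Int_commute)
  then obtain U where U: "central_nbhd U" "U \<subseteq> topspace T \<inter> \<Inter> (N ` \<Delta>)"
    by (rule central_nbhd_exists) (use N(2) in \<open>auto simp: topspace_eq\<close>)
  have "\<forall>\<alpha>\<in>\<Delta>. \<exists>c. c \<noteq> 0 \<and> isotypic G (L2 M) L \<alpha> \<subseteq> eigen U c" using N(3) U by blast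
  then obtain c where c: "\<And>\<alpha>. \<alpha> \<in> \<Delta> \<Longrightarrow> c \<alpha> \<noteq> 0" "\<And>\<alpha>. \<alpha> \<in> \<Delta> \<Longrightarrow> isotypic G (L2 M) L \<alpha> \<subseteq> eigen U (c \<alpha>)"
    unfolding bchoice_iff by blast
  let ?E = "lin_span (\<Union>c\<in>c ` \<Delta>. eigen U c)"
  have C: "finite (c ` \<Delta>)" "0 \<notin> c ` \<Delta>" using \<Delta>(1) c(1) by auto
  have "(\<Union>\<alpha>\<in>\<Delta>. isotypic G (L2 M) L \<alpha>) \<subseteq> ?E"
    using c(2) lin_span_superset[of "\<Union>c\<in>c ` \<Delta>. eigen U c"] by blast
  then have "closed_span (L2 M) (\<Union>\<alpha>\<in>\<Delta>. isotypic G (L2 M) L \<alpha>) \<subseteq> ?E"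
    by (rule closed_span_minimal[OF fdim_closed[OF eigen_span_fdim[OF U(1) C]]])
  then show ?thesis using that U(1) C by blast
qed

lemma isotypic_V: "isotypic G (L2 M) L \<alpha> \<subseteq> V"
  unfolding isotypic_def
  by (rule closed_span_minimal[OF closed_subspace_V])
    (auto simp: invariant_subspace_def closed_subspace_def linear_subspace_def)

end

section \<open>Invariant forms\<close>

locale invariant_form = haar_group +
  fixes D Q
  assumes herm: "hermitian_form (L2 M) D Q"
    and finite_isotypic: "\<And>x. x \<in> D \<Longrightarrow> \<exists>\<Delta>\<subseteq>dual G T. finite \<Delta> \<and> isotypic_proj G M \<Delta> x = x"
    and L_D: "\<And>g x. g \<in> carrier G \<Longrightarrow> x \<in> D \<Longrightarrow> left_regular G M g x \<in> D"
    and Q_L: "\<And>g x. g \<in> carrier G \<Longrightarrow> x \<in> D \<Longrightarrow>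
      Q (left_regular G M g x) (left_regular G M g x) = Q x x"
begin

sublocale form_domain "L2 M" D Q by unfold_locales (rule herm)

text \<open>Polarisation: invariance at \<open>x + y\<close> gives the sum
  \<open>Q x y + Q y x\<close>, invariance at \<open>x + \<i> y\<close> the difference.\<close>

lemma Q_L_polar:
  assumes g: "g \<in> carrier G" and x: "x \<in> D" and y: "y \<in> D"
  shows "Q (L g x) (L g y) = Q x y"
proof -
  have sym: "Q (L g x) (L g z) + Q (L g z) (L g x) = Q x z + Q z x" if z: "z \<in> D" for z
  proof -
    have xz: "x \<oplus> z \<in> D" by (rule subspaceD(4)[OF D_lin x z])
    have exp: "Q (u \<oplus> v) (u \<oplus> v) = Q u u + (Q u v + Q v u) + Q v v" if "u \<in> D" "v \<in> D" for u v
      using Q_rules(1)[OF _ that(1) that(2)] Q_rules(3)[OF that] that subspaceD(4)[OF D_lin that] by simp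
    have "Q (L g (x \<oplus> z)) (L g (x \<oplus> z)) = Q (x \<oplus> z) (x \<oplus> z)" by (rule Q_L[OF g xz])
    then show ?thesis
      using exp[OF x z] exp[OF L_D[OF g x] L_D[OF g z]] Q_L[OF g x] Q_L[OF g z]
      by (simp add: L_add[OF g D_V[OF x] D_V[OF z]])
  qed
  have iy: "\<i> \<odot> y \<in> D" by (rule subspaceD(5)[OF D_lin y])
  have "\<i> * Q (L g x) (L g y) - \<i> * Q (L g y) (L g x) = \<i> * Q x y - \<i> * Q y x"
    using sym[OF iy] Q_rules(2,4)[OF L_D[OF g x] L_D[OF g y]] Q_rules(4)[OF L_D[OF g y] L_D[OF g x]]
      Q_rules(2)[OF x y] Q_rules(4)[OF y x] by (simp add: L_scl[OF g D_V[OF y]])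
  then have *: "Q (L g x) (L g y) - Q (L g y) (L g x) = Q x y - Q y x"
    by (simp flip: right_diff_distrib)
  have "(Q (L g x) (L g y) + Q (L g y) (L g x)) + (Q (L g x) (L g y) - Q (L g y) (L g x))
      = (Q x y + Q y x) + (Q x y - Q y x)"
    unfolding sym[OF y] * ..
  then show ?thesis by simp
qed

text \<open>\<open>F\<close> is the part of \<open>D\<close> inside a finite span of eigenspaces
  with nonzero eigenvalues; intersecting with \<open>D\<close> keeps it invariant. A vector of
  \<open>F\<close> killed by \<open>K U\<close> is orthogonal to all these eigenspaces, hence to
  itself.\<close>

lemma D_fdim:
  assumes x: "x \<in> D"
  obtains U F where "central_nbhd U" "fdim F" "F \<subseteq> D" "x \<in> F"
    "\<And>g v. g \<in> carrier G \<Longrightarrow> v \<in> F \<Longrightarrow> L g v \<in> F"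
    "\<And>v. v \<in> F \<Longrightarrow> K U v = vzero (L2 M) \<Longrightarrow> v = vzero (L2 M)"
proof -
  obtain \<Delta> where \<Delta>: "finite \<Delta>" "\<Delta> \<subseteq> dual G T" "isotypic_proj G M \<Delta> x = x"
    using finite_isotypic[OF x] by blast
  let ?S = "closed_span (L2 M) (\<Union>\<alpha>\<in>\<Delta>. isotypic G (L2 M) L \<alpha>)"
  obtain U C where U: "central_nbhd U" and C: "finite C" "0 \<notin> C"
    and SE: "?S \<subseteq> lin_span (\<Union>c\<in>C. eigen U c)"
    by (rule finite_isotypic_span[OF \<Delta>(1,2)])
  let ?E = "lin_span (\<Union>c\<in>C. eigen U c)"
  have "closed_subspace (L2 M) ?S" by (rule closed_subspace_closed_span) (use isotypic_V in blast)
  then have "orth_proj (L2 M) ?S x \<in> ?S" using orth_proj(1) D_V[OF x] by blast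
  then have xE: "x \<in> ?E" using \<Delta>(3) SE by (auto simp: isotypic_proj_def)
  have eV: "eigen U c \<subseteq> V" for c by (auto simp: eigen_def[OF U])
  have E: "fdim ?E" by (rule eigen_span_fdim[OF U C])
  have Elin: "linear_subspace (L2 M) ?E" using E by (simp add: fdim_def)
  have EL: "L g v \<in> ?E" if g: "g \<in> carrier G" and v: "v \<in> ?E" for g v
  proof -
    have "linear_subspace (L2 M) {v \<in> V. L g v \<in> ?E}"
      using subspaceD(3-5)[OF Elin] L_scl[OF g zero_closed, of 0] L_closed[OF g zero_closed]
      by (auto simp: linear_subspace_def L_add[OF g] L_scl[OF g])
    moreover have "(\<Union>c\<in>C. eigen U c) \<subseteq> {v \<in> V. L g v \<in> ?E}"
      using eV eigen_L[OF U g] lin_span_superset[of "\<Union>c\<in>C. eigen U c"] by blast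
    ultimately have "?E \<subseteq> {v \<in> V. L g v \<in> ?E}" by (rule lin_span_minimal)
    then show ?thesis using v by blast
  qed
  have inj: "v = vzero (L2 M)" if v: "v \<in> ?E" "K U v = vzero (L2 M)" for v
  proof -
    have vV: "v \<in> V" using subspaceD(2)[OF Elin v(1)] .
    have "ip u v = 0" if u: "u \<in> (\<Union>c\<in>C. eigen U c)" for u
    proof -
      obtain c where c: "c \<in> C" "u \<in> V" "K U u = of_real c \<odot> u" using u by (auto simp: eigen_def[OF U])
      have "of_real c * ip u v = ip (K U u) v" using c vV by simp
      also have "\<dots> = ip u (K U v)" by (rule K_sym[OF U c(2) vV])
      also have "\<dots> = 0" using v c by simp
      finally show ?thesis using c C by auto
    qed
    then have "ip v v = 0" using lin_span_orth[OF vV _ _ v(1)] eV by blast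
    then show ?thesis using inner_definite vV by blast
  qed
  have lin: "linear_subspace (L2 M) (D \<inter> ?E)" using D_lin Elin by (auto simp: linear_subspace_def)
  show ?thesis
  proof (rule that[OF U, of "D \<inter> ?E"])
    show "fdim (D \<inter> ?E)" by (rule fdim_subset[OF E lin]) blast
  qed (use x xE EL L_D inj in auto)
qed

section \<open>Convolution operators and the form\<close>

lemma K_fdim:
  assumes U: "central_nbhd U" and F: "fdim F" and FL: "\<And>g v. g \<in> carrier G \<Longrightarrow> v \<in> F \<Longrightarrow> L g v \<in> F"
    and v: "v \<in> F"
  shows "K U v \<in> F"
  by (rule K_invariant_subspace[OF central_sets[OF U] fdim_closed[OF F] FL v])

text \<open>\<open>D\<close> need not be closed, so an average of translates could leave it; it is
  caught by the closed invariant subspace \<open>F\<close> of \<open>D\<close>.\<close>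

lemma K_D:
  assumes U: "central_nbhd U" and x: "x \<in> D" shows "K U x \<in> D"
proof -
  obtain U' F where F: "central_nbhd U'" "fdim F" "F \<subseteq> D" "x \<in> F"
    and FL: "\<And>g v. g \<in> carrier G \<Longrightarrow> v \<in> F \<Longrightarrow> L g v \<in> F"
    using D_fdim[OF x] by metis
  show ?thesis using K_fdim[OF U F(2) FL F(4)] F(3) by blast
qed

lemma Q_fourier:
  assumes B: "orthonormal B" "B \<subseteq> D" and x: "x \<in> D"
  shows "Q x (fourier B y) = (\<Sum>b\<in>B. ip b y * Q x b)"
proof -
  have *: "Q x (vsum (\<lambda>b. a b \<odot> b) A) = (\<Sum>b\<in>A. a b * Q x b)" if "finite A" "A \<subseteq> D" for a A
    using that
  proof (induction A rule: finite_induct)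
    case empty
    show ?case using Q_rules(2)[OF x subspaceD(3)[OF D_lin], of 0] by simp
  next
    case (insert b A)
    have 1: "a b' \<odot> b' \<in> D" if "b' \<in> insert b A" for b'
      using that insert.prems subspaceD(5)[OF D_lin] by blast
    have 2: "vsum (\<lambda>b. a b \<odot> b) A \<in> D" by (rule vsum_in[OF D_lin insert.hyps(1)]) (use 1 in auto)
    have "vsum (\<lambda>b. a b \<odot> b) (insert b A) = a b \<odot> b \<oplus> vsum (\<lambda>b. a b \<odot> b) A"
      by (rule vsum_insert[OF insert.hyps]) (use 1 D_V in auto)
    then show ?case
      using Q_rules(1)[OF x 1 2] Q_rules(2)[OF x, of b "a b"] insert by simp
  qed
  show ?thesis unfolding fourier_def by (rule *[OF orthonormalD(1)[OF B(1)] B(2)])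
qed

text \<open>The orbit of \<open>y\<close> and its average lie in a finite-dimensional
  \<open>F\<close>. There \<open>Q x\<close> is a finite combination of the functionals
  \<open>ip b\<close>, for which measurability and the integral formula are already known.\<close>

lemma Q_K_weak:
  assumes U: "central_nbhd U" and x: "x \<in> D" and y: "y \<in> D"
  shows "Q x (K U y) = (\<integral>g. indicator U g * Q x (L g y) \<partial>M)"
    and "(\<lambda>g. Q x (L g y)) \<in> borel_measurable M"
proof -
  note Us = central_sets[OF U]
  obtain U' F where F: "central_nbhd U'" "fdim F" "F \<subseteq> D" "y \<in> F"
    and FL: "\<And>g v. g \<in> carrier G \<Longrightarrow> v \<in> F \<Longrightarrow> L g v \<in> F"
    using D_fdim[OF y] by metis
  obtain B where B: "B \<subseteq> F" "orthonormal B" "\<And>x. x \<in> F \<Longrightarrow> fourier B x = x"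
    using fdim_basis[OF F(2)] by metis
  have BD: "B \<subseteq> D" using B F by blast
  have BV: "b \<in> V" if "b \<in> B" for b using orthonormalD(2)[OF B(2) that] .
  have yV: "y \<in> V" by (rule D_V[OF y])
  have exp: "Q x v = (\<Sum>b\<in>B. ip b v * Q x b)" if "v \<in> F" for v
    using Q_fourier[OF B(2) BD x, of v] B(3)[OF that] by simp
  have QL: "Q x (L g y) = (\<Sum>b\<in>B. ip b (L g y) * Q x b)" if "g \<in> carrier G" for g
    by (rule exp[OF FL[OF that F(4)]])
  have "(\<lambda>g. \<Sum>b\<in>B. ip b (L g y) * Q x b) \<in> borel_measurable M"
    by (intro borel_measurable_sum borel_measurable_times borel_measurable_const ip_L_measurable BV yV)
  then show "(\<lambda>g. Q x (L g y)) \<in> borel_measurable M"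
    by (subst measurable_cong[where g = "\<lambda>g. \<Sum>b\<in>B. ip b (L g y) * Q x b"]) (simp_all add: QL space_M)
  have "Q x (K U y) = (\<Sum>b\<in>B. ip b (K U y) * Q x b)" by (rule exp[OF K_fdim[OF U F(2) FL F(4)]])
  also have "\<dots> = (\<Sum>b\<in>B. \<integral>g. indicator U g * ip b (L g y) * Q x b \<partial>M)"
    using K_weak[OF Us BV yV] by simp
  also have "\<dots> = (\<integral>g. (\<Sum>b\<in>B. indicator U g * ip b (L g y) * Q x b) \<partial>M)"
    by (rule Bochner_Integration.integral_sum[symmetric])
      (intro integrable_mult_left weighted_integrable[OF Us] BV yV)
  also have "\<dots> = (\<integral>g. indicator U g * Q x (L g y) \<partial>M)"
    by (rule Bochner_Integration.integral_cong) (simp_all add: space_M QL sum_distrib_left mult.assoc)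
  finally show "Q x (K U y) = (\<integral>g. indicator U g * Q x (L g y) \<partial>M)" .
qed

text \<open>The computation of \<open>K_sym\<close> with polarised invariance of \<open>Q\<close> in
  the place of unitarity.\<close>

lemma Q_K_sym:
  assumes U: "central_nbhd U" and x: "x \<in> D" and y: "y \<in> D"
  shows "Q (K U x) y = Q x (K U y)"
proof -
  note [measurable] = Q_K_weak(2)[OF U y x]
  have "Q x (K U y) = (\<integral>g. indicator U g * cnj (Q y (L (inv g) x)) \<partial>M)"
    unfolding Q_K_weak(1)[OF U x y]
  proof (rule Bochner_Integration.integral_cong[OF refl])
    fix g assume "g \<in> space M"
    then have g: "g \<in> carrier G" by (simp add: space_M)
    have ig: "inv g \<in> carrier G" using g by simp
    have "Q x (L g y) = Q (L (inv g) x) (L (inv g) (L g y))"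
      by (rule Q_L_polar[OF ig x L_D[OF g y], symmetric])
    also have "L (inv g) (L g y) = y" using L_mult[OF ig g D_V[OF y]] g L_one[OF D_V[OF y]] by simp
    also have "Q (L (inv g) x) y = cnj (Q y (L (inv g) x))" by (rule Q_rules(5)[OF L_D[OF ig x] y])
    finally show "indicator U g * Q x (L g y) = indicator U g * cnj (Q y (L (inv g) x))" by simp
  qed
  also have "\<dots> = (\<integral>g. indicator U g * cnj (Q y (L g x)) \<partial>M)"
    by (rule central_integral_inv[OF U]) measurable
  also have "\<dots> = (\<integral>g. cnj (indicator U g * Q y (L g x)) \<partial>M)"
    by (rule Bochner_Integration.integral_cong) (auto simp: indicator_def)
  also have "\<dots> = cnj (Q y (K U x))"
    unfolding Q_K_weak(1)[OF U y x] by (rule Bochner_Integration.integral_cnj)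
  also have "\<dots> = Q (K U x) y" by (rule Q_rules(5)[OF K_D[OF U x] y, symmetric])
  finally show ?thesis by simp
qed

text \<open>On a vector \<open>z\<close> orthogonal to the eigenspace, \<open>z = (K U - c) z'\<close> is solvable inside \<open>D\<close>.\<close>

lemma Q_orth_eigen:
  assumes U: "central_nbhd U" and y: "y \<in> D" "y \<in> eigen U c" and z: "z \<in> D"
    and orth: "\<And>u. u \<in> D \<Longrightarrow> u \<in> eigen U c \<Longrightarrow> ip u z = 0"
  shows "Q y z = 0"
proof -
  note Us = central_sets[OF U]
  obtain U' F where F: "central_nbhd U'" "fdim F" "F \<subseteq> D" "z \<in> F"
    and FL: "\<And>g v. g \<in> carrier G \<Longrightarrow> v \<in> F \<Longrightarrow> L g v \<in> F"
    using D_fdim[OF z] by metis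
  have Flin: "linear_subspace (L2 M) F" using F by (simp add: fdim_def)
  note FV = subspaceD(2)[OF Flin]
  \<comment> \<open>On \<open>F'\<close> the operator \<open>K U - c\<close> is injective, since a
    vector in its kernel would be an eigenvector orthogonal to itself; finite dimension makes it
    surjective.\<close>
  define F' where "F' = F \<inter> {u \<in> V. \<forall>w\<in>F \<inter> eigen U c. ip w u = 0}"
  have F'F: "u \<in> F" "u \<in> V" if "u \<in> F'" for u using that by (auto simp: F'_def)
  have F'o: "ip w u = 0" if "u \<in> F'" "w \<in> F" "w \<in> eigen U c" for u w using that by (auto simp: F'_def)
  have "linear_subspace (L2 M) {u \<in> V. \<forall>w\<in>F \<inter> eigen U c. ip w u = 0}"
    by (rule closed_subspaceD(1)[OF closed_subspace_weak]) (use FV in auto)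
  then have lin': "linear_subspace (L2 M) F'" using Flin unfolding F'_def by (auto simp: linear_subspace_def)
  have fd': "fdim F'" by (rule fdim_subset[OF F(2) lin']) (use F'F in blast)
  define A where "A u = K U u \<ominus> of_real c \<odot> u" for u
  have A_sym: "ip (A u) v = ip u (A v)" if "u \<in> V" "v \<in> V" for u v
    using that K_sym[OF U that] K_closed[OF Us] by (simp add: A_def)
  have op: "fdim_operator (L2 M) F' A"
  proof unfold_locales
    show "fdim F'" by (rule fd')
    show "A u \<in> F'" if u: "u \<in> F'" for u
    proof -
      have "A u \<in> F" unfolding A_def
        by (intro subspaceD(5,6)[OF Flin] K_fdim[OF U F(2) FL] F'F[OF u])
      moreover have "ip w (A u) = 0" if w: "w \<in> F" "w \<in> eigen U c" for w
      proof -
        have wV: "w \<in> V" by (rule FV[OF w(1)])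
        have "A w = vzero (L2 M)" using w wV by (simp add: A_def eigen_def[OF U])
        then show ?thesis using A_sym[OF wV F'F(2)[OF u]] F'F(2)[OF u] by simp
      qed
      ultimately show ?thesis using FV by (auto simp: F'_def)
    qed
    show "A (u \<oplus> v) = A u \<oplus> A v" if "u \<in> F'" "v \<in> F'" for u v
      by (rule ip_eqI)
        (use F'F that K_closed[OF Us] K_add[OF Us] in \<open>simp_all add: A_def algebra_simps\<close>)
    show "A (a \<odot> u) = a \<odot> A u" if "u \<in> F'" for a u
      by (rule ip_eqI)
        (use F'F that K_closed[OF Us] K_scl[OF Us] in \<open>simp_all add: A_def algebra_simps\<close>)
    show "ip (A u) v = ip u (A v)" if "u \<in> F'" "v \<in> F'" for u v
      by (rule A_sym) (use F'F that in auto)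
  qed
  have "z \<in> A ` F'"
  proof (rule fdim_operator.fdim_inj_surj[OF op])
    fix u assume u: "u \<in> F'" "A u = vzero (L2 M)"
    have "K U u = of_real c \<odot> u" using u(2) F'F[OF u(1)] K_closed[OF Us] by (simp add: A_def)
    then have "u \<in> eigen U c" using F'F[OF u(1)] by (simp add: eigen_def[OF U])
    then have "ip u u = 0" using F'o[OF u(1)] F'F[OF u(1)] by blast
    then show "u = vzero (L2 M)" using inner_definite F'F[OF u(1)] by blast
  next
    show "z \<in> F'" using F orth D_V[OF z] by (auto simp: F'_def)
  qed
  then obtain u where u: "u \<in> F'" "z = A u" by blast
  have uD: "u \<in> D" using F'F[OF u(1)] F(3) by blast
  \<comment> \<open>Moving \<open>K U - c\<close> over to the eigenvector \<open>y\<close>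
    annihilates it.\<close>
  have "Q y z = Q y (K U u) - Q y (of_real c \<odot> u)"
    unfolding u(2) A_def by (rule Q_sub[OF y(1) K_D[OF U uD] subspaceD(5)[OF D_lin uD]])
  also have "Q y (K U u) = Q (K U y) u" by (rule Q_K_sym[OF U y(1) uD, symmetric])
  also have "K U y = of_real c \<odot> y" using y by (simp add: eigen_def[OF U])
  finally show ?thesis using Q_rules(2)[OF y(1) uD] Q_rules(4)[OF y(1) uD] by simp
qed

text \<open>On a finite-dimensional space \<open>Q\<close> is represented by a symmetric operator,
  which is diagonalised. Its eigenvectors satisfy the defining equation of
  \<open>form_eigenspace\<close> only against \<open>?F\<close> at first. A general \<open>x\<close>
  in \<open>D\<close> is split into its projection \<open>p\<close> and a remainder orthogonal to
  \<open>?F\<close>, on which \<open>Q\<close> vanishes by \<open>Q_orth_eigen\<close>.\<close>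

lemma eigen_spanned:
  assumes U: "central_nbhd U" and c: "c \<noteq> 0"
  shows "D \<inter> eigen U c \<subseteq> lin_span (\<Union>l. form_eigenspace (L2 M) D Q l)"
proof -
  let ?F = "D \<inter> eigen U c"
  have "linear_subspace (L2 M) ?F"
    using D_lin closed_subspaceD(1)[OF eigen_closed[OF U]] by (auto simp: linear_subspace_def)
  then have F: "fdim ?F" by (rule fdim_subset[OF eigen_fdim[OF U c]]) blast
  have Flin: "linear_subspace (L2 M) ?F" using F by (simp add: fdim_def)
  obtain B where B: "B \<subseteq> ?F" "orthonormal B" "\<And>x. x \<in> ?F \<Longrightarrow> fourier B x = x"
    using fdim_basis[OF F] by metis
  have BD: "B \<subseteq> D" using B by blast
  have BV: "b \<in> V" if "b \<in> B" for b using orthonormalD(2)[OF B(2) that] .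
  have FV: "x \<in> V" if "x \<in> ?F" for x using that D_V by blast
  \<comment> \<open>The coefficients are those which give \<open>ip y (A x) = Q y x\<close> on
    \<open>?F\<close>, by expansion in the basis \<open>B\<close>.\<close>
  define A where "A x = vsum (\<lambda>b. Q b x \<odot> b) B" for x
  have AF: "A x \<in> ?F" for x unfolding A_def
    by (rule vsum_in[OF Flin orthonormalD(1)[OF B(2)]]) (use B(1) subspaceD(5)[OF Flin] in blast)
  have ipA: "ip z (A x) = (\<Sum>b\<in>B. Q b x * ip z b)" if "z \<in> V" for z x
    unfolding A_def by (subst ip_vsum_right) (use that BV orthonormalD(1)[OF B(2)] in auto)
  have QA: "ip y (A x) = Q y x" if x: "x \<in> ?F" and y: "y \<in> ?F" for x y
  proof -
    have xD: "x \<in> D" and yD: "y \<in> D" using x y by auto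
    have "Q y x = cnj (Q x y)" by (rule Q_rules(5)[OF yD xD])
    also have "Q x y = (\<Sum>b\<in>B. ip b y * Q x b)" using Q_fourier[OF B(2) BD xD, of y] B(3)[OF y] by simp
    also have "cnj \<dots> = (\<Sum>b\<in>B. Q b x * ip y b)"
      unfolding cnj_sum
    proof (rule sum.cong[OF refl])
      fix b assume b: "b \<in> B"
      have "Q b x = cnj (Q x b)" by (rule Q_rules(5)) (use b BD xD in auto)
      moreover have "ip y b = cnj (ip b y)" by (rule inner_commute[OF FV[OF y] BV[OF b]])
      ultimately show "cnj (ip b y * Q x b) = Q b x * ip y b" by simp
    qed
    also have "\<dots> = ip y (A x)" by (rule ipA[OF FV[OF y], symmetric])
    finally show ?thesis by simp
  qed
  have op: "fdim_operator (L2 M) ?F A"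
  proof unfold_locales
    show "fdim ?F" by (rule F)
    show "A x \<in> ?F" for x by (rule AF)
    fix x y assume x: "x \<in> ?F" and y: "y \<in> ?F"
    show "A (x \<oplus> y) = A x \<oplus> A y"
    proof (rule ip_eqI)
      fix z assume z: "z \<in> V"
      have "(\<Sum>b\<in>B. Q b (x \<oplus> y) * ip z b) = (\<Sum>b\<in>B. Q b x * ip z b + Q b y * ip z b)"
        by (rule sum.cong[OF refl]) (use Q_rules(1) BD x y in \<open>auto simp: distrib_right\<close>)
      then show "ip z (A (x \<oplus> y)) = ip z (A x \<oplus> A y)"
        using z FV[OF AF] by (simp add: ipA sum.distrib)
    qed (use FV[OF AF] in auto)
    show "A (a \<odot> x) = a \<odot> A x" for a
    proof (rule ip_eqI)
      fix z assume z: "z \<in> V"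
      have "(\<Sum>b\<in>B. Q b (a \<odot> x) * ip z b) = (\<Sum>b\<in>B. a * (Q b x * ip z b))"
        by (rule sum.cong[OF refl]) (use Q_rules(2) BD x in \<open>auto simp: mult.assoc\<close>)
      then show "ip z (A (a \<odot> x)) = ip z (a \<odot> A x)"
        using z FV[OF AF] by (simp add: ipA sum_distrib_left)
    qed (use FV[OF AF] in auto)
    have "ip (A x) y = cnj (ip y (A x))" by (rule inner_commute[OF FV[OF AF] FV[OF y]])
    also have "\<dots> = Q x y" using QA[OF x y] Q_rules(5)[of x y] x y by simp
    also have "\<dots> = ip x (A y)" by (rule QA[OF y x, symmetric])
    finally show "ip (A x) y = ip x (A y)" .
  qed
  have "v \<in> form_eigenspace (L2 M) D Q l" if v: "v \<in> ?F" "A v = of_real l \<odot> v" for v l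
    unfolding form_eigenspace_def
  proof (intro CollectI conjI ballI)
    show vD: "v \<in> D" using v by blast
    have vV: "v \<in> V" by (rule FV[OF v(1)])
    fix x assume x: "x \<in> D"
    have xV: "x \<in> V" by (rule D_V[OF x])
    note cl = fdim_closed[OF F]
    define p where "p = orth_proj (L2 M) ?F x"
    have p: "p \<in> ?F" unfolding p_def by (rule orth_proj(1)[OF cl xV])
    have pD: "p \<in> D" and pV: "p \<in> V" using p FV by auto
    have o: "ip u (x \<ominus> p) = 0" if "u \<in> ?F" for u unfolding p_def by (rule orth_proj(2)[OF cl xV that])
    have "Q v (x \<ominus> p) = 0"
      by (rule Q_orth_eigen[OF U vD _ subspaceD(6)[OF D_lin x pD], of c]) (use v o in auto)
    then have "Q v x = Q v p" using Q_sub[OF vD x pD] by simp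
    also have "\<dots> = cnj (Q p v)" by (rule Q_rules(5)[OF vD pD])
    also have "Q p v = of_real l * ip p v" using QA[OF v(1) p] v(2) pV vV by simp
    also have "cnj \<dots> = of_real l * ip v p" using inner_commute[OF vV pV] by simp
    also have "ip v p = ip v x" using o[OF v(1)] vV xV pV by simp
    finally show "Q v x = of_real l * ip v x" .
  qed
  then have "{v \<in> ?F. \<exists>l. A v = complex_of_real l \<odot> v} \<subseteq> lin_span (\<Union>l. form_eigenspace (L2 M) D Q l)"
    using lin_span_superset[of "\<Union>l. form_eigenspace (L2 M) D Q l"] by blast
  moreover have "linear_subspace (L2 M) (lin_span (\<Union>l. form_eigenspace (L2 M) D Q l))"
    by (rule linear_subspace_lin_span) (auto simp: form_eigenspace_def D_V)
  ultimately show ?thesis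
    using fdim_operator.fdim_eigenvectors_span[OF op] lin_span_minimal by (meson order_trans)
qed

text \<open>Diagonalise \<open>K U\<close> on a finite-dimensional \<open>F\<close> around
  \<open>x\<close>. Injectivity on \<open>F\<close> rules out nonzero eigenvectors for the
  eigenvalue 0, so every nonzero one is covered by \<open>eigen_spanned\<close>. \<open>U\<close>
  varies with \<open>x\<close> while the target span does not.\<close>

lemma D_spanned: "D \<subseteq> lin_span (\<Union>l. form_eigenspace (L2 M) D Q l)"
proof
  let ?W = "lin_span (\<Union>l. form_eigenspace (L2 M) D Q l)"
  have W: "linear_subspace (L2 M) ?W"
    by (rule linear_subspace_lin_span) (auto simp: form_eigenspace_def D_V)
  fix x assume x: "x \<in> D"
  obtain U F where U: "central_nbhd U" and F: "fdim F" "F \<subseteq> D" "x \<in> F"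
    and FL: "\<And>g v. g \<in> carrier G \<Longrightarrow> v \<in> F \<Longrightarrow> L g v \<in> F"
    and inj: "\<And>v. v \<in> F \<Longrightarrow> K U v = vzero (L2 M) \<Longrightarrow> v = vzero (L2 M)"
    using D_fdim[OF x] by metis
  note Us = central_sets[OF U]
  have FV: "v \<in> V" if "v \<in> F" for v using that F(2) D_V by blast
  have op: "fdim_operator (L2 M) F (K U)"
  proof unfold_locales
    show "fdim F" by (rule F(1))
    show "K U v \<in> F" if "v \<in> F" for v by (rule K_fdim[OF U F(1) FL that])
  qed (use K_add[OF Us] K_scl[OF Us] K_sym[OF U] FV in auto)
  have "v \<in> ?W" if v: "v \<in> F" "K U v = complex_of_real c \<odot> v" for v c
  proof (cases "c = 0")
    case True
    then have "v = vzero (L2 M)" using inj[OF v(1)] v(2) FV[OF v(1)] by simp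
    then show ?thesis using subspaceD(3)[OF W] by simp
  next
    case False
    have "v \<in> D \<inter> eigen U c" using v F(2) FV[OF v(1)] by (auto simp: eigen_def[OF U])
    then show ?thesis using eigen_spanned[OF U False] by blast
  qed
  then have "{v \<in> F. \<exists>c. K U v = complex_of_real c \<odot> v} \<subseteq> ?W" by blast
  then have "F \<subseteq> ?W"
    using fdim_operator.fdim_eigenvectors_span[OF op] lin_span_minimal[OF W] by (meson order_trans)
  then show "x \<in> ?W" using F(3) by blast
qed

theorem strongly_representable: "\<exists>DA A. strongly_representable (L2 M) D Q DA A"
proof -
  have "diagonal_form (L2 M) D Q"
    by unfold_locales (use herm D_spanned in auto)
  then show ?thesis using diagonal_form.strongly_representable_A by blast
qed

end

theorem proposition5p10:
  fixes G :: "('g, 'm) monoid_scheme"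
    and T :: "'g topology"
    and M :: "'g measure"
    and D :: "('g \<Rightarrow> complex) set set"
    and Q :: "('g \<Rightarrow> complex) set \<Rightarrow> ('g \<Rightarrow> complex) set \<Rightarrow> complex"
  assumes "compact_metrisable_group G T"
    and "haar_measure G T M"
    and "hermitian_form (L2 M) D Q"
    and "closable_form (L2 M) D Q"
    and "\<forall>\<Phi>\<in>D. \<exists>\<Delta>\<subseteq>dual G T.
           emeasure (count_space (dual G T)) \<Delta> < \<infinity> \<and> isotypic_proj G M \<Delta> \<Phi> = \<Phi>"
    and "\<forall>g\<in>carrier G. \<forall>\<Phi>\<in>D. left_regular G M g \<Phi> \<in> D \<and>
           Q (left_regular G M g \<Phi>) (left_regular G M g \<Phi>) = Q \<Phi> \<Phi>"
  shows "\<exists>DA A. strongly_representable (L2 M) D Q DA A"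
proof -
  have fin: "\<exists>\<Delta>\<subseteq>dual G T. finite \<Delta> \<and> isotypic_proj G M \<Delta> x = x" if x: "x \<in> D" for x
  proof -
    obtain \<Delta> where \<Delta>: "\<Delta> \<subseteq> dual G T" "emeasure (count_space (dual G T)) \<Delta> < \<infinity>" "isotypic_proj G M \<Delta> x = x"
      using assms(5) x by blast
    have "finite \<Delta>" using \<Delta>(1,2) by (auto simp: emeasure_count_space split: if_splits)
    then show ?thesis using \<Delta> by blast
  qed
  have "haar_group G T M"
    using assms(1,2) by (simp add: haar_group_def haar_group_axioms_def)
  then have "invariant_form G T M D Q"
    using assms(3,6) fin by (simp add: invariant_form_def invariant_form_axioms_def)
  then show ?thesis by (rule invariant_form.strongly_representable)
qed

end
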